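(* Let $\mathcal{A}$ be a finite set, let $h$ be a penalty function on $\mathcal{X}=\Delta(\mathcal{A})$ with strong convexity constant $K$ and induced choice map $Q$, and let $X(t)$ be generated by the unilateral stochastically perturbed reinforcement learning process $$dY_\alpha(t)=v_\alpha(t)\,dt+\sigma_\alpha(t)\,dW_\alpha(t)\quad(\alpha\in\mathcal{A}),\qquad X(t)=Q(\eta(t)Y(t)),$$ with initial bias $Y(0)=0$ and with a learning parameter $\eta:[0,\infty)\to(0,\infty)$ that is $C^1$-smooth, nonincreasing, and satisfies $\lim_{t\to\infty}t\,\eta(t)=+\infty$ and $\lim_{t\to\infty}\eta(t)=0$. Then the process is consistent, i.e. $$\limsup_{t\to\infty}\frac1t\operatorname{Reg}(t)\le 0\quad\text{(a.s.)},$$ and it enjoys the cumulative regret bound $$\operatorname{Reg}(t)\le\frac{\Omega}{\eta(t)}+\sigma_{\max}^2\,\frac{|\mathcal{A}|}{2K}\int_0^t\eta(s)\,ds+\mathcal{O}\big(\sigma_{\max}\sqrt{t\log\log t}\big),$$ where $\Omega=\max\{h(x)-h(x'):x,x'\in\mathcal{X}\}$ and $\sigma_{\max}=\sup_t\max_\beta\sigma_\beta(t)$.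
   Context: $\mathcal{X}=\Delta(\mathcal{A})$ is the simplex of probability measures on $\mathcal{A}$, viewed in $\mathbb{R}^{\mathcal{A}}$. A penalty function $h:\mathcal{X}\to\mathbb{R}$ is a function that is continuous on $\mathcal{X}$, smooth on the relative interior of every face of $\mathcal{X}$, and strongly convex with constant $K>0$: $h(tx+(1-t)x')\le t h(x)+(1-t)h(x')-\tfrac12 K t(1-t)\|x'-x\|^2$ for all $x,x'\in\mathcal{X}$, $t\in[0,1]$ ($\|\cdot\|$ the Euclidean norm). The induced choice map is $Q(y)=\arg\max_{x\in\mathcal{X}}\{\langle y,x\rangle-h(x)\}$, $y\in\mathbb{R}^{\mathcal{A}}$. $v(t)=(v_\alpha(t))_{\alpha\in\mathcal{A}}$ is an arbitrary locally integrable stream of payoff vectors, $W(t)=(W_\alpha(t))_{\alpha\in\mathcal{A}}$ is a Wiener process in $\mathbb{R}^{\mathcal{A}}$ (independent components), and the noise coefficients $\sigma_\alpha(t)\ge0$ are continuous and bounded. The cumulative regret is $\operatorname{Reg}(t)=\max_{\alpha\in\mathcal{A}}\int_0^t v_\alpha(s)\,ds-\int_0^t\langle v(s),X(s)\rangle\,ds$. A statement $f(t)=\mathcal{O}(g(t))$ (as $t\to\infty$) for stochastic processes is meant in the almost sure sense: a.s. there exist a constant $C$ and a (random) $t_0$ with $|f(t)|\le C|g(t)|$ for all $t\ge t_0$. *)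

theory Defs
  imports "HOL-Probability.Probability" "HOL-Library.Landau_Symbols"
begin

unbundle vec_syntax

section \<open>Penalty functions and choice maps\<close>

definition prob_simplex :: "(real ^ 'n) set" where
  "prob_simplex = {x. (\<forall>\<alpha>. 0 \<le> x $ \<alpha>) \<and> (\<Sum>\<alpha>\<in>UNIV. x $ \<alpha>) = 1}"

text \<open>\<open>Ck_on k U f\<close> is meant for open \<open>U\<close>; on a set that is not open it is a different notion.\<close>

primrec Ck_on :: "nat \<Rightarrow> 'v::euclidean_space set \<Rightarrow> ('v \<Rightarrow> real) \<Rightarrow> bool" where
  "Ck_on 0 U f \<longleftrightarrow> continuous_on U f"
| "Ck_on (Suc k) U f \<longleftrightarrow> f differentiable_on U \<and>
     (\<forall>b\<in>Basis. Ck_on k U (\<lambda>x. frechet_derivative f (at x) b))"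

text \<open>Smoothness on a relatively open subset of an affine subspace, such as the relative interior
  of a face: the function is the restriction of a smooth function on an ambient open set.\<close>

definition smooth_on_relopen :: "'v::euclidean_space set \<Rightarrow> ('v \<Rightarrow> real) \<Rightarrow> bool" where
  "smooth_on_relopen S f \<longleftrightarrow>
     (\<exists>U g. open U \<and> S \<subseteq> U \<and> (\<forall>k. Ck_on k U g) \<and> (\<forall>x\<in>S. g x = f x))"

definition strongly_convex_on :: "'v::real_normed_vector set \<Rightarrow> real \<Rightarrow> ('v \<Rightarrow> real) \<Rightarrow> bool" where
  "strongly_convex_on S K h \<longleftrightarrow>
     (\<forall>x\<in>S. \<forall>x'\<in>S. \<forall>t\<in>{0..1}.
        h (t *\<^sub>R x + (1 - t) *\<^sub>R x')
          \<le> t * h x + (1 - t) * h x' - 1/2 * K * t * (1 - t) * (norm (x' - x))\<^sup>2)"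

definition penalty_function :: "real \<Rightarrow> (real ^ 'n \<Rightarrow> real) \<Rightarrow> bool" where
  "penalty_function K h \<longleftrightarrow>
     continuous_on prob_simplex h \<and>
     (\<forall>S. S face_of prob_simplex \<longrightarrow> smooth_on_relopen (rel_interior S) h) \<and>
     K > 0 \<and> strongly_convex_on prob_simplex K h"

definition choice_map :: "(real ^ 'n \<Rightarrow> real) \<Rightarrow> real ^ 'n \<Rightarrow> real ^ 'n" where
  "choice_map h y = arg_max_on (\<lambda>x. y \<bullet> x - h x) prob_simplex"

definition penalty_range :: "(real ^ 'n \<Rightarrow> real) \<Rightarrow> real" where
  "penalty_range h = Sup {h x - h x' | x x'. x \<in> prob_simplex \<and> x' \<in> prob_simplex}"

section \<open>Processes driven by Brownian motion\<close>

text \<open>All processes are indexed by \<open>real\<close>, but only times \<open>t \<ge> 0\<close> are used.\<close>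

definition adapted_process ::
    "(real \<Rightarrow> 'w measure) \<Rightarrow> (real \<Rightarrow> 'w \<Rightarrow> 'b::topological_space) \<Rightarrow> bool" where
  "adapted_process F Z \<longleftrightarrow> (\<forall>t\<ge>0. Z t \<in> borel_measurable (F t))"

definition progressively_measurable ::
    "(real \<Rightarrow> 'w measure) \<Rightarrow> (real \<Rightarrow> 'w \<Rightarrow> 'b::topological_space) \<Rightarrow> bool" where
  "progressively_measurable F Z \<longleftrightarrow>
     (\<forall>t\<ge>0. (\<lambda>(s, \<omega>). Z s \<omega>) \<in> borel_measurable (restrict_space borel {0..t} \<Otimes>\<^sub>M F t))"

text \<open>A standard Wiener process relative to the filtration \<open>F\<close>. The components are independent
  processes: jointly, all increments over disjoint intervals are independent across both time
  and coordinates.\<close>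

definition wiener_process ::
    "'w measure \<Rightarrow> (real \<Rightarrow> 'w measure) \<Rightarrow> (real \<Rightarrow> 'w \<Rightarrow> real ^ 'n) \<Rightarrow> bool" where
  "wiener_process M F W \<longleftrightarrow>
     adapted_process F W \<and>
     (AE \<omega> in M. W 0 \<omega> = 0) \<and>
     (AE \<omega> in M. continuous_on {0..} (\<lambda>t. W t \<omega>)) \<and>
     (\<forall>s t. 0 \<le> s \<and> s < t \<longrightarrow>
        prob_space.indep_set M (sets (F s))
          {(\<lambda>\<omega>. W t \<omega> - W s \<omega>) -` B \<inter> space M | B. B \<in> sets borel} \<and>
        prob_space.indep_vars M (\<lambda>_. borel) (\<lambda>\<alpha> \<omega>. (W t \<omega> - W s \<omega>) $ \<alpha>) UNIV \<and>
        (\<forall>\<alpha>. distributed M lborel (\<lambda>\<omega>. (W t \<omega> - W s \<omega>) $ \<alpha>) (normal_density 0 (sqrt (t - s)))))"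

text \<open>\<open>partition_mesh t \<delta> n p\<close>: \<open>0 = p 0 \<le> \<dots> \<le> p n = t\<close> is a partition of mesh less than \<open>\<delta>\<close>.\<close>

definition partition_mesh :: "real \<Rightarrow> real \<Rightarrow> nat \<Rightarrow> (nat \<Rightarrow> real) \<Rightarrow> bool" where
  "partition_mesh t \<delta> n p \<longleftrightarrow>
     p 0 = 0 \<and> p n = t \<and> (\<forall>i<n. p i \<le> p (Suc i) \<and> p (Suc i) - p i < \<delta>)"

text \<open>\<open>I\<close> is (a continuous version of) the Ito integral process of \<open>H\<close> against the scalar Brownian
  motion \<open>B\<close>. For a continuous adapted integrand the Ito integral over \<open>[0, t]\<close> is the limit in
  probability of the left-endpoint Riemann sums as the mesh tends to \<open>0\<close>; this is used as the
  definition, so the predicate is meant for such integrands only.\<close>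

definition ito_integral ::
    "'w measure \<Rightarrow> (real \<Rightarrow> 'w \<Rightarrow> real) \<Rightarrow> (real \<Rightarrow> 'w \<Rightarrow> real) \<Rightarrow> (real \<Rightarrow> 'w \<Rightarrow> real) \<Rightarrow> bool" where
  "ito_integral M B H I \<longleftrightarrow>
     (\<forall>t\<ge>0. I t \<in> borel_measurable M) \<and>
     (AE \<omega> in M. continuous_on {0..} (\<lambda>t. I t \<omega>)) \<and>
     (\<forall>t\<ge>0. \<forall>\<epsilon>>0. \<exists>\<delta>>0. \<forall>n p. partition_mesh t \<delta> n p \<longrightarrow>
        measure M {\<omega> \<in> space M.
          \<epsilon> < \<bar>(\<Sum>i<n. H (p i) \<omega> * (B (p (Suc i)) \<omega> - B (p i) \<omega>)) - I t \<omega>\<bar>} < \<epsilon>)"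

text \<open>The system \<open>dY\<^sub>\<alpha> = v\<^sub>\<alpha> dt + \<sigma>\<^sub>\<alpha> dW\<^sub>\<alpha>\<close> with \<open>Y(0) = 0\<close>, in integral form.\<close>

definition score_process ::
    "'w measure \<Rightarrow> (real \<Rightarrow> 'w \<Rightarrow> real ^ 'n) \<Rightarrow> (real \<Rightarrow> 'w \<Rightarrow> real ^ 'n) \<Rightarrow>
     (real \<Rightarrow> 'w \<Rightarrow> real ^ 'n) \<Rightarrow> (real \<Rightarrow> 'w \<Rightarrow> real ^ 'n) \<Rightarrow> bool" where
  "score_process M W v \<sigma> Y \<longleftrightarrow>
     (AE \<omega> in M. Y 0 \<omega> = 0) \<and>
     (\<exists>I. \<forall>\<alpha>.
        ito_integral M (\<lambda>t \<omega>. W t \<omega> $ \<alpha>) (\<lambda>t \<omega>. \<sigma> t \<omega> $ \<alpha>) (I \<alpha>) \<and>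
        (AE \<omega> in M. \<forall>t\<ge>0. Y t \<omega> $ \<alpha> = (LINT s:{0..t}|lborel. v s \<omega> $ \<alpha>) + I \<alpha> t \<omega>))"

section \<open>Regret\<close>

definition Reg :: "(real \<Rightarrow> real ^ 'n) \<Rightarrow> (real \<Rightarrow> real ^ 'n) \<Rightarrow> real \<Rightarrow> real" where
  "Reg v x t = (MAX \<alpha>. LINT s:{0..t}|lborel. v s $ \<alpha>) - (LINT s:{0..t}|lborel. v s \<bullet> x s)"

definition sigma_max :: "(real \<Rightarrow> real ^ 'n) \<Rightarrow> real" where
  "sigma_max \<sigma> = (SUP t\<in>{0..}. MAX \<alpha>. \<sigma> t $ \<alpha>)"

end

theory Submission
  imports Defs "HOL-Real_Asymp.Real_Asymp"
begin

text \<open>No stochastic calculus is needed. Strong convexity makes the perturbed maximum of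
  \<open>\<langle>y, x\<rangle> - h x\<close> a function with Lipschitz gradient, so on a grid of mesh \<open>2\<^sup>-\<^sup>m\<close> it
  satisfies a one-sided second order Taylor inequality, and summing it over the grid bounds the
  regret by \<open>\<Omega> / \<eta>\<close>, a quadratic term and martingale transforms of the Wiener increments. This is
  done for the scores in which the Ito integrals are replaced by their left endpoint sums, so that
  every integrand is adapted; the sums converge to the Ito integrals almost everywhere in time and
  probability along a subsequence, which suffices to pass to the limit in the payoff integral. The
  quadratic term tends to the integral of \<open>\<eta>\<close>, and the transforms have Gaussian tails uniformly in
  the mesh, so that Borel--Cantelli along the times \<open>2\<^sup>j\<close> yields the iterated logarithm rate.\<close>

section \<open>Choice maps\<close>

text \<open>Strong convexity only makes the conjugate of \<open>h\<close> differentiable with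
  Lipschitz gradient, which is too little for a second order Ito formula, while the one-sided Taylor
  inequality survives on a grid. The Ito integrals \<open>I\<close> are only known to be measurable
  with respect to \<open>M\<close>, not to the filtration, so a choice computed from them could not
  serve as the integrand of a martingale transform. Two volatility bounds coexist: the random
  \<open>sigma_max\<close> enters the quadratic term path by path, the deterministic
  \<open>C\<close> enters the tails. Their quotient is absorbed by the random constant of the O-term
  on paths with positive \<open>sigma_max\<close>; paths with \<open>sigma_max\<close> equal to 0
  need an argument of their own, since there the error must vanish. The mesh tends to 0 at fixed
  times of a coarse dyadic grid, and only afterwards is the coarse grid refined. Both passages are
  free of cost: an event that occurs eventually along a sequence of events has at most their common
  probability bound.\<close>

lemma prob_simplexD:
  assumes "x \<in> prob_simplex"
  shows "0 \<le> x $ \<alpha>" "x $ \<alpha> \<le> 1" "(\<Sum>\<alpha>\<in>UNIV. x $ \<alpha>) = 1"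
proof -
  show *: "0 \<le> x $ \<alpha>" "(\<Sum>\<alpha>\<in>UNIV. x $ \<alpha>) = 1" for \<alpha>
    using assms by (auto simp: prob_simplex_def)
  have "x $ \<alpha> \<le> (\<Sum>\<alpha>\<in>UNIV. x $ \<alpha>)"
    by (rule member_le_sum) (auto simp: *)
  then show "x $ \<alpha> \<le> 1" using * by simp
qed

lemma axis_in_prob_simplex: "axis \<alpha> 1 \<in> prob_simplex"
  by (auto simp: prob_simplex_def axis_def)

lemma norm_prob_simplex_le:
  assumes "x \<in> prob_simplex" shows "norm x \<le> 1"
  using norm_le_l1_cart[of x] prob_simplexD[OF assms] by simp

lemma compact_prob_simplex: "compact (prob_simplex :: (real ^ 'n) set)"
proof -
  have "prob_simplex = (\<Inter>\<alpha>. {x :: real ^ 'n. 0 \<le> x $ \<alpha>}) \<inter> {x. (\<Sum>\<alpha>\<in>UNIV. x $ \<alpha>) = 1}"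
    by (auto simp: prob_simplex_def)
  moreover have "closed \<dots>"
    by (intro closed_Int closed_INT ballI closed_Collect_le closed_Collect_eq continuous_intros)
  moreover have "bounded (prob_simplex :: (real ^ 'n) set)"
    using norm_prob_simplex_le by (auto simp: bounded_iff)
  ultimately show ?thesis by (simp add: compact_eq_bounded_closed)
qed

lemma convex_prob_simplex_comb:
  assumes "x \<in> prob_simplex" "y \<in> prob_simplex" "0 \<le> t" "t \<le> 1"
  shows "t *\<^sub>R x + (1 - t) *\<^sub>R y \<in> prob_simplex"
  using assms
  by (auto simp: prob_simplex_def sum.distrib simp flip: sum_distrib_left)

lemma penalty_functionD:
  assumes "penalty_function K h"
  shows "continuous_on prob_simplex h" "K > 0" "strongly_convex_on prob_simplex K h"
  using assms by (auto simp: penalty_function_def)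

text \<open>Compactness and continuity provide a maximiser, so the Hilbert choice hidden in
  \<open>arg_max_on\<close> really selects one.\<close>

lemma choice_map_is_max:
  assumes "penalty_function K h"
  shows "choice_map h y \<in> prob_simplex"
    and "x \<in> prob_simplex \<Longrightarrow> y \<bullet> x - h x \<le> y \<bullet> choice_map h y - h (choice_map h y)"
proof -
  let ?f = "\<lambda>x. y \<bullet> x - h x"
  have "continuous_on prob_simplex ?f"
    using penalty_functionD(1)[OF assms] by (intro continuous_intros)
  then obtain x0 where "x0 \<in> prob_simplex" "\<forall>x\<in>prob_simplex. ?f x \<le> ?f x0"
    using continuous_attains_sup[OF compact_prob_simplex _] axis_in_prob_simplex by blast
  then have "is_arg_max ?f (\<lambda>x. x \<in> prob_simplex) x0"
    by (auto simp: is_arg_max_linorder)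
  then have "is_arg_max ?f (\<lambda>x. x \<in> prob_simplex) (choice_map h y)"
    unfolding choice_map_def arg_max_on_def arg_max_def by (rule someI)
  then show "choice_map h y \<in> prob_simplex"
    and "x \<in> prob_simplex \<Longrightarrow> y \<bullet> x - h x \<le> y \<bullet> choice_map h y - h (choice_map h y)"
    by (auto simp: is_arg_max_linorder)
qed

text \<open>Quadratic growth at the maximiser \<open>q\<close>: optimality is tested at t x + (1 -
  t) q, where strong convexity yields an extra K/2 t (1 - t) d. Dividing by t and letting t tend to
  0 leaves the full constant K/2.\<close>

lemma choice_map_gap:
  assumes "penalty_function K h" "x \<in> prob_simplex"
  shows "y \<bullet> x - h x + K / 2 * (norm (x - choice_map h y))\<^sup>2
    \<le> y \<bullet> choice_map h y - h (choice_map h y)"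
proof -
  define q where "q = choice_map h y"
  define d where "d = (norm (x - q))\<^sup>2"
  have q: "q \<in> prob_simplex" unfolding q_def by (rule choice_map_is_max[OF assms(1)])
  have *: "y \<bullet> x - h x + K / 2 * (1 - t) * d \<le> y \<bullet> q - h q" if t: "0 < t" "t < 1" for t
  proof -
    have "h (t *\<^sub>R x + (1 - t) *\<^sub>R q) \<le> t * h x + (1 - t) * h q - 1/2 * K * t * (1 - t) * d"
      using penalty_functionD(3)[OF assms(1)] assms(2) q t
      by (auto simp: strongly_convex_on_def d_def norm_minus_commute)
    moreover have "y \<bullet> (t *\<^sub>R x + (1 - t) *\<^sub>R q) - h (t *\<^sub>R x + (1 - t) *\<^sub>R q) \<le> y \<bullet> q - h q"
      unfolding q_def using t assms(2) q[unfolded q_def]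
      by (intro choice_map_is_max(2)[OF assms(1)] convex_prob_simplex_comb) auto
    ultimately have "t * (y \<bullet> x - h x + K / 2 * (1 - t) * d) \<le> t * (y \<bullet> q - h q)"
      by (simp add: inner_add_right algebra_simps)
    then show ?thesis using t by simp
  qed
  have "((\<lambda>t. y \<bullet> x - h x + K / 2 * (1 - t) * d) \<longlongrightarrow> y \<bullet> x - h x + K / 2 * (1 - 0) * d) (at_right 0)"
    by (intro tendsto_intros)
  moreover have "\<forall>\<^sub>F t in at_right 0. y \<bullet> x - h x + K / 2 * (1 - t) * d \<le> y \<bullet> q - h q"
    using * by (auto simp: eventually_at_right_field intro!: exI[of _ 1])
  ultimately have "y \<bullet> x - h x + K / 2 * (1 - 0) * d \<le> y \<bullet> q - h q"
    by (rule tendsto_upperbound) simp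
  then show ?thesis by (simp add: d_def q_def)
qed

text \<open>Each maximiser is tested in the other one's problem. In the sum of the two gap
  inequalities the penalties cancel and the two halves of K add up; Cauchy-Schwarz does the
  rest.\<close>

lemma choice_map_lipschitz:
  assumes "penalty_function K h"
  shows "norm (choice_map h y - choice_map h z) \<le> norm (y - z) / K"
proof -
  let ?q = "choice_map h y" and ?r = "choice_map h z"
  note K = penalty_functionD(2)[OF assms]
  have "K * (norm (?q - ?r))\<^sup>2 \<le> (y - z) \<bullet> (?q - ?r)"
    using choice_map_gap[OF assms choice_map_is_max(1)[OF assms], of y z]
      choice_map_gap[OF assms choice_map_is_max(1)[OF assms], of z y]
    by (simp add: norm_minus_commute inner_diff_left inner_diff_right)
  also have "\<dots> \<le> norm (y - z) * norm (?q - ?r)" by (rule norm_cauchy_schwarz)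
  finally have "norm (?q - ?r) * (K * norm (?q - ?r)) \<le> norm (?q - ?r) * norm (y - z)"
    by (simp add: power2_eq_square algebra_simps)
  then have "K * norm (?q - ?r) \<le> norm (y - z)"
    using K by (cases "?q = ?r") (auto simp: mult_le_cancel_left)
  then show ?thesis using K by (simp add: field_simps)
qed

lemma continuous_on_choice_map:
  assumes "penalty_function K h"
  shows "continuous_on S (choice_map h)"
proof -
  have "(1/K)-lipschitz_on UNIV (choice_map h)"
    using choice_map_lipschitz[OF assms] penalty_functionD(2)[OF assms]
    by (intro lipschitz_onI) (auto simp: dist_norm)
  then have "continuous_on UNIV (choice_map h)"
    by (rule lipschitz_on_continuous_on)
  then show ?thesis by (rule continuous_on_subset) simp
qed

lemma choice_map_measurable [measurable]:
  assumes "penalty_function K h"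
  shows "choice_map h \<in> borel_measurable borel"
  by (rule borel_measurable_continuous_onI[OF continuous_on_choice_map[OF assms]])

section \<open>Regret of a discrete sequence of scores\<close>

lemma penalty_range_ge:
  assumes "penalty_function K h" "x \<in> prob_simplex" "x' \<in> prob_simplex"
  shows "h x - h x' \<le> penalty_range h"
proof -
  have "compact (h ` prob_simplex)"
    using penalty_functionD(1)[OF assms(1)] compact_prob_simplex by (rule compact_continuous_image)
  then obtain B where B: "\<And>x. x \<in> prob_simplex \<Longrightarrow> \<bar>h x\<bar> \<le> B"
    using compact_imp_bounded bounded_iff by (metis imageI real_norm_def)
  have "bdd_above {h x - h x' | x x'. x \<in> prob_simplex \<and> x' \<in> prob_simplex}"
    using B by (intro bdd_aboveI[of _ "B + B"]) (smt (verit) mem_Collect_eq)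
  then show ?thesis
    unfolding penalty_range_def using assms by (intro cSup_upper) auto
qed

text \<open>The potential is \<open>max\<^sub>x (y \<bullet> x - (h x - min h) / \<eta>)\<close>: a step of the scores raises it by the
  first-order term plus a quadratic error, while lowering \<open>\<eta>\<close> can only lower it.\<close>

lemma discrete_regret_bound:
  fixes y :: "nat \<Rightarrow> real ^ 'n"
  assumes h: "penalty_function K h" and y0: "y 0 = 0"
    and pos: "\<And>i. e i > 0" and dec: "\<And>i. e (Suc i) \<le> e i"
  shows "y k $ \<alpha> \<le> penalty_range h / e k
    + (\<Sum>i<k. choice_map h (e i *\<^sub>R y i) \<bullet> (y (Suc i) - y i))
    + (\<Sum>i<k. e i / (2 * K) * (norm (y (Suc i) - y i))\<^sup>2)"
proof -
  obtain z where z: "z \<in> prob_simplex" "\<And>x. x \<in> prob_simplex \<Longrightarrow> h z \<le> h x"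
    using continuous_attains_inf[OF compact_prob_simplex _ penalty_functionD(1)[OF h]]
      axis_in_prob_simplex by blast
  note K = penalty_functionD(2)[OF h]
  define q where "q i = choice_map h (e i *\<^sub>R y i)" for i
  define G where "G i = y i \<bullet> q i - (h (q i) - h z) / e i" for i
  have q: "q i \<in> prob_simplex" for i unfolding q_def by (rule choice_map_is_max[OF h])
  have opt: "y i \<bullet> x - (h x - h z) / e i + K / (2 * e i) * (norm (x - q i))\<^sup>2 \<le> G i"
    if "x \<in> prob_simplex" for x i
  proof -
    have "e i * (y i \<bullet> x - (h x - h z) / e i + K / (2 * e i) * (norm (x - q i))\<^sup>2)
        = (e i *\<^sub>R y i) \<bullet> x - h x + K / 2 * (norm (x - q i))\<^sup>2 + h z"
      using pos[of i] by (simp add: field_simps)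
    also have "\<dots> \<le> (e i *\<^sub>R y i) \<bullet> q i - h (q i) + h z"
      using choice_map_gap[OF h that, of "e i *\<^sub>R y i"] by (simp add: q_def)
    also have "\<dots> = e i * G i"
      using pos[of i] by (simp add: G_def field_simps)
    finally have "e i * (y i \<bullet> x - (h x - h z) / e i + K / (2 * e i) * (norm (x - q i))\<^sup>2) \<le> e i * G i" .
    then show ?thesis using pos[of i] by simp
  qed
  have step: "G (Suc i) \<le> G i + q i \<bullet> (y (Suc i) - y i) + e i / (2 * K) * (norm (y (Suc i) - y i))\<^sup>2"
    for i
  proof -
    define x where "x = q (Suc i)"
    define d where "d = y (Suc i) - y i"
    have x: "x \<in> prob_simplex" by (simp add: x_def q)
    \<comment> \<open>Subtracting the minimum \<open>h z\<close> makes the numerator nonnegative;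
      otherwise a smaller rate could raise the potential.\<close>
    have "(h x - h z) / e i \<le> (h x - h z) / e (Suc i)"
      using z(2)[OF x] pos dec[of i] by (intro divide_left_mono) auto
    then have "G (Suc i) \<le> y i \<bullet> x - (h x - h z) / e i + d \<bullet> x"
      by (simp add: G_def x_def[symmetric] d_def inner_diff_left)
    also have "\<dots> \<le> G i - K / (2 * e i) * (norm (x - q i))\<^sup>2 + d \<bullet> x"
      using opt[OF x, of i] by simp
    also have "\<dots> = G i + q i \<bullet> d + (d \<bullet> (x - q i) - K / (2 * e i) * (norm (x - q i))\<^sup>2)"
      by (simp add: inner_diff_right inner_commute)
    \<comment> \<open>Young's inequality, written as a square: the quadratic gain in
      \<open>opt\<close> pays for the first-order effect of moving from \<open>q i\<close> to the
      new maximiser \<open>x\<close>.\<close>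
    also have "d \<bullet> (x - q i) - K / (2 * e i) * (norm (x - q i))\<^sup>2 \<le> e i / (2 * K) * (norm d)\<^sup>2"
    proof -
      have "d \<bullet> (x - q i) \<le> norm d * norm (x - q i)" by (rule norm_cauchy_schwarz)
      moreover have "0 \<le> (e i * norm d - K * norm (x - q i))\<^sup>2 / (2 * K * e i)"
        using K pos[of i] by simp
      moreover have "(e i * norm d - K * norm (x - q i))\<^sup>2 / (2 * K * e i)
          = e i / (2 * K) * (norm d)\<^sup>2 - norm d * norm (x - q i) + K / (2 * e i) * (norm (x - q i))\<^sup>2"
        using K pos[of i] by (simp add: power2_eq_square field_simps)
      ultimately show ?thesis by linarith
    qed
    finally show ?thesis by (simp add: d_def)
  qed
  have "G k \<le> (\<Sum>i<k. q i \<bullet> (y (Suc i) - y i)) + (\<Sum>i<k. e i / (2 * K) * (norm (y (Suc i) - y i))\<^sup>2)"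
  proof (induction k)
    case 0
    show ?case using z(2)[OF q[of 0]] pos[of 0] by (simp add: G_def y0)
  next
    case (Suc k)
    then show ?case using step[of k] by simp
  qed
  \<comment> \<open>Testing the final potential at the vertex of \<alpha> recovers the score of
    \<alpha>, at the price of one penalty difference divided by the last rate.\<close>
  moreover have "y k $ \<alpha> \<le> penalty_range h / e k + G k"
  proof -
    have "y k $ \<alpha> - (h (axis \<alpha> 1) - h z) / e k \<le> G k"
      using opt[OF axis_in_prob_simplex[of \<alpha>], of k] K pos[of k]
      by (simp add: inner_axis) (smt (verit) divide_nonneg_pos zero_le_power2 mult_nonneg_nonneg)
    moreover have "(h (axis \<alpha> 1) - h z) / e k \<le> penalty_range h / e k"
      using penalty_range_ge[OF h axis_in_prob_simplex z(1)] pos[of k]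
      by (intro divide_right_mono) (auto simp: less_imp_le)
    ultimately show ?thesis by linarith
  qed
  ultimately show ?thesis by (simp add: q_def)
qed

section \<open>Gaussian random walks\<close>

text \<open>The martingale transform (discrete stochastic integral) of \<open>H\<close> against the
  increments \<xi>.\<close>

definition walk :: "(nat \<Rightarrow> 'a \<Rightarrow> real) \<Rightarrow> (nat \<Rightarrow> 'a \<Rightarrow> real) \<Rightarrow> nat \<Rightarrow> 'a \<Rightarrow> real" where
  "walk \<xi> H k \<omega> = (\<Sum>i<k. H i \<omega> * \<xi> i \<omega>)"

text \<open>The increments are tied to the filtration by adaptedness one step later and by
  independence from the past; this is what is needed to integrate out the newest increment with
  everything earlier frozen.\<close>

locale gaussian_walk = prob_space M for M :: "'a measure" +
  fixes G :: "nat \<Rightarrow> 'a measure" and \<xi> :: "nat \<Rightarrow> 'a \<Rightarrow> real" and \<Delta> :: real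
  assumes subalg: "\<And>i. subalgebra M (G i)"
    and sets_mono: "\<And>i j. i \<le> j \<Longrightarrow> sets (G i) \<subseteq> sets (G j)"
    and step_pos: "\<Delta> > 0"
    and incr_measurable: "\<And>i. \<xi> i \<in> borel_measurable (G (Suc i))"
    and incr_distributed: "\<And>i. distributed M lborel (\<xi> i) (normal_density 0 (sqrt \<Delta>))"
    and incr_indep: "\<And>i. indep_set (sets (G i)) {\<xi> i -` B \<inter> space M | B. B \<in> sets borel}"
begin

lemma measurable_mono: "i \<le> j \<Longrightarrow> f \<in> measurable (G i) N \<Longrightarrow> f \<in> measurable (G j) N"
  using sets_mono[of i j] subalg[of i] subalg[of j]
  by (metis measurable_from_subalg subalgebra_def)

lemma measurable_from_G: "f \<in> measurable (G i) N \<Longrightarrow> f \<in> measurable M N"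
  using measurable_from_subalg[OF subalg] .

lemma incr_random_variable [measurable]: "random_variable borel (\<xi> i)"
  using measurable_from_G[OF incr_measurable] .

lemma indep_var_incr:
  assumes X: "X \<in> measurable (G i) N" and f[measurable]: "f \<in> measurable borel N'"
  shows "indep_var N X N' (\<lambda>\<omega>. f (\<xi> i \<omega>))"
proof -
  have sp: "space (G i) = space M" using subalg[of i] by (simp add: subalgebra_def)
  let ?A = "{X -` A \<inter> space M | A. A \<in> sets N}"
  let ?B = "{(\<lambda>\<omega>. f (\<xi> i \<omega>)) -` A \<inter> space M | A. A \<in> sets N'}"
  let ?V = "vimage_algebra (space M) (\<xi> i) borel"
  have "?A \<subseteq> sets (G i)"
    using measurable_sets[OF X] sp by auto
  then have "sigma_sets (space M) ?A \<subseteq> sets (G i)"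
    using sets.sigma_sets_subset[of ?A "G i"] sp by simp
  moreover have "(\<lambda>\<omega>. f (\<xi> i \<omega>)) \<in> measurable ?V N'"
    by (rule measurable_compose[OF measurable_vimage_algebra1 f]) simp
  then have "?B \<subseteq> sets ?V"
    by (auto dest: measurable_sets)
  then have "sigma_sets (space M) ?B \<subseteq> sets ?V"
    using sets.sigma_sets_subset[of ?B ?V] by simp
  moreover have "sets ?V = {\<xi> i -` B \<inter> space M | B. B \<in> sets borel}"
    by (simp add: sets_vimage_algebra2)
  ultimately have "indep_set (sigma_sets (space M) ?A) (sigma_sets (space M) ?B)"
    using incr_indep[of i] unfolding indep_set_def
    by (elim indep_sets_mono_sets) (auto split: bool.split)
  then show ?thesis using measurable_from_G[OF X] by (simp add: indep_var_eq)
qed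

text \<open>Completing the square: tilting the centred normal density by exp (u x) shifts its mean
  to u \<Delta> and leaves the constant factor.\<close>

lemma nn_integral_exp_incr:
  "(\<integral>\<^sup>+\<omega>. ennreal (exp (u * \<xi> i \<omega>)) \<partial>M) = ennreal (exp (u\<^sup>2 * \<Delta> / 2))"
proof -
  have *: "normal_density 0 (sqrt \<Delta>) x * exp (u * x)
      = exp (u\<^sup>2 * \<Delta> / 2) * normal_density (u * \<Delta>) (sqrt \<Delta>) x" for x
  proof -
    have "- x\<^sup>2 / (2 * \<Delta>) + u * x = u\<^sup>2 * \<Delta> / 2 + - (x - u * \<Delta>)\<^sup>2 / (2 * \<Delta>)"
      using step_pos by (simp add: field_simps power2_eq_square)
    then show ?thesis
      using step_pos by (simp add: normal_density_def mult.left_commute flip: exp_add)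
  qed
  have "(\<integral>\<^sup>+\<omega>. ennreal (exp (u * \<xi> i \<omega>)) \<partial>M)
      = (\<integral>\<^sup>+x. normal_density 0 (sqrt \<Delta>) x * ennreal (exp (u * x)) \<partial>lborel)"
    by (subst distributed_nn_integral[OF incr_distributed]) auto
  also have "\<dots> = (\<integral>\<^sup>+x. exp (u\<^sup>2 * \<Delta> / 2) * ennreal (normal_density (u * \<Delta>) (sqrt \<Delta>) x) \<partial>lborel)"
    by (intro nn_integral_cong) (simp add: ennreal_mult[symmetric] *)
  also have "\<dots> = exp (u\<^sup>2 * \<Delta> / 2) * (\<integral>\<^sup>+x. ennreal (normal_density (u * \<Delta>) (sqrt \<Delta>) x) \<partial>lborel)"
    by (rule nn_integral_cmult) auto
  also have "(\<integral>\<^sup>+x. ennreal (normal_density (u * \<Delta>) (sqrt \<Delta>) x) \<partial>lborel) = 1"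
    using step_pos by (subst nn_integral_eq_integral) auto
  finally show ?thesis by simp
qed

text \<open>Stands in for conditioning on \<open>G i\<close>: by independence the joint law is a
  product, and Fubini integrates out the increment while \<open>Z\<close> and \<open>H\<close> are
  held fixed. Nonnegative integrals avoid any integrability question.\<close>

lemma nn_integral_exp_step:
  assumes Z: "Z \<in> borel_measurable (G i)" and H: "H \<in> borel_measurable (G i)"
  shows "(\<integral>\<^sup>+\<omega>. Z \<omega> * ennreal (exp (H \<omega> * \<xi> i \<omega>)) \<partial>M)
    = (\<integral>\<^sup>+\<omega>. Z \<omega> * ennreal (exp ((H \<omega>)\<^sup>2 * \<Delta> / 2)) \<partial>M)"
proof -
  let ?N = "borel \<Otimes>\<^sub>M borel :: (ennreal \<times> real) measure"
  \<comment> \<open>The constant 0 pads the increment to the value type of \<open>?X\<close>,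
    because \<open>indep_var\<close> relates variables with values in one common type.\<close>
  let ?X = "\<lambda>\<omega>. (Z \<omega>, H \<omega>)" and ?Y = "\<lambda>\<omega>. (0::ennreal, \<xi> i \<omega>)"
  have X: "?X \<in> measurable (G i) ?N" using Z H by simp
  have X'[measurable]: "?X \<in> measurable M ?N" using X by (rule measurable_from_G)
  interpret P: prob_space "distr M ?N ?Y" by (rule prob_space_distr) simp
  let ?f = "\<lambda>p :: (ennreal \<times> real) \<times> (ennreal \<times> real). fst (fst p) * ennreal (exp (snd (fst p) * snd (snd p)))"
  have eq: "distr M ?N ?X \<Otimes>\<^sub>M distr M ?N ?Y = distr M (?N \<Otimes>\<^sub>M ?N) (\<lambda>\<omega>. (?X \<omega>, ?Y \<omega>))"
    using indep_var_incr[OF X, of "\<lambda>x. (0, x)" ?N] by (simp add: indep_var_distribution_eq)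
  have "(\<integral>\<^sup>+\<omega>. Z \<omega> * ennreal (exp (H \<omega> * \<xi> i \<omega>)) \<partial>M)
      = (\<integral>\<^sup>+p. ?f p \<partial>distr M (?N \<Otimes>\<^sub>M ?N) (\<lambda>\<omega>. (?X \<omega>, ?Y \<omega>)))"
    by (subst nn_integral_distr) auto
  also have "\<dots> = (\<integral>\<^sup>+p. ?f p \<partial>(distr M ?N ?X \<Otimes>\<^sub>M distr M ?N ?Y))" by (simp add: eq)
  also have "\<dots> = (\<integral>\<^sup>+q. \<integral>\<^sup>+x. ?f (q, x) \<partial>distr M ?N ?Y \<partial>distr M ?N ?X)"
    by (rule P.nn_integral_fst[symmetric]) measurable
  also have "\<dots> = (\<integral>\<^sup>+q. fst q * ennreal (exp ((snd q)\<^sup>2 * \<Delta> / 2)) \<partial>distr M ?N ?X)"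
  proof (intro nn_integral_cong)
    fix q :: "ennreal \<times> real"
    have "(\<integral>\<^sup>+x. ?f (q, x) \<partial>distr M ?N ?Y) = (\<integral>\<^sup>+\<omega>. fst q * ennreal (exp (snd q * \<xi> i \<omega>)) \<partial>M)"
      by (subst nn_integral_distr) auto
    also have "\<dots> = fst q * ennreal (exp ((snd q)\<^sup>2 * \<Delta> / 2))"
      by (simp add: nn_integral_cmult nn_integral_exp_incr)
    finally show "(\<integral>\<^sup>+x. ?f (q, x) \<partial>distr M ?N ?Y) = fst q * ennreal (exp ((snd q)\<^sup>2 * \<Delta> / 2))" .
  qed
  also have "\<dots> = (\<integral>\<^sup>+\<omega>. Z \<omega> * ennreal (exp ((H \<omega>)\<^sup>2 * \<Delta> / 2)) \<partial>M)"
    by (subst nn_integral_distr) auto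
  finally show ?thesis .
qed

section \<open>Exponential tails of walks with bounded integrands\<close>

lemma walk_measurable:
  assumes "\<And>i. H i \<in> borel_measurable (G i)"
  shows "walk \<xi> H k \<in> borel_measurable (G k)"
  unfolding walk_def
  by (intro borel_measurable_sum borel_measurable_times)
    (auto intro: measurable_mono[OF _ assms] measurable_mono[OF _ incr_measurable])

text \<open>The exponential supermartingale in discrete form: integrating out the last increment
  leaves a factor depending on \<open>H k\<close>, and the uniform bound \<open>c\<close> makes that
  factor deterministic, so that it can be pulled out.\<close>

lemma nn_integral_exp_walk:
  assumes H: "\<And>i. H i \<in> borel_measurable (G i)"
    and bound: "\<And>i \<omega>. \<omega> \<in> space M \<Longrightarrow> \<bar>H i \<omega>\<bar> \<le> c"
  shows "(\<integral>\<^sup>+\<omega>. ennreal (exp (u * walk \<xi> H k \<omega>)) \<partial>M) \<le> ennreal (exp (u\<^sup>2 * c\<^sup>2 * \<Delta> * real k / 2))"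
proof (induction k)
  case 0
  show ?case by (simp add: walk_def emeasure_space_1)
next
  case (Suc k)
  note W[measurable] = walk_measurable[of H k, OF H]
  note H[measurable]
  let ?E = "\<lambda>\<omega>. ennreal (exp (u * walk \<xi> H k \<omega>))"
  have "(\<integral>\<^sup>+\<omega>. ennreal (exp (u * walk \<xi> H (Suc k) \<omega>)) \<partial>M)
      = (\<integral>\<^sup>+\<omega>. ?E \<omega> * ennreal (exp ((u * H k \<omega>) * \<xi> k \<omega>)) \<partial>M)"
    by (simp add: walk_def distrib_left exp_add ennreal_mult mult.assoc)
  also have "\<dots> = (\<integral>\<^sup>+\<omega>. ?E \<omega> * ennreal (exp ((u * H k \<omega>)\<^sup>2 * \<Delta> / 2)) \<partial>M)"
    by (rule nn_integral_exp_step) measurable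
  also have "\<dots> \<le> (\<integral>\<^sup>+\<omega>. ?E \<omega> * ennreal (exp (u\<^sup>2 * c\<^sup>2 * \<Delta> / 2)) \<partial>M)"
  proof (intro nn_integral_mono mult_left_mono ennreal_leI)
    fix \<omega> assume "\<omega> \<in> space M"
    then have "(H k \<omega>)\<^sup>2 \<le> c\<^sup>2" using bound[of \<omega> k] by (simp add: abs_le_square_iff[symmetric])
    then show "exp ((u * H k \<omega>)\<^sup>2 * \<Delta> / 2) \<le> exp (u\<^sup>2 * c\<^sup>2 * \<Delta> / 2)"
      using step_pos by (simp add: power_mult_distrib mult_left_mono mult_right_mono)
  qed simp
  also have "\<dots> = (\<integral>\<^sup>+\<omega>. ?E \<omega> \<partial>M) * ennreal (exp (u\<^sup>2 * c\<^sup>2 * \<Delta> / 2))"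
    by (rule nn_integral_multc) (use measurable_from_G[OF W] in measurable)
  also have "\<dots> \<le> ennreal (exp (u\<^sup>2 * c\<^sup>2 * \<Delta> * real k / 2)) * ennreal (exp (u\<^sup>2 * c\<^sup>2 * \<Delta> / 2))"
    by (intro mult_right_mono Suc.IH) simp
  also have "\<dots> = ennreal (exp (u\<^sup>2 * c\<^sup>2 * \<Delta> * real (Suc k) / 2))"
    by (simp add: ennreal_mult[symmetric] exp_add[symmetric] field_simps)
  finally show ?case .
qed

lemma prob_walk_ge:
  assumes H: "\<And>i. H i \<in> borel_measurable (G i)"
    and bound: "\<And>i \<omega>. \<omega> \<in> space M \<Longrightarrow> \<bar>H i \<omega>\<bar> \<le> c"
    and "c > 0" "a > 0" "n > 0"
  shows "prob {\<omega> \<in> space M. a \<le> walk \<xi> H n \<omega>} \<le> exp (- a\<^sup>2 / (2 * c\<^sup>2 * \<Delta> * real n))"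
proof -
  \<comment> \<open>The minimiser of the Chernoff exponent - u a + u^2 c^2 \<Delta> n / 2.\<close>
  define u where "u = a / (c\<^sup>2 * \<Delta> * real n)"
  have u: "u > 0" using assms step_pos by (simp add: u_def)
  note W[measurable] = measurable_from_G[OF walk_measurable[of H n, OF H]]
  have "emeasure M {\<omega> \<in> space M. a \<le> walk \<xi> H n \<omega>}
      = emeasure M {\<omega> \<in> space M. 1 \<le> ennreal (exp (- u * a)) * ennreal (exp (u * walk \<xi> H n \<omega>))}"
    using u by (intro arg_cong[where f = "emeasure M"])
      (auto simp: ennreal_mult[symmetric] exp_add[symmetric] algebra_simps simp del: ennreal_1 simp flip: ennreal_1)
  also have "\<dots> \<le> ennreal (exp (- u * a)) * (\<integral>\<^sup>+\<omega>. ennreal (exp (u * walk \<xi> H n \<omega>)) * indicator (space M) \<omega> \<partial>M)"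
    by (rule nn_integral_Markov_inequality[of _ "space M", simplified]) auto
  also have "\<dots> \<le> ennreal (exp (- u * a)) * ennreal (exp (u\<^sup>2 * c\<^sup>2 * \<Delta> * real n / 2))"
    using nn_integral_exp_walk[OF H bound, of u n]
    by (intro mult_left_mono) (auto cong: nn_integral_cong)
  also have "\<dots> = ennreal (exp (- u * a + u\<^sup>2 * c\<^sup>2 * \<Delta> * real n / 2))"
    by (simp add: ennreal_mult[symmetric] flip: exp_add)
  also have "- u * a + u\<^sup>2 * c\<^sup>2 * \<Delta> * real n / 2 = - a\<^sup>2 / (2 * c\<^sup>2 * \<Delta> * real n)"
    using assms step_pos by (simp add: u_def field_simps power2_eq_square)
  finally show ?thesis by (simp add: emeasure_eq_measure)
qed

text \<open>Doob's maximal inequality for this exponential bound: switching the integrand off as soon as the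
  walk has reached \<open>a\<close> gives an adapted integrand again, whose walk ends at or above \<open>a\<close>.\<close>

lemma prob_walk_max_ge:
  assumes H: "\<And>i. H i \<in> borel_measurable (G i)"
    and bound: "\<And>i \<omega>. \<omega> \<in> space M \<Longrightarrow> \<bar>H i \<omega>\<bar> \<le> c"
    and "c > 0" "a > 0" "n > 0"
  shows "prob {\<omega> \<in> space M. \<exists>k\<le>n. a \<le> walk \<xi> H k \<omega>} \<le> exp (- a\<^sup>2 / (2 * c\<^sup>2 * \<Delta> * real n))"
proof -
  \<comment> \<open>The test includes index \<open>i\<close> itself: \<open>walk \<xi> H i\<close>
    contains only increments before \<open>i\<close>, so the decision about term \<open>i\<close> is
    already known in \<open>G i\<close>. Once the level has been reached, all later terms are
    0.\<close>
  define H' where "H' i \<omega> = (if \<forall>k\<le>i. walk \<xi> H k \<omega> < a then H i \<omega> else 0)" for i \<omega>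
  have H': "H' i \<in> borel_measurable (G i)" for i
  proof -
    have [measurable]: "walk \<xi> H k \<in> borel_measurable (G i)" if "k \<le> i" for k
      using measurable_mono[OF that walk_measurable[OF H]] .
    have "Measurable.pred (G i) (\<lambda>\<omega>. \<forall>k\<in>{..i}. walk \<xi> H k \<omega> < a)"
      by (intro pred_intros_finite) (auto intro!: borel_measurable_pred_less)
    then show ?thesis unfolding H'_def using H by (auto intro: measurable_If)
  qed
  have b': "\<bar>H' i \<omega>\<bar> \<le> c" if "\<omega> \<in> space M" for i \<omega>
    using bound[OF that] \<open>c > 0\<close> by (simp add: H'_def)
  have stop: "a \<le> walk \<xi> H' n \<omega>" if "k \<le> n" "a \<le> walk \<xi> H k \<omega>" for k \<omega>
  proof -
    define t where "t = (LEAST k. a \<le> walk \<xi> H k \<omega>)"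
    have t: "a \<le> walk \<xi> H t \<omega>" "t \<le> k" using that(2) unfolding t_def by (auto intro: LeastI Least_le)
    have less: "walk \<xi> H j \<omega> < a" if "j < t" for j
      using not_less_Least[OF that[unfolded t_def]] by simp
    have "walk \<xi> H' n \<omega> = (\<Sum>i<t. H' i \<omega> * \<xi> i \<omega>)"
      unfolding walk_def using t that(1)
      by (intro sum.mono_neutral_right) (auto simp: H'_def not_less intro!: exI[of _ t])
    also have "\<dots> = walk \<xi> H t \<omega>"
      unfolding walk_def[of \<xi> H t] H'_def using less by (intro sum.cong) auto
    finally show ?thesis using t by simp
  qed
  have [measurable]: "walk \<xi> H' n \<in> borel_measurable M"
    using measurable_from_G[OF walk_measurable[OF H']] .
  have "prob {\<omega> \<in> space M. \<exists>k\<le>n. a \<le> walk \<xi> H k \<omega>} \<le> prob {\<omega> \<in> space M. a \<le> walk \<xi> H' n \<omega>}"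
    using stop by (intro finite_measure_mono) auto
  also have "\<dots> \<le> exp (- a\<^sup>2 / (2 * c\<^sup>2 * \<Delta> * real n))"
    by (rule prob_walk_ge[OF H' b' assms(3-5)])
  finally show ?thesis .
qed

lemma prob_abs_walk_max_ge:
  assumes H: "\<And>i. H i \<in> borel_measurable (G i)"
    and bound: "\<And>i \<omega>. \<omega> \<in> space M \<Longrightarrow> \<bar>H i \<omega>\<bar> \<le> c"
    and "c > 0" "a > 0" "n > 0"
  shows "prob {\<omega> \<in> space M. \<exists>k\<le>n. a \<le> \<bar>walk \<xi> H k \<omega>\<bar>} \<le> 2 * exp (- a\<^sup>2 / (2 * c\<^sup>2 * \<Delta> * real n))"
proof -
  let ?A = "\<lambda>H. {\<omega> \<in> space M. \<exists>k\<le>n. a \<le> walk \<xi> H k \<omega>}"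
  let ?mH = "\<lambda>i \<omega>. - H i \<omega>"
  have mH: "?mH i \<in> borel_measurable (G i)" for i using H by simp
  have neg: "walk \<xi> ?mH k \<omega> = - walk \<xi> H k \<omega>" for k \<omega> by (simp add: walk_def sum_negf)
  have A: "?A H' \<in> events" if "\<And>i. H' i \<in> borel_measurable (G i)" for H'
  proof -
    have [measurable]: "walk \<xi> H' k \<in> borel_measurable M" for k
      using measurable_from_G[OF walk_measurable[OF that]] .
    show ?thesis by measurable
  qed
  have "{\<omega> \<in> space M. \<exists>k\<le>n. a \<le> \<bar>walk \<xi> H k \<omega>\<bar>} = ?A H \<union> ?A ?mH"
    unfolding neg using \<open>a > 0\<close> by (auto simp: abs_real_def split: if_splits)
  then have "prob {\<omega> \<in> space M. \<exists>k\<le>n. a \<le> \<bar>walk \<xi> H k \<omega>\<bar>} = prob (?A H \<union> ?A ?mH)"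
    by (rule arg_cong)
  also have "\<dots> \<le> prob (?A H) + prob (?A ?mH)"
    by (rule measure_Un_le[OF A[OF H] A[OF mH]])
  also have "prob (?A H) \<le> exp (- a\<^sup>2 / (2 * c\<^sup>2 * \<Delta> * real n))"
    by (rule prob_walk_max_ge[OF H bound assms(3-5)])
  also have "prob (?A ?mH) \<le> exp (- a\<^sup>2 / (2 * c\<^sup>2 * \<Delta> * real n))"
    by (rule prob_walk_max_ge[OF mH _ assms(3-5)]) (simp add: bound)
  finally show ?thesis by simp
qed

section \<open>Fluctuation of the quadratic variation\<close>

lemma incr_moments:
  shows "integrable M (\<lambda>\<omega>. (\<xi> i \<omega>)\<^sup>2 - \<Delta>)"
    and "expectation (\<lambda>\<omega>. (\<xi> i \<omega>)\<^sup>2 - \<Delta>) = 0"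
    and "integrable M (\<lambda>\<omega>. ((\<xi> i \<omega>)\<^sup>2 - \<Delta>)\<^sup>2)"
    and "expectation (\<lambda>\<omega>. ((\<xi> i \<omega>)\<^sup>2 - \<Delta>)\<^sup>2) = 2 * \<Delta>\<^sup>2"
proof -
  have pos: "0 < sqrt \<Delta>" using step_pos by simp
  have mom: "integrable M (\<lambda>\<omega>. \<xi> i \<omega> ^ (2 * k))"
    "expectation (\<lambda>\<omega>. \<xi> i \<omega> ^ (2 * k)) = fact (2 * k) / ((2 / \<Delta>) ^ k * fact k)" for k
    using normal_moment_even[OF pos, of 0 k] step_pos
      distributed_integrable[OF incr_distributed, of "\<lambda>x. x ^ (2 * k)" i]
      distributed_integral[OF incr_distributed, of "\<lambda>x. x ^ (2 * k)" i]
    by (auto simp: has_bochner_integral_iff)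
  have m2: "integrable M (\<lambda>\<omega>. (\<xi> i \<omega>)\<^sup>2)" "expectation (\<lambda>\<omega>. (\<xi> i \<omega>)\<^sup>2) = \<Delta>"
    using mom[of 1] by (auto simp: fact_numeral)
  have m4: "integrable M (\<lambda>\<omega>. \<xi> i \<omega> ^ 4)" "expectation (\<lambda>\<omega>. \<xi> i \<omega> ^ 4) = 3 * \<Delta>\<^sup>2"
    using mom[of 2] by (auto simp: fact_numeral power2_eq_square)
  show "integrable M (\<lambda>\<omega>. (\<xi> i \<omega>)\<^sup>2 - \<Delta>)" "expectation (\<lambda>\<omega>. (\<xi> i \<omega>)\<^sup>2 - \<Delta>) = 0"
    using m2 by (auto simp: prob_space)
  have eq: "((\<xi> i \<omega>)\<^sup>2 - \<Delta>)\<^sup>2 = \<xi> i \<omega> ^ 4 - 2 * \<Delta> * (\<xi> i \<omega>)\<^sup>2 + \<Delta>\<^sup>2" for \<omega>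
    by (simp add: power2_eq_square algebra_simps power4_eq_xxxx)
  show "integrable M (\<lambda>\<omega>. ((\<xi> i \<omega>)\<^sup>2 - \<Delta>)\<^sup>2)" "expectation (\<lambda>\<omega>. ((\<xi> i \<omega>)\<^sup>2 - \<Delta>)\<^sup>2) = 2 * \<Delta>\<^sup>2"
    unfolding eq using m2 m4 by (auto simp: prob_space power2_eq_square)
qed

text \<open>Cross terms vanish: the partial sum is measurable with respect to \<open>G k\<close>,
  and the next compensated square is centred and independent of it.\<close>

lemma weighted_squares_variance:
  shows "integrable M (\<lambda>\<omega>. (\<Sum>i<k. w i * ((\<xi> i \<omega>)\<^sup>2 - \<Delta>))\<^sup>2)"
    and "expectation (\<lambda>\<omega>. (\<Sum>i<k. w i * ((\<xi> i \<omega>)\<^sup>2 - \<Delta>))\<^sup>2) = 2 * \<Delta>\<^sup>2 * (\<Sum>i<k. (w i)\<^sup>2)"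
proof (induction k)
  case (Suc k)
  let ?S = "\<lambda>\<omega>. \<Sum>i<k. w i * ((\<xi> i \<omega>)\<^sup>2 - \<Delta>)" and ?q = "\<lambda>\<omega>. (\<xi> k \<omega>)\<^sup>2 - \<Delta>"
  have S: "?S \<in> borel_measurable (G k)"
    by (intro borel_measurable_sum borel_measurable_times borel_measurable_diff borel_measurable_power)
      (auto intro: measurable_mono[OF _ incr_measurable])
  have iS: "integrable M ?S"
    by (intro Bochner_Integration.integrable_sum integrable_mult_right incr_moments)
  have ind: "indep_var borel ?S borel ?q"
    using indep_var_incr[OF S, of "\<lambda>x. x\<^sup>2 - \<Delta>" borel] by simp
  have cross: "integrable M (\<lambda>\<omega>. ?S \<omega> * ?q \<omega>)" "expectation (\<lambda>\<omega>. ?S \<omega> * ?q \<omega>) = 0"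
    using indep_var_integrable[OF ind iS incr_moments(1)]
      indep_var_lebesgue_integral[OF ind iS incr_moments(1)] incr_moments(2) by auto
  have eq: "(\<Sum>i<Suc k. w i * ((\<xi> i \<omega>)\<^sup>2 - \<Delta>))\<^sup>2
      = (?S \<omega>)\<^sup>2 + (2 * w k) * (?S \<omega> * ?q \<omega>) + (w k)\<^sup>2 * (?q \<omega>)\<^sup>2" for \<omega>
    by (simp add: power2_eq_square algebra_simps)
  show "integrable M (\<lambda>\<omega>. (\<Sum>i<Suc k. w i * ((\<xi> i \<omega>)\<^sup>2 - \<Delta>))\<^sup>2)"
    unfolding eq
    by (intro Bochner_Integration.integrable_add integrable_mult_right Suc.IH(1) cross incr_moments)
  show "expectation (\<lambda>\<omega>. (\<Sum>i<Suc k. w i * ((\<xi> i \<omega>)\<^sup>2 - \<Delta>))\<^sup>2) = 2 * \<Delta>\<^sup>2 * (\<Sum>i<Suc k. (w i)\<^sup>2)"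
    unfolding eq
    by (simp del: sum_power2_eq_zero_iff add: Suc.IH cross incr_moments distrib_left)
qed (simp_all)

end

section \<open>Dyadic grids\<close>

text \<open>Dyadic meshes are nested: point \<open>j\<close> of level \<open>l\<close> is point
  \<open>j * 2 ^ (m - l)\<close> of every finer level \<open>m\<close>, so a fixed grid time can be
  followed as the mesh shrinks.\<close>

definition grid :: "nat \<Rightarrow> nat \<Rightarrow> real" where
  "grid m i = real i / 2 ^ m"

definition grid_index :: "nat \<Rightarrow> real \<Rightarrow> nat" where
  "grid_index m s = nat \<lfloor>s * 2 ^ m\<rfloor>"

lemma grid_simps [simp]: "0 \<le> grid m i" "grid m 0 = 0" "grid m i \<le> grid m j \<longleftrightarrow> i \<le> j"
  by (auto simp: grid_def field_simps)

lemma grid_Suc: "grid m (Suc i) = grid m i + 1 / 2 ^ m"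
  by (simp add: grid_def field_simps)

lemma grid_index_bounds:
  assumes "0 \<le> s"
  shows "grid m (grid_index m s) \<le> s" "s < grid m (grid_index m s) + 1 / 2 ^ m"
proof -
  have "real (grid_index m s) = of_int \<lfloor>s * 2 ^ m\<rfloor>"
    using assms by (simp add: grid_index_def)
  then have "real (grid_index m s) \<le> s * 2 ^ m" "s * 2 ^ m < real (grid_index m s) + 1"
    by linarith+
  then show "grid m (grid_index m s) \<le> s" "s < grid m (grid_index m s) + 1 / 2 ^ m"
    by (auto simp: grid_def field_simps)
qed

lemma grid_index_eqI:
  assumes "grid m i \<le> s" "s < grid m (Suc i)"
  shows "grid_index m s = i"
proof -
  have "real i \<le> s * 2 ^ m" "s * 2 ^ m < real i + 1"
    using assms by (auto simp: grid_def field_simps)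
  then have "\<lfloor>s * 2 ^ m\<rfloor> = int i" by linarith
  then show ?thesis by (simp add: grid_index_def)
qed

lemma tendsto_inverse_power2: "(\<lambda>m. 1 / 2 ^ m :: real) \<longlonglongrightarrow> 0"
  using LIMSEQ_realpow_zero[of "1/2 :: real"] by (simp add: power_one_over)

lemma grid_grid_index_tendsto:
  assumes "0 \<le> s"
  shows "(\<lambda>m. grid m (grid_index m s)) \<longlonglongrightarrow> s"
proof (rule tendsto_sandwich)
  show "(\<lambda>m. s - 1 / 2 ^ m) \<longlonglongrightarrow> s"
    using tendsto_diff[OF tendsto_const tendsto_inverse_power2, of s] by simp
  show "\<forall>\<^sub>F m in sequentially. s - 1 / 2 ^ m \<le> grid m (grid_index m s)"
    using grid_index_bounds(2)[OF assms] by (intro always_eventually allI) (smt (verit))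
qed (use grid_index_bounds(1)[OF assms] in auto)

lemma measurable_grid_index [measurable]: "grid_index m \<in> measurable borel (count_space UNIV)"
  unfolding grid_index_def by measurable

lemma measurable_comp_grid_index [measurable]: "(\<lambda>s. x (grid_index m s)) \<in> borel_measurable borel"
  by (rule measurable_compose[OF measurable_grid_index]) simp

section \<open>Payoffs and rates integrated over grid cells\<close>

lemma set_integrable_inner_bounded:
  fixes v x :: "real \<Rightarrow> 'a::euclidean_space"
  assumes v: "set_integrable lborel A v" and [measurable]: "A \<in> sets borel"
    and x: "set_borel_measurable lborel A x" and bound: "\<And>s. s \<in> A \<Longrightarrow> norm (x s) \<le> 1"
  shows "set_integrable lborel A (\<lambda>s. v s \<bullet> x s)"
proof -
  have "integrable lborel (\<lambda>s. (indicator A s *\<^sub>R v s) \<bullet> (indicator A s *\<^sub>R x s))"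
  proof (rule Bochner_Integration.integrable_bound)
    show "integrable lborel (\<lambda>s. indicator A s *\<^sub>R v s)" using v by (simp add: set_integrable_def)
    show "(\<lambda>s. (indicator A s *\<^sub>R v s) \<bullet> (indicator A s *\<^sub>R x s)) \<in> borel_measurable lborel"
      using v x by (intro borel_measurable_inner) (auto simp: set_integrable_def set_borel_measurable_def)
    show "AE s in lborel. norm ((indicator A s *\<^sub>R v s) \<bullet> (indicator A s *\<^sub>R x s))
        \<le> norm (indicator A s *\<^sub>R v s)"
    proof (intro AE_I2)
      fix s
      have "\<bar>v s \<bullet> x s\<bar> \<le> norm (v s)" if "s \<in> A"
        using Cauchy_Schwarz_ineq2[of "v s" "x s"] mult_left_mono[OF bound[OF that], of "norm (v s)"] by simp
      then show "norm ((indicator A s *\<^sub>R v s) \<bullet> (indicator A s *\<^sub>R x s)) \<le> norm (indicator A s *\<^sub>R v s)"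
        by (simp add: indicator_def)
    qed
  qed
  moreover have "(\<lambda>s. (indicator A s *\<^sub>R v s) \<bullet> (indicator A s *\<^sub>R x s)) = (\<lambda>s. indicator A s *\<^sub>R (v s \<bullet> x s))"
    by (auto simp: indicator_def)
  ultimately show ?thesis by (simp add: set_integrable_def)
qed

lemma set_integral_singleton [simp]:
  fixes f :: "real \<Rightarrow> 'a::euclidean_space"
  shows "(LINT s:{a}|lborel. f s) = 0"
proof -
  have "AE s in lborel. s \<noteq> a" by (rule AE_lborel_singleton)
  then have "AE s in lborel. indicator {a} s *\<^sub>R f s = 0" by eventually_elim auto
  then show ?thesis unfolding set_lebesgue_integral_def by (rule integral_eq_zero_AE)
qed

lemma set_integral_split:
  fixes f :: "real \<Rightarrow> 'a::euclidean_space"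
  assumes "set_integrable lborel {0..b} f" "0 \<le> a" "a \<le> b"
  shows "(LINT s:{0..b}|lborel. f s) = (LINT s:{0..a}|lborel. f s) + (LINT s:{a<..b}|lborel. f s)"
proof -
  have "{0..b} = {0..a} \<union> {a<..b}" using assms by auto
  moreover have "set_integrable lborel {0..a} f" "set_integrable lborel {a<..b} f"
    using assms by (auto intro: set_integrable_subset)
  moreover have "{0..a} \<inter> {a<..b} = {}" by auto
  ultimately show ?thesis using set_integral_Un by metis
qed

lemma continuous_on_atLeast0I:
  fixes f :: "real \<Rightarrow> 'a::topological_space"
  assumes "\<And>b. b > 0 \<Longrightarrow> continuous_on {0..b} f"
  shows "continuous_on {0..} f"
  unfolding continuous_on_eq_continuous_within
proof
  fix t :: real assume t: "t \<in> {0..}"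
  have "continuous (at t within {0..t + 1}) f"
    using assms[of "t + 1"] t by (auto simp: continuous_on_eq_continuous_within)
  moreover have "at t within {0..} = at t within {0..t + 1}"
    using t by (intro at_within_nhd[of _ "{..<t + 1}"]) auto
  ultimately show "continuous (at t within {0..}) f"
    by (simp add: continuous_within)
qed

lemma continuous_on_indefinite_integral:
  fixes f :: "real \<Rightarrow> 'a::euclidean_space"
  assumes "\<And>t. t \<ge> 0 \<Longrightarrow> set_integrable lborel {0..t} f"
  shows "continuous_on {0..} (\<lambda>t. LINT s:{0..t}|lborel. f s)"
proof (rule continuous_on_atLeast0I)
  fix b :: real assume "b > 0"
  then show "continuous_on {0..b} (\<lambda>t. LINT s:{0..t}|lborel. f s)"
    using indefinite_integral_continuous_1[OF set_borel_integral_eq_integral(1)[OF assms[of b]]]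
    by (rule_tac continuous_on_eq) (auto simp: set_borel_integral_eq_integral(2)[OF assms])
qed

lemma set_integral_inner_left:
  fixes f :: "real \<Rightarrow> 'a::euclidean_space"
  assumes "set_integrable lborel A f"
  shows "(LINT s:A|lborel. f s \<bullet> c) = (LINT s:A|lborel. f s) \<bullet> c"
proof -
  have "(LINT s|lborel. (indicator A s *\<^sub>R f s) \<bullet> c) = (LINT s|lborel. indicator A s *\<^sub>R f s) \<bullet> c"
    using assms by (intro integral_inner_left) (simp add: set_integrable_def)
  then show ?thesis by (simp add: set_lebesgue_integral_def)
qed

lemma grid_sum_eq_integral:
  fixes v :: "real \<Rightarrow> 'a::euclidean_space"
  assumes v: "\<And>t. t \<ge> 0 \<Longrightarrow> set_integrable lborel {0..t} v" and bound: "\<And>i. norm (x i) \<le> 1"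
  shows "(\<Sum>i<k. x i \<bullet> ((LINT s:{0..grid m (Suc i)}|lborel. v s) - (LINT s:{0..grid m i}|lborel. v s)))
    = (LINT s:{0..grid m k}|lborel. v s \<bullet> x (grid_index m s))"
proof (induction k)
  case 0
  show ?case using set_integral_singleton by simp
next
  case (Suc k)
  let ?a = "grid m k" and ?b = "grid m (Suc k)"
  let ?f = "\<lambda>s. v s \<bullet> x (grid_index m s)"
  have int: "set_integrable lborel {0..?b} ?f"
    using v bound by (intro set_integrable_inner_bounded) (auto simp: set_borel_measurable_def)
  have "(LINT s:{0..?b}|lborel. ?f s) = (LINT s:{0..?a}|lborel. ?f s) + (LINT s:{?a<..?b}|lborel. ?f s)"
    by (rule set_integral_split[OF int]) simp_all
  also have "(LINT s:{?a<..?b}|lborel. ?f s) = (LINT s:{?a<..?b}|lborel. v s \<bullet> x k)"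
  proof -
    \<comment> \<open>\<open>grid_index\<close> belongs to cells closed on the left, whereas the
      integral is split into cells closed on the right; they differ at the right endpoint, which is
      null.\<close>
    have "AE s in lborel. s \<noteq> ?b" by (rule AE_lborel_singleton)
    then have ae: "AE s in lborel. indicator {?a<..?b} s *\<^sub>R ?f s = indicator {?a<..?b} s *\<^sub>R (v s \<bullet> x k)"
      by eventually_elim (auto simp: indicator_def dest!: grid_index_eqI[of m k, OF less_imp_le])
    have "set_integrable lborel {?a<..?b} ?f"
      by (rule set_integrable_subset[OF int]) (auto intro: order.trans[OF grid_simps(1) less_imp_le])
    moreover have vv: "set_integrable lborel {?a<..?b} v"
      by (rule set_integrable_subset[OF v[of ?b]]) (auto intro: order.trans[OF grid_simps(1) less_imp_le])
    then have "(\<lambda>s. (indicator {?a<..?b} s *\<^sub>R v s) \<bullet> x k) \<in> borel_measurable lborel"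
      by (intro borel_measurable_inner) (auto simp: set_integrable_def)
    ultimately show ?thesis
      unfolding set_lebesgue_integral_def set_integrable_def
      using ae by (intro integral_cong_AE) auto
  qed
  also have "\<dots> = (LINT s:{?a<..?b}|lborel. v s) \<bullet> x k"
    by (rule set_integral_inner_left, rule set_integrable_subset[OF v[of ?b]])
      (auto intro: order.trans[OF grid_simps(1) less_imp_le])
  also have "(LINT s:{?a<..?b}|lborel. v s) = (LINT s:{0..?b}|lborel. v s) - (LINT s:{0..?a}|lborel. v s)"
    using set_integral_split[OF v[of ?b], of ?a] by simp
  finally show ?case by (simp add: Suc.IH inner_commute)
qed

text \<open>The payoff part of the scores has finite variation, which makes its contribution to the
  squared increments negligible as the mesh shrinks.\<close>

lemma grid_variation_le:
  fixes v :: "real \<Rightarrow> 'a::euclidean_space"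
  assumes v: "\<And>t. t \<ge> 0 \<Longrightarrow> set_integrable lborel {0..t} v"
  shows "(\<Sum>i<k. norm ((LINT s:{0..grid m (Suc i)}|lborel. v s) - (LINT s:{0..grid m i}|lborel. v s)))
    \<le> (LINT s:{0..grid m k}|lborel. norm (v s))"
proof (induction k)
  case 0
  show ?case using set_integral_singleton by simp
next
  case (Suc k)
  let ?a = "grid m k" and ?b = "grid m (Suc k)"
  have vv: "set_integrable lborel {?a<..?b} v"
    by (rule set_integrable_subset[OF v[of ?b]]) (auto intro: order.trans[OF grid_simps(1) less_imp_le])
  have "norm ((LINT s:{0..?b}|lborel. v s) - (LINT s:{0..?a}|lborel. v s)) = norm (LINT s:{?a<..?b}|lborel. v s)"
    using set_integral_split[OF v[of ?b], of ?a] by simp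
  also have "\<dots> \<le> (LINT s:{?a<..?b}|lborel. norm (v s))"
    by (rule set_integral_norm_bound[OF vv])
  also have "\<dots> = (LINT s:{0..?b}|lborel. norm (v s)) - (LINT s:{0..?a}|lborel. norm (v s))"
    using set_integral_split[OF set_integrable_norm[OF v[of ?b]], of ?a] by simp
  finally show ?case using Suc.IH by simp
qed

text \<open>The first term of the left endpoint sum is the one not dominated by an integral, whence the error.\<close>

lemma antimono_grid_sum_le:
  assumes anti: "antimono_on {0..} e" and nonneg: "\<And>s::real. s \<ge> 0 \<Longrightarrow> 0 \<le> (e s :: real)"
    and int: "\<And>t. t \<ge> 0 \<Longrightarrow> set_integrable lborel {0..t} e"
  shows "(\<Sum>i<k. e (grid m i) / 2 ^ m) \<le> (LINT s:{0..grid m k}|lborel. e s) + e 0 / 2 ^ m"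
proof -
  have mono: "e t \<le> e s" if "0 \<le> s" "s \<le> t" for s t
    using monotone_onD[OF anti, of s t] that by simp
  \<comment> \<open>The additional last term shifts the sum by one index, so that the induction step
    compares the right endpoint value with the integral over its own cell.\<close>
  have "(\<Sum>i<k. e (grid m i) / 2 ^ m) + e (grid m k) / 2 ^ m \<le> (LINT s:{0..grid m k}|lborel. e s) + e 0 / 2 ^ m"
  proof (induction k)
    case 0
    show ?case using set_integral_singleton by simp
  next
    case (Suc k)
    let ?a = "grid m k" and ?b = "grid m (Suc k)"
    have i: "set_integrable lborel {?a<..?b} e"
      by (rule set_integrable_subset[OF int[of ?b]]) (auto intro: order.trans[OF grid_simps(1) less_imp_le])
    have "e ?b / 2 ^ m = (LINT s:{?a<..?b}|lborel. e ?b)"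
      by (simp add: grid_Suc set_lebesgue_integral_def)
    also have "\<dots> \<le> (LINT s:{?a<..?b}|lborel. e s)"
      using i mono by (intro set_integral_mono) (auto simp: set_integrable_def grid_Suc intro: order.trans[OF grid_simps(1) less_imp_le])
    also have "\<dots> = (LINT s:{0..?b}|lborel. e s) - (LINT s:{0..?a}|lborel. e s)"
      using set_integral_split[OF int[of ?b], of ?a] by simp
    finally show ?case using Suc.IH by simp
  qed
  moreover have "0 \<le> e (grid m k) / 2 ^ m" using nonneg by simp
  ultimately show ?thesis by linarith
qed

text \<open>Uniform continuity on the compact interval provides one level from which all cells are
  controlled simultaneously.\<close>

lemma grid_increments_small:
  fixes f :: "real \<Rightarrow> 'a::real_normed_vector"
  assumes cont: "continuous_on {0..} f" and "\<epsilon> > 0"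
  shows "\<forall>\<^sub>F m in sequentially. \<forall>i. grid m (Suc i) \<le> T \<longrightarrow> norm (f (grid m (Suc i)) - f (grid m i)) < \<epsilon>"
proof -
  have "uniformly_continuous_on {0..T} f"
    by (rule compact_uniformly_continuous[OF continuous_on_subset[OF cont]]) auto
  then obtain d where d: "d > 0"
    "\<And>s t. s \<in> {0..T} \<Longrightarrow> t \<in> {0..T} \<Longrightarrow> dist t s < d \<Longrightarrow> dist (f t) (f s) < \<epsilon>"
    unfolding uniformly_continuous_on_def using \<open>\<epsilon> > 0\<close> by metis
  have "\<forall>\<^sub>F m in sequentially. 1 / 2 ^ m < d"
    using order_tendstoD(2)[OF tendsto_inverse_power2 d(1)] .
  then show ?thesis
  proof (rule eventually_mono, intro allI impI)
    fix m i assume m: "1 / 2 ^ m < d" and i: "grid m (Suc i) \<le> T"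
    have "grid m i \<le> T" using order_trans[of "grid m i" "grid m (Suc i)" T] i by simp
    then have "grid m i \<in> {0..T}" "grid m (Suc i) \<in> {0..T}" "dist (grid m (Suc i)) (grid m i) < d"
      using i m by (auto simp: grid_Suc dist_real_def intro: order_trans)
    then show "norm (f (grid m (Suc i)) - f (grid m i)) < \<epsilon>"
      using d(2) by (simp add: dist_norm)
  qed
qed

section \<open>The discretised learning process\<close>

text \<open>\<open>C\<close> bounds the volatility uniformly over paths and is strictly positive, as
  the Gaussian tails divide by it. \<open>I\<close> fixes one version of the Ito integrals; scores
  and choices are rebuilt from it.\<close>

locale perturbed_learning = prob_space M for M :: "'w measure" +
  fixes F :: "real \<Rightarrow> 'w measure"
    and h :: "real ^ 'n \<Rightarrow> real" and K C :: real
    and W v \<sigma> :: "real \<Rightarrow> 'w \<Rightarrow> real ^ 'n"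
    and I :: "'n \<Rightarrow> real \<Rightarrow> 'w \<Rightarrow> real"
    and \<eta> :: "real \<Rightarrow> real"
  assumes filtration: "filtration (space M) F" and subalg: "\<And>t. subalgebra M (F t)"
    and wiener: "wiener_process M F W"
    and penalty: "penalty_function K h"
    and payoff_progressive: "progressively_measurable F v"
    and payoff_integrable:
      "\<And>\<omega> t. \<omega> \<in> space M \<Longrightarrow> t \<ge> 0 \<Longrightarrow> set_integrable lborel {0..t} (\<lambda>s. v s \<omega>)"
    and vol_adapted: "adapted_process F \<sigma>"
    and vol_continuous: "\<And>\<omega>. \<omega> \<in> space M \<Longrightarrow> continuous_on {0..} (\<lambda>t. \<sigma> t \<omega>)"
    and vol_nonneg: "\<And>\<omega> t \<alpha>. \<omega> \<in> space M \<Longrightarrow> t \<ge> 0 \<Longrightarrow> 0 \<le> \<sigma> t \<omega> $ \<alpha>"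
    and vol_le: "\<And>\<omega> t \<alpha>. \<omega> \<in> space M \<Longrightarrow> t \<ge> 0 \<Longrightarrow> \<sigma> t \<omega> $ \<alpha> \<le> C"
    and vol_bound_pos: "C > 0"
    and rate_pos: "\<And>t. t \<ge> 0 \<Longrightarrow> \<eta> t > 0"
    and rate_continuous: "continuous_on {0..} \<eta>"
    and rate_antimono: "antimono_on {0..} \<eta>"
    and ito: "\<And>\<alpha>. ito_integral M (\<lambda>t \<omega>. W t \<omega> $ \<alpha>) (\<lambda>t \<omega>. \<sigma> t \<omega> $ \<alpha>) (I \<alpha>)"
begin

definition cum_payoff :: "real \<Rightarrow> 'w \<Rightarrow> real ^ 'n" where
  "cum_payoff t \<omega> = (LINT s:{0..t}|lborel. v s \<omega>)"

text \<open>The process \<open>X\<close> with its scores written out in integral form; the two agree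
  at all times t \<ge> 0 off a single null set.\<close>

definition choice :: "real \<Rightarrow> 'w \<Rightarrow> real ^ 'n" where
  "choice t \<omega> = choice_map h (\<eta> t *\<^sub>R (cum_payoff t \<omega> + (\<chi> \<alpha>. I \<alpha> t \<omega>)))"

text \<open>The part of the regret that the iterated logarithm term has to absorb.\<close>

definition excess :: "real \<Rightarrow> 'w \<Rightarrow> real" where
  "excess t \<omega> = Reg (\<lambda>s. v s \<omega>) (\<lambda>s. choice s \<omega>) t - penalty_range h / \<eta> t
    - (sigma_max (\<lambda>s. \<sigma> s \<omega>))\<^sup>2 * (real CARD('n) / (2 * K)) * (LINT s:{0..t}|lborel. \<eta> s)"

text \<open>The discretisation at mesh \<open>2\<^sup>-\<^sup>m\<close> keeps the exact payoffs and replaces the Ito integrals by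
  their left endpoint sums, so that all its ingredients are adapted.\<close>

definition dW :: "nat \<Rightarrow> 'n \<Rightarrow> nat \<Rightarrow> 'w \<Rightarrow> real" where
  "dW m \<alpha> i \<omega> = W (grid m (Suc i)) \<omega> $ \<alpha> - W (grid m i) \<omega> $ \<alpha>"

definition grid_noise :: "nat \<Rightarrow> 'n \<Rightarrow> nat \<Rightarrow> 'w \<Rightarrow> real" where
  "grid_noise m \<alpha> = walk (dW m \<alpha>) (\<lambda>i \<omega>. \<sigma> (grid m i) \<omega> $ \<alpha>)"

definition grid_choice :: "nat \<Rightarrow> nat \<Rightarrow> 'w \<Rightarrow> real ^ 'n" where
  "grid_choice m i \<omega> =
     choice_map h (\<eta> (grid m i) *\<^sub>R (cum_payoff (grid m i) \<omega> + (\<chi> \<alpha>. grid_noise m \<alpha> i \<omega>)))"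

text \<open>Two sources of noise: what the played strategy collects along the way, and what the
  final score of the comparison action contains. Summing absolute values over all actions covers
  whichever action attains the maximum.\<close>

definition grid_fluct :: "nat \<Rightarrow> nat \<Rightarrow> 'w \<Rightarrow> real" where
  "grid_fluct m k \<omega> = (\<Sum>\<alpha>\<in>UNIV.
     \<bar>walk (dW m \<alpha>) (\<lambda>i \<omega>. grid_choice m i \<omega> $ \<alpha> * \<sigma> (grid m i) \<omega> $ \<alpha>) k \<omega>\<bar> + \<bar>grid_noise m \<alpha> k \<omega>\<bar>)"

text \<open>The quadratic variation of the Wiener process weighted by the rate, minus its
  compensator.\<close>

definition grid_qv :: "nat \<Rightarrow> nat \<Rightarrow> 'w \<Rightarrow> real" where
  "grid_qv m k \<omega> = (\<Sum>\<alpha>\<in>UNIV. \<Sum>i<k. \<eta> (grid m i) * ((dW m \<alpha> i \<omega>)\<^sup>2 - 1 / 2 ^ m))"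

lemmas K_pos = penalty_functionD(2)[OF penalty]

section \<open>Regret bound along a single path\<close>

lemma vol_sigma_max:
  assumes "\<omega> \<in> space M" "t \<ge> 0"
  shows "\<sigma> t \<omega> $ \<alpha> \<le> sigma_max (\<lambda>s. \<sigma> s \<omega>)"
proof -
  have "\<sigma> t \<omega> $ \<alpha> \<le> (MAX \<alpha>. \<sigma> t \<omega> $ \<alpha>)" by (intro Max_ge) auto
  also have "\<dots> \<le> sigma_max (\<lambda>s. \<sigma> s \<omega>)"
    unfolding sigma_max_def using assms vol_le
    by (intro cSUP_upper bdd_aboveI[of _ C]) auto
  finally show ?thesis .
qed

lemma sigma_max_nonneg: "\<omega> \<in> space M \<Longrightarrow> 0 \<le> sigma_max (\<lambda>s. \<sigma> s \<omega>)"
  using vol_sigma_max[of \<omega> 0] vol_nonneg[of \<omega> 0] order_trans by blast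

lemma grid_choice_simplex: "grid_choice m i \<omega> \<in> prob_simplex"
  and choice_simplex: "choice t \<omega> \<in> prob_simplex"
  unfolding grid_choice_def choice_def by (rule choice_map_is_max[OF penalty])+

lemma rate_integrable: "set_integrable lborel {0..t} \<eta>"
  by (intro borel_integrable_atLeastAtMost' continuous_on_subset[OF rate_continuous]) auto

lemma cum_payoff_nth:
  assumes "\<omega> \<in> space M" "t \<ge> 0"
  shows "cum_payoff t \<omega> $ \<alpha> = (LINT s:{0..t}|lborel. v s \<omega> $ \<alpha>)"
  using set_integral_inner_left[OF payoff_integrable[OF assms], of "axis \<alpha> 1"]
  by (simp add: cum_payoff_def inner_axis)

text \<open>\<open>discrete_regret_bound\<close> applied to the discretised scores, with each
  increment split into a payoff part \<open>a\<close> and a noise part \<open>b\<close>. In the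
  squared increment everything involving \<open>a\<close> is at most \<delta> times the norm of
  \<open>a\<close>, hence summable by finite variation; the square of \<open>b\<close> yields the
  integral of \<eta> plus \<open>grid_qv\<close>.\<close>

lemma choice_grid_bound:
  assumes \<omega>: "\<omega> \<in> space M" and \<delta>_nonneg: "0 \<le> \<delta>"
    and \<delta>: "\<And>i. i < k \<Longrightarrow> norm (cum_payoff (grid m (Suc i)) \<omega> - cum_payoff (grid m i) \<omega>)
      + 2 * C * norm (W (grid m (Suc i)) \<omega> - W (grid m i) \<omega>) \<le> \<delta>"
  shows "excess (grid m k) \<omega> \<le> grid_fluct m k \<omega>
    + ((LINT s:{0..grid m k}|lborel. v s \<omega> \<bullet> grid_choice m (grid_index m s) \<omega>)
       - (LINT s:{0..grid m k}|lborel. v s \<omega> \<bullet> choice s \<omega>))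
    + ((sigma_max (\<lambda>s. \<sigma> s \<omega>))\<^sup>2 * (grid_qv m k \<omega> + real CARD('n) * \<eta> 0 / 2 ^ m)
       + \<eta> 0 * \<delta> * (LINT s:{0..grid m k}|lborel. norm (v s \<omega>))) / (2 * K)"
proof -
  let ?S = "sigma_max (\<lambda>s. \<sigma> s \<omega>)" and ?g = "grid m" and ?n = "real CARD('n)"
  let ?t = "grid m k"
  define R where "R i = (\<chi> \<alpha>. grid_noise m \<alpha> i \<omega>)" for i
  define y where "y i = cum_payoff (?g i) \<omega> + R i" for i
  define a where "a i = cum_payoff (?g (Suc i)) \<omega> - cum_payoff (?g i) \<omega>" for i
  define b where "b i = R (Suc i) - R i" for i
  define x where "x i = grid_choice m i \<omega>" for i
  let ?X = "LINT s:{0..?t}|lborel. v s \<omega> \<bullet> x (grid_index m s)"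
  let ?Q = "(\<Sum>i<k. \<eta> (?g i) * (norm (a i + b i))\<^sup>2)"
  have b_nth: "b i $ \<alpha> = \<sigma> (?g i) \<omega> $ \<alpha> * dW m \<alpha> i \<omega>" for i \<alpha>
    by (simp add: b_def R_def grid_noise_def walk_def)
  have y_diff: "y (Suc i) - y i = a i + b i" for i by (simp add: y_def a_def b_def)
  have rate_le: "\<eta> (?g i) \<le> \<eta> 0" for i using monotone_onD[OF rate_antimono, of 0 "?g i"] by simp
  have rate_nonneg: "0 \<le> \<eta> (?g i)" for i using rate_pos[of "?g i"] by simp

  have first: "cum_payoff ?t \<omega> $ \<alpha> \<le> penalty_range h / \<eta> ?t + ?X + grid_fluct m k \<omega> + ?Q / (2 * K)" for \<alpha>
  proof -
    have "y k $ \<alpha> \<le> penalty_range h / \<eta> ?t + (\<Sum>i<k. x i \<bullet> (a i + b i))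
        + (\<Sum>i<k. \<eta> (?g i) / (2 * K) * (norm (a i + b i))\<^sup>2)"
    proof -
      have "y 0 = 0"
        by (simp add: y_def R_def grid_noise_def walk_def cum_payoff_def vec_eq_iff)
      moreover have x_eq: "choice_map h (\<eta> (?g i) *\<^sub>R y i) = x i" for i
        by (simp add: x_def grid_choice_def y_def R_def)
      ultimately show ?thesis
        using discrete_regret_bound[OF penalty, of y "\<lambda>i. \<eta> (?g i)" k \<alpha>] rate_pos
          monotone_onD[OF rate_antimono]
        by (simp add: y_diff x_eq)
    qed
    moreover have "(\<Sum>i<k. \<eta> (?g i) / (2 * K) * (norm (a i + b i))\<^sup>2) = ?Q / (2 * K)"
      by (simp add: sum_divide_distrib)
    moreover have "(\<Sum>i<k. x i \<bullet> a i) = ?X"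
      unfolding a_def cum_payoff_def
      using payoff_integrable[OF \<omega>] norm_prob_simplex_le[OF grid_choice_simplex]
      by (intro grid_sum_eq_integral) (auto simp: x_def)
    \<comment> \<open>The score \<open>y k $ \<alpha>\<close> is the cumulative payoff plus the
      noise \<open>R k $ \<alpha>\<close>; isolating the payoff moves this noise to the right-hand
      side.\<close>
    moreover have "(\<Sum>i<k. x i \<bullet> b i) - R k $ \<alpha> \<le> grid_fluct m k \<omega>"
    proof -
      have "(\<Sum>i<k. x i \<bullet> b i)
          = (\<Sum>\<alpha>\<in>UNIV. walk (dW m \<alpha>) (\<lambda>i \<omega>. grid_choice m i \<omega> $ \<alpha> * \<sigma> (?g i) \<omega> $ \<alpha>) k \<omega>)"
        unfolding inner_vec_def walk_def by (subst sum.swap) (simp add: b_nth x_def mult.assoc)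
      also have "\<dots> \<le> (\<Sum>\<alpha>\<in>UNIV. \<bar>walk (dW m \<alpha>) (\<lambda>i \<omega>. grid_choice m i \<omega> $ \<alpha> * \<sigma> (?g i) \<omega> $ \<alpha>) k \<omega>\<bar>)"
        by (intro sum_mono) simp
      moreover have "- R k $ \<alpha> \<le> (\<Sum>\<alpha>\<in>UNIV. \<bar>grid_noise m \<alpha> k \<omega>\<bar>)"
        using member_le_sum[of \<alpha> UNIV "\<lambda>\<alpha>. \<bar>grid_noise m \<alpha> k \<omega>\<bar>"] by (simp add: R_def)
      ultimately show ?thesis by (simp add: grid_fluct_def sum.distrib)
    qed
    ultimately show ?thesis by (simp add: inner_add_right sum.distrib y_def)
  qed

  have norm_b: "norm (b i) \<le> C * norm (W (?g (Suc i)) \<omega> - W (?g i) \<omega>)" for i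
  proof -
    have "norm (b i) \<le> norm (C *\<^sub>R (W (?g (Suc i)) \<omega> - W (?g i) \<omega>))"
    proof (rule norm_le_componentwise_cart)
      fix \<alpha>
      have "\<bar>\<sigma> (?g i) \<omega> $ \<alpha>\<bar> \<le> C" using vol_le vol_nonneg \<omega> by (simp add: abs_le_iff order_trans[of _ 0])
      then show "norm (b i $ \<alpha>) \<le> norm ((C *\<^sub>R (W (?g (Suc i)) \<omega> - W (?g i) \<omega>)) $ \<alpha>)"
        using vol_bound_pos by (simp add: b_nth dW_def abs_mult mult_right_mono)
    qed
    then show ?thesis using vol_bound_pos by simp
  qed
  \<comment> \<open>The square is regrouped as (|a| + 2 |b|) |a| + |b|^2. The bracket is at most
    \<delta>, which explains the factor 2 C in the assumption on \<delta>.\<close>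
  have split: "\<eta> (?g i) * (norm (a i + b i))\<^sup>2 \<le> \<eta> 0 * \<delta> * norm (a i) + \<eta> (?g i) * (norm (b i))\<^sup>2" if "i < k" for i
  proof -
    have "(norm (a i + b i))\<^sup>2 \<le> (norm (a i) + norm (b i))\<^sup>2"
      by (intro power_mono norm_triangle_ineq) simp
    also have "\<dots> = (norm (a i) + 2 * norm (b i)) * norm (a i) + (norm (b i))\<^sup>2"
      by (simp add: power2_eq_square algebra_simps)
    also have "\<dots> \<le> \<delta> * norm (a i) + (norm (b i))\<^sup>2"
      using \<delta>[OF that] norm_b[of i] by (intro add_mono mult_right_mono) (auto simp: a_def)
    finally have "\<eta> (?g i) * (norm (a i + b i))\<^sup>2 \<le> \<eta> (?g i) * (\<delta> * norm (a i)) + \<eta> (?g i) * (norm (b i))\<^sup>2"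
      using rate_nonneg[of i] by (metis distrib_left mult_left_mono)
    also have "\<eta> (?g i) * (\<delta> * norm (a i)) \<le> \<eta> 0 * (\<delta> * norm (a i))"
      using \<delta>_nonneg by (intro mult_right_mono rate_le) auto
    finally show ?thesis by (simp add: mult.assoc)
  qed
  \<comment> \<open>Here the volatility is bounded by \<open>sigma_max\<close> of the path rather
    than by \<open>C\<close>; this produces the leading constant in front of the integral of
    \<eta>.\<close>
  have b2: "(norm (b i))\<^sup>2 \<le> ?S\<^sup>2 * (\<Sum>\<alpha>\<in>UNIV. (dW m \<alpha> i \<omega>)\<^sup>2)" for i
  proof -
    have "(norm (b i))\<^sup>2 = (\<Sum>\<alpha>\<in>UNIV. (\<sigma> (?g i) \<omega> $ \<alpha>)\<^sup>2 * (dW m \<alpha> i \<omega>)\<^sup>2)"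
      unfolding power2_norm_eq_inner inner_vec_def by (simp add: b_nth power2_eq_square ac_simps)
    also have "\<dots> \<le> (\<Sum>\<alpha>\<in>UNIV. ?S\<^sup>2 * (dW m \<alpha> i \<omega>)\<^sup>2)"
      using vol_sigma_max[OF \<omega>] vol_nonneg[OF \<omega>] by (intro sum_mono mult_right_mono power_mono) auto
    finally show ?thesis by (simp add: sum_distrib_left)
  qed
  have "?Q \<le> (\<Sum>i<k. \<eta> 0 * \<delta> * norm (a i) + \<eta> (?g i) * (norm (b i))\<^sup>2)"
    using split by (intro sum_mono) auto
  also have "\<dots> \<le> (\<Sum>i<k. \<eta> 0 * \<delta> * norm (a i) + \<eta> (?g i) * (?S\<^sup>2 * (\<Sum>\<alpha>\<in>UNIV. (dW m \<alpha> i \<omega>)\<^sup>2)))"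
    by (intro sum_mono add_left_mono mult_left_mono b2 rate_nonneg)
  also have "\<dots> = \<eta> 0 * \<delta> * (\<Sum>i<k. norm (a i)) + ?S\<^sup>2 * (\<Sum>i<k. \<eta> (?g i) * (\<Sum>\<alpha>\<in>UNIV. (dW m \<alpha> i \<omega>)\<^sup>2))"
    by (simp add: sum.distrib sum_distrib_left ac_simps)
  \<comment> \<open>Compensation: each squared Wiener increment is its mean \<open>1 / 2 ^ m\<close>
    plus a centred remainder, and the means form a left endpoint sum of \<eta> for every
    action.\<close>
  also have "(\<Sum>i<k. \<eta> (?g i) * (\<Sum>\<alpha>\<in>UNIV. (dW m \<alpha> i \<omega>)\<^sup>2)) = grid_qv m k \<omega> + ?n * (\<Sum>i<k. \<eta> (?g i) / 2 ^ m)"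
    unfolding grid_qv_def
    by (subst sum.swap) (simp add: sum_subtractf sum_distrib_left right_diff_distrib)
  also have "\<eta> 0 * \<delta> * (\<Sum>i<k. norm (a i)) + ?S\<^sup>2 * (grid_qv m k \<omega> + ?n * (\<Sum>i<k. \<eta> (?g i) / 2 ^ m))
      \<le> \<eta> 0 * \<delta> * (LINT s:{0..?t}|lborel. norm (v s \<omega>))
        + ?S\<^sup>2 * (grid_qv m k \<omega> + ?n * ((LINT s:{0..?t}|lborel. \<eta> s) + \<eta> 0 / 2 ^ m))"
  proof (intro add_mono mult_left_mono)
    show "(\<Sum>i<k. norm (a i)) \<le> (LINT s:{0..?t}|lborel. norm (v s \<omega>))"
      unfolding a_def cum_payoff_def using payoff_integrable[OF \<omega>] by (intro grid_variation_le)
    show "(\<Sum>i<k. \<eta> (?g i) / 2 ^ m) \<le> (LINT s:{0..?t}|lborel. \<eta> s) + \<eta> 0 / 2 ^ m"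
      using rate_pos rate_integrable by (intro antimono_grid_sum_le rate_antimono) (auto simp: less_imp_le)
    show "0 \<le> \<eta> 0 * \<delta>" using \<delta>_nonneg rate_pos[of 0] by simp
  qed auto
  finally have Q: "?Q \<le> \<dots>" .
  have "(MAX \<alpha>. LINT s:{0..?t}|lborel. v s \<omega> $ \<alpha>)
      \<le> penalty_range h / \<eta> ?t + ?X + grid_fluct m k \<omega> + ?Q / (2 * K)"
    using first by (simp add: cum_payoff_nth[OF \<omega>])
  also have "?Q / (2 * K) \<le> (\<eta> 0 * \<delta> * (LINT s:{0..?t}|lborel. norm (v s \<omega>))
        + ?S\<^sup>2 * (grid_qv m k \<omega> + ?n * ((LINT s:{0..?t}|lborel. \<eta> s) + \<eta> 0 / 2 ^ m))) / (2 * K)"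
    using Q K_pos by (intro divide_right_mono) auto
  also have "\<dots> = (?S\<^sup>2 * (grid_qv m k \<omega> + ?n * \<eta> 0 / 2 ^ m)
       + \<eta> 0 * \<delta> * (LINT s:{0..?t}|lborel. norm (v s \<omega>))) / (2 * K)
      + ?S\<^sup>2 * (?n / (2 * K)) * (LINT s:{0..?t}|lborel. \<eta> s)"
    by (simp add: add_divide_distrib distrib_left ac_simps)
  finally show ?thesis
    unfolding excess_def Reg_def x_def by linarith
qed

section \<open>Adaptedness and tails of the discretised process\<close>

lemma space_F [simp]: "space (F t) = space M"
  using subalg[of t] by (simp add: subalgebra_def)

text \<open>Progressive measurability makes \<open>v\<close> jointly measurable over {0..t} and
  \<open>F t\<close>, so integrating out time keeps measurability with respect to
  \<open>F t\<close>.\<close>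

lemma cum_payoff_adapted:
  assumes "t \<ge> 0"
  shows "cum_payoff t \<in> borel_measurable (F t)"
proof -
  let ?N = "restrict_space lborel {0..t}"
  interpret N: sigma_finite_measure ?N
    by (intro sigma_finite_measure_restrict_space sigma_finite_lborel) auto
  have *: "(\<lambda>(s, \<omega>). v s \<omega>) \<in> borel_measurable (?N \<Otimes>\<^sub>M F t)"
    using payoff_progressive assms
    by (auto simp: progressively_measurable_def cong: measurable_cong_sets sets_pair_measure_cong sets_restrict_space_cong)
  have "(\<lambda>p. (\<lambda>(s, \<omega>). v s \<omega>) (snd p, fst p)) \<in> borel_measurable (F t \<Otimes>\<^sub>M ?N)"
    by (rule measurable_compose[OF _ *]) simp
  then have "(\<lambda>\<omega>. \<integral>s. v s \<omega> \<partial>?N) \<in> borel_measurable (F t)"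
    by (intro N.borel_measurable_lebesgue_integral) (simp add: split_beta')
  moreover have "cum_payoff t = (\<lambda>\<omega>. \<integral>s. v s \<omega> \<partial>?N)"
    by (auto simp: cum_payoff_def set_lebesgue_integral_def integral_restrict_space)
  ultimately show ?thesis by simp
qed

lemma W_adapted: "t \<ge> 0 \<Longrightarrow> W t \<in> borel_measurable (F t)"
  using wiener by (auto simp: wiener_process_def adapted_process_def)

lemma vol_adapted': "t \<ge> 0 \<Longrightarrow> \<sigma> t \<in> borel_measurable (F t)"
  using vol_adapted by (auto simp: adapted_process_def)

lemma borel_measurable_nth' [measurable (raw)]:
  fixes f :: "'b \<Rightarrow> real ^ 'c"
  shows "f \<in> borel_measurable N \<Longrightarrow> (\<lambda>x. f x $ i) \<in> borel_measurable N"
  by (rule measurable_compose[OF _ borel_measurable_nth])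

lemma gaussian_walk_grid: "gaussian_walk M (\<lambda>i. F (grid m i)) (dW m \<alpha>) (1 / 2 ^ m)"
proof (intro gaussian_walk.intro gaussian_walk_axioms.intro)
  interpret fil: filtration "space M" F by (rule filtration)
  show mono: "sets (F (grid m i)) \<subseteq> sets (F (grid m j))" if "i \<le> j" for i j
    using that by (intro fil.sets_F_mono) simp
  have lt: "0 \<le> grid m i \<and> grid m i < grid m (Suc i)" for i by (simp add: grid_Suc)
  show "dW m \<alpha> i \<in> borel_measurable (F (grid m (Suc i)))" for i
  proof -
    have "W (grid m i) \<in> borel_measurable (F (grid m (Suc i)))"
      using measurable_from_subalg[of "F (grid m (Suc i))" "F (grid m i)"] mono[of i "Suc i"] W_adapted[of "grid m i"]
      by (simp add: subalgebra_def)
    then show ?thesis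
      unfolding dW_def using W_adapted[of "grid m (Suc i)"]
      by (intro borel_measurable_diff borel_measurable_nth') simp_all
  qed
  note inc = wiener[unfolded wiener_process_def, THEN conjunct2, THEN conjunct2, THEN conjunct2, rule_format, OF lt]
  have dW_eq: "dW m \<alpha> i = (\<lambda>\<omega>. (W (grid m (Suc i)) \<omega> - W (grid m i) \<omega>) $ \<alpha>)" for i
    by (auto simp: dW_def)
  show "distributed M lborel (dW m \<alpha> i) (normal_density 0 (sqrt (1 / 2 ^ m)))" for i
    using inc[of i] by (simp add: dW_eq grid_Suc)
  show "indep_set (sets (F (grid m i))) {dW m \<alpha> i -` B \<inter> space M | B. B \<in> sets borel}" for i
  proof -
    have "indep_set (sets (F (grid m i)))
      {(\<lambda>\<omega>. W (grid m (Suc i)) \<omega> - W (grid m i) \<omega>) -` B \<inter> space M | B. B \<in> sets borel}"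
      using inc[of i] by blast
    moreover have "{dW m \<alpha> i -` B \<inter> space M | B. B \<in> sets borel}
      \<subseteq> {(\<lambda>\<omega>. W (grid m (Suc i)) \<omega> - W (grid m i) \<omega>) -` B \<inter> space M | B. B \<in> sets borel}"
    proof safe
      fix B :: "real set" assume "B \<in> sets borel"
      then have "(\<lambda>x :: real ^ 'n. x $ \<alpha>) -` B \<inter> space borel \<in> sets borel"
        by (intro measurable_sets[of _ borel borel]) auto
      then show "\<exists>B'. dW m \<alpha> i -` B \<inter> space M
          = (\<lambda>\<omega>. W (grid m (Suc i)) \<omega> - W (grid m i) \<omega>) -` B' \<inter> space M \<and> B' \<in> sets borel"
        by (intro exI[of _ "(\<lambda>x. x $ \<alpha>) -` B"]) (auto simp: dW_def)
    qed
    ultimately show ?thesis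
      unfolding indep_set_def by (elim indep_sets_mono_sets) (auto split: bool.split)
  qed
qed (use subalg in \<open>auto intro: prob_space_axioms\<close>)

lemma vol_grid_measurable: "(\<lambda>\<omega>. \<sigma> (grid m i) \<omega> $ \<alpha>) \<in> borel_measurable (F (grid m i))"
  using vol_adapted'[of "grid m i"] by simp

lemma grid_noise_adapted: "grid_noise m \<alpha> i \<in> borel_measurable (F (grid m i))"
  unfolding grid_noise_def
  by (rule gaussian_walk.walk_measurable[OF gaussian_walk_grid]) (rule vol_grid_measurable)

lemma grid_choice_adapted: "grid_choice m i \<in> borel_measurable (F (grid m i))"
proof -
  have "(\<lambda>\<omega>. \<chi> \<alpha>. grid_noise m \<alpha> i \<omega>) \<in> borel_measurable (F (grid m i))"
    unfolding borel_measurable_euclidean_space[where 'c = "real ^ 'n"]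
    using grid_noise_adapted by (auto simp: Basis_vec_def inner_axis)
  then have "(\<lambda>\<omega>. \<eta> (grid m i) *\<^sub>R (cum_payoff (grid m i) \<omega> + (\<chi> \<alpha>. grid_noise m \<alpha> i \<omega>)))
      \<in> borel_measurable (F (grid m i))"
    using cum_payoff_adapted[of "grid m i"] by simp
  then show ?thesis
    unfolding grid_choice_def by (rule measurable_compose[OF _ choice_map_measurable[OF penalty]])
qed

lemma grid_fluct_terms:
  defines "H \<equiv> \<lambda>m \<alpha> i \<omega>. grid_choice m i \<omega> $ \<alpha> * \<sigma> (grid m i) \<omega> $ \<alpha>"
  shows "H m \<alpha> i \<in> borel_measurable (F (grid m i))"
    and "\<omega> \<in> space M \<Longrightarrow> \<bar>H m \<alpha> i \<omega>\<bar> \<le> C"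
    and "\<omega> \<in> space M \<Longrightarrow> \<bar>\<sigma> (grid m i) \<omega> $ \<alpha>\<bar> \<le> C"
proof -
  show "H m \<alpha> i \<in> borel_measurable (F (grid m i))"
    unfolding H_def
    by (intro borel_measurable_times borel_measurable_nth' grid_choice_adapted vol_grid_measurable)
  show *: "\<bar>\<sigma> (grid m i) \<omega> $ \<alpha>\<bar> \<le> C" if "\<omega> \<in> space M"
    using vol_nonneg[OF that, of "grid m i" \<alpha>] vol_le[OF that, of "grid m i" \<alpha>] by simp
  show "\<bar>H m \<alpha> i \<omega>\<bar> \<le> C" if "\<omega> \<in> space M"
  proof -
    have "\<bar>grid_choice m i \<omega> $ \<alpha>\<bar> * \<bar>\<sigma> (grid m i) \<omega> $ \<alpha>\<bar> \<le> 1 * C"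
      using prob_simplexD[OF grid_choice_simplex[of m i \<omega>]] *[OF that] by (intro mult_mono) auto
    then show ?thesis by (simp add: H_def abs_mult)
  qed
qed

lemma grid_fluct_measurable [measurable]: "grid_fluct m k \<in> borel_measurable M"
proof -
  interpret G: gaussian_walk M "\<lambda>i. F (grid m i)" "dW m \<alpha>" "1 / 2 ^ m" for \<alpha>
    by (rule gaussian_walk_grid)
  have "walk (dW m \<alpha>) (\<lambda>i \<omega>. grid_choice m i \<omega> $ \<alpha> * \<sigma> (grid m i) \<omega> $ \<alpha>) k \<in> borel_measurable M"
    and "grid_noise m \<alpha> k \<in> borel_measurable M" for \<alpha>
    using G.measurable_from_G[OF G.walk_measurable[OF grid_fluct_terms(1)]]
      G.measurable_from_G[OF grid_noise_adapted] by auto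
  then show ?thesis unfolding grid_fluct_def by measurable
qed

text \<open>A union bound over two walks per action, each with level a / (2 n), where n is the
  number of actions. The two signs of each walk make the factor 4 n, and the level makes the 8 n^2.
  The mesh drops out because T 2^m steps of variance 2^-m have total variance T.\<close>

lemma prob_grid_fluct:
  assumes "a > 0" "T > 0"
  shows "prob {\<omega> \<in> space M. \<exists>k\<le>T * 2 ^ m. a < grid_fluct m k \<omega>}
    \<le> 4 * real CARD('n) * exp (- a\<^sup>2 / (8 * (real CARD('n))\<^sup>2 * C\<^sup>2 * real T))"
proof -
  let ?n = "real CARD('n)"
  define N1 where "N1 \<alpha> = walk (dW m \<alpha>) (\<lambda>i \<omega>. grid_choice m i \<omega> $ \<alpha> * \<sigma> (grid m i) \<omega> $ \<alpha>)" for \<alpha>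
  let ?b = "a / (2 * ?n)"
  let ?A = "\<lambda>\<alpha>. {\<omega> \<in> space M. \<exists>k\<le>T * 2 ^ m. ?b \<le> \<bar>N1 \<alpha> k \<omega>\<bar>}"
  let ?B = "\<lambda>\<alpha>. {\<omega> \<in> space M. \<exists>k\<le>T * 2 ^ m. ?b \<le> \<bar>grid_noise m \<alpha> k \<omega>\<bar>}"
  let ?p = "exp (- a\<^sup>2 / (8 * ?n\<^sup>2 * C\<^sup>2 * real T))"
  interpret G: gaussian_walk M "\<lambda>i. F (grid m i)" "dW m \<alpha>" "1 / 2 ^ m" for \<alpha>
    by (rule gaussian_walk_grid)
  have [measurable]: "N1 \<alpha> k \<in> borel_measurable M" "grid_noise m \<alpha> k \<in> borel_measurable M" for \<alpha> k
    unfolding N1_def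
    using G.measurable_from_G[OF G.walk_measurable[OF grid_fluct_terms(1)]]
      G.measurable_from_G[OF grid_noise_adapted] by auto
  have AB: "?A \<alpha> \<in> events" "?B \<alpha> \<in> events" for \<alpha> by measurable
  have exponent: "exp (- ?b\<^sup>2 / (2 * C\<^sup>2 * (1 / 2 ^ m) * real (T * 2 ^ m))) = ?p"
    by (simp add: power_divide power_mult_distrib mult.assoc)
  have pA: "prob (?A \<alpha>) \<le> 2 * ?p" for \<alpha>
    unfolding exponent[symmetric] N1_def
    by (rule G.prob_abs_walk_max_ge[OF grid_fluct_terms(1,2)]) (use assms vol_bound_pos in auto)
  have pB: "prob (?B \<alpha>) \<le> 2 * ?p" for \<alpha>
    unfolding exponent[symmetric] grid_noise_def
    by (rule G.prob_abs_walk_max_ge[OF vol_grid_measurable grid_fluct_terms(3)]) (use assms vol_bound_pos in auto)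
  have "{\<omega> \<in> space M. \<exists>k\<le>T * 2 ^ m. a < grid_fluct m k \<omega>} \<subseteq> (\<Union>\<alpha>. ?A \<alpha> \<union> ?B \<alpha>)"
  proof (rule subsetI, rule ccontr)
    fix \<omega> assume \<omega>: "\<omega> \<in> {\<omega> \<in> space M. \<exists>k\<le>T * 2 ^ m. a < grid_fluct m k \<omega>}" "\<omega> \<notin> (\<Union>\<alpha>. ?A \<alpha> \<union> ?B \<alpha>)"
    then obtain k where k: "k \<le> T * 2 ^ m" "a < grid_fluct m k \<omega>" by auto
    have "\<bar>N1 \<alpha> k \<omega>\<bar> + \<bar>grid_noise m \<alpha> k \<omega>\<bar> \<le> ?b + ?b" for \<alpha>
    proof (intro add_mono)
      have "\<not> ?b \<le> \<bar>N1 \<alpha> k \<omega>\<bar>" "\<not> ?b \<le> \<bar>grid_noise m \<alpha> k \<omega>\<bar>"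
        using \<omega> k(1) by blast+
      then show "\<bar>N1 \<alpha> k \<omega>\<bar> \<le> ?b" "\<bar>grid_noise m \<alpha> k \<omega>\<bar> \<le> ?b" by simp_all
    qed
    then have "grid_fluct m k \<omega> \<le> (\<Sum>\<alpha>\<in>(UNIV::'n set). ?b + ?b)"
      unfolding grid_fluct_def N1_def by (intro sum_mono) auto
    then show False using k(2) by simp
  qed
  then have "prob {\<omega> \<in> space M. \<exists>k\<le>T * 2 ^ m. a < grid_fluct m k \<omega>} \<le> prob (\<Union>\<alpha>. ?A \<alpha> \<union> ?B \<alpha>)"
    using AB by (intro finite_measure_mono) auto
  also have "\<dots> \<le> (\<Sum>\<alpha>\<in>UNIV. prob (?A \<alpha> \<union> ?B \<alpha>))"
    using AB by (intro finite_measure_subadditive_finite) auto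
  also have "\<dots> \<le> (\<Sum>\<alpha>\<in>(UNIV::'n set). 2 * ?p + 2 * ?p)"
    by (intro sum_mono order_trans[OF measure_Un_le[OF AB]] add_mono pA pB)
  finally show ?thesis by simp
qed

end

section \<open>Convergence of the discretisation\<close>

text \<open>The mean of min 1 |f| metrises convergence in probability and, being an expectation, can
  also be integrated over time.\<close>

lemma (in prob_space) expectation_min_one_le:
  assumes [measurable]: "f \<in> borel_measurable M" and "0 \<le> \<epsilon>"
  shows "expectation (\<lambda>\<omega>. min 1 \<bar>f \<omega>\<bar>) \<le> \<epsilon> + prob {\<omega> \<in> space M. \<epsilon> < \<bar>f \<omega>\<bar>}"
proof -
  let ?A = "{\<omega> \<in> space M. \<epsilon> < \<bar>f \<omega>\<bar>}"
  have indicator: "integrable M (indicat_real ?A)"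
    by (rule integrable_real_indicator) (auto simp: emeasure_eq_measure)
  have "expectation (\<lambda>\<omega>. min 1 \<bar>f \<omega>\<bar>) \<le> expectation (\<lambda>\<omega>. \<epsilon> + indicator ?A \<omega>)"
  proof (rule integral_mono)
    show "integrable M (\<lambda>\<omega>. min 1 \<bar>f \<omega>\<bar>)"
      by (intro integrable_const_bound[where B = 1]) auto
    show "integrable M (\<lambda>\<omega>. \<epsilon> + indicator ?A \<omega> :: real)"
      using \<open>0 \<le> \<epsilon>\<close> by (intro integrable_const_bound[where B = "\<epsilon> + 1"]) (auto simp: indicator_def)
    show "min 1 \<bar>f \<omega>\<bar> \<le> \<epsilon> + indicator ?A \<omega>" if "\<omega> \<in> space M" for \<omega>
      using that \<open>0 \<le> \<epsilon>\<close> by (auto simp: indicator_def)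
  qed
  also have "\<dots> = \<epsilon> + prob ?A"
    using indicator by (simp add: prob_space)
  finally show ?thesis .
qed

lemma (in prob_space) AE_tendsto_imp_expectation_min_one:
  fixes f :: "nat \<Rightarrow> 'a \<Rightarrow> real"
  assumes [measurable]: "\<And>m. f m \<in> borel_measurable M" and ae: "AE \<omega> in M. (\<lambda>m. f m \<omega>) \<longlonglongrightarrow> 0"
  shows "(\<lambda>m. expectation (\<lambda>\<omega>. min 1 \<bar>f m \<omega>\<bar>)) \<longlonglongrightarrow> 0"
proof -
  have "(\<lambda>m. expectation (\<lambda>\<omega>. min 1 \<bar>f m \<omega>\<bar>)) \<longlonglongrightarrow> expectation (\<lambda>\<omega>. 0)"
  proof (rule integral_dominated_convergence[where w = "\<lambda>_. 1"])
    show "AE \<omega> in M. (\<lambda>m. min 1 \<bar>f m \<omega>\<bar>) \<longlonglongrightarrow> 0"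
      using ae
    proof eventually_elim
      case (elim \<omega>)
      then show ?case using tendsto_min[OF tendsto_const tendsto_rabs[OF elim], of 1] by simp
    qed
  qed auto
  then show ?thesis by simp
qed

lemma min_one_tendsto_0D:
  assumes "(\<lambda>m. min 1 \<bar>x m :: real\<bar>) \<longlonglongrightarrow> 0"
  shows "x \<longlonglongrightarrow> 0"
proof (rule tendsto_rabs_zero_cancel, rule tendsto_cong[THEN iffD1, OF _ assms])
  show "\<forall>\<^sub>F m in sequentially. min 1 \<bar>x m\<bar> = \<bar>x m\<bar>"
    using order_tendstoD(2)[OF assms, of 1] by (auto elim!: eventually_mono)
qed

context perturbed_learning begin

lemma random_variables [measurable]:
  shows "t \<ge> 0 \<Longrightarrow> W t \<in> borel_measurable M" "t \<ge> 0 \<Longrightarrow> \<sigma> t \<in> borel_measurable M"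
    and "t \<ge> 0 \<Longrightarrow> I \<alpha> t \<in> borel_measurable M" "grid_noise m \<alpha> k \<in> borel_measurable M"
    and "dW m \<alpha> i \<in> borel_measurable M"
proof -
  note * = measurable_from_subalg[OF subalg]
  show W: "t \<ge> 0 \<Longrightarrow> W t \<in> borel_measurable M" "t \<ge> 0 \<Longrightarrow> \<sigma> t \<in> borel_measurable M" for t
    using *[OF W_adapted] *[OF vol_adapted'] by auto
  show "t \<ge> 0 \<Longrightarrow> I \<alpha> t \<in> borel_measurable M" using ito[of \<alpha>] by (simp add: ito_integral_def)
  show "grid_noise m \<alpha> k \<in> borel_measurable M" using *[OF grid_noise_adapted] .
  show "dW m \<alpha> i \<in> borel_measurable M"
    unfolding dW_def by (intro borel_measurable_diff borel_measurable_nth' W) auto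
qed

section \<open>Left endpoint sums approach the Ito integrals\<close>

lemma AE_continuous:
  "AE \<omega> in M. continuous_on {0..} (\<lambda>t. W t \<omega>) \<and> (\<forall>\<alpha>. continuous_on {0..} (\<lambda>t. I \<alpha> t \<omega>))"
proof -
  have "AE \<omega> in M. continuous_on {0..} (\<lambda>t. I \<alpha> t \<omega>)" for \<alpha>
    using ito[of \<alpha>] by (simp add: ito_integral_def)
  then have "AE \<omega> in M. \<forall>\<alpha>. continuous_on {0..} (\<lambda>t. I \<alpha> t \<omega>)"
    by (simp add: AE_all_countable)
  moreover have "AE \<omega> in M. continuous_on {0..} (\<lambda>t. W t \<omega>)"
    using wiener by (simp add: wiener_process_def)
  ultimately show ?thesis by eventually_elim simp
qed

lemma grid_tendsto_of_continuous:
  fixes f :: "real \<Rightarrow> 'b::topological_space"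
  assumes "continuous_on {0..} f" "s \<ge> 0"
  shows "(\<lambda>m. f (grid m (grid_index m s))) \<longlonglongrightarrow> f s"
  using assms(2) by (intro continuous_on_tendsto_compose[OF assms(1) grid_grid_index_tendsto]) auto

text \<open>The Ito property supplies a mesh bound \<delta> for one fixed time only, while the
  sampled grid point moves with \<open>m\<close>. Hence the property is used at \<open>s\<close>,
  and path continuity removes both the incomplete last cell (\<open>b\<close>) and the increment of
  \<open>I\<close> over that cell (\<open>c\<close>).\<close>

lemma grid_noise_tendsto_expectation:
  assumes s: "s \<ge> 0"
  shows "(\<lambda>m. expectation (\<lambda>\<omega>. min 1 \<bar>grid_noise m \<alpha> (grid_index m s) \<omega> - I \<alpha> (grid m (grid_index m s)) \<omega>\<bar>)) \<longlonglongrightarrow> 0"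
proof -
  let ?k = "\<lambda>m. grid_index m s" let ?g = "\<lambda>m. grid m (?k m)"
  \<comment> \<open>Cutting the grid at \<open>s\<close> makes it a partition ending in
    \<open>s\<close> at index \<open>Suc (?k m)\<close>; if \<open>s\<close> is itself a grid point
    the last cell is degenerate, which \<open>partition_mesh\<close> permits.\<close>
  define p where "p m i = min (grid m i) s" for m i
  define R where "R m \<omega> = (\<Sum>i<Suc (?k m). \<sigma> (p m i) \<omega> $ \<alpha> * (W (p m (Suc i)) \<omega> $ \<alpha> - W (p m i) \<omega> $ \<alpha>))" for m \<omega>
  define b where "b m \<omega> = \<sigma> (?g m) \<omega> $ \<alpha> * (W s \<omega> $ \<alpha> - W (?g m) \<omega> $ \<alpha>)" for m \<omega>
  define c where "c m \<omega> = I \<alpha> s \<omega> - I \<alpha> (?g m) \<omega>" for m \<omega>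
  have p_le: "p m i = grid m i" if "i \<le> ?k m" for m i
    using order_trans[of "grid m i" "?g m" s] grid_index_bounds(1)[OF s, of m] that
    by (simp add: p_def)
  have p_end: "p m (Suc (?k m)) = s" for m
    using grid_index_bounds(2)[OF s, of m] by (simp add: p_def grid_Suc)
  have R_eq: "R m \<omega> = grid_noise m \<alpha> (?k m) \<omega> + b m \<omega>" for m \<omega>
    by (simp add: R_def b_def p_le p_end grid_noise_def walk_def dW_def Suc_le_eq)
  have meas: "(\<lambda>\<omega>. R m \<omega> - I \<alpha> s \<omega>) \<in> borel_measurable M" "b m \<in> borel_measurable M" "c m \<in> borel_measurable M" for m
    unfolding R_eq b_def c_def using s
    by (intro borel_measurable_add borel_measurable_diff borel_measurable_times borel_measurable_nth'
        random_variables grid_simps; assumption)+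
  have lim_a: "(\<lambda>m. expectation (\<lambda>\<omega>. min 1 \<bar>R m \<omega> - I \<alpha> s \<omega>\<bar>)) \<longlonglongrightarrow> 0"
  proof (rule tendstoI)
    fix e :: real assume "e > 0"
    then obtain \<delta> where \<delta>: "\<delta> > 0" "\<And>n p. partition_mesh s \<delta> n p \<Longrightarrow> measure M {\<omega> \<in> space M.
        e / 2 < \<bar>(\<Sum>i<n. \<sigma> (p i) \<omega> $ \<alpha> * (W (p (Suc i)) \<omega> $ \<alpha> - W (p i) \<omega> $ \<alpha>)) - I \<alpha> s \<omega>\<bar>} < e / 2"
      using ito[of \<alpha>] s unfolding ito_integral_def by (meson half_gt_zero)
    show "\<forall>\<^sub>F m in sequentially. dist (expectation (\<lambda>\<omega>. min 1 \<bar>R m \<omega> - I \<alpha> s \<omega>\<bar>)) 0 < e"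
      using order_tendstoD(2)[OF tendsto_inverse_power2 \<delta>(1)]
    proof eventually_elim
      case (elim m)
      have "p m i \<le> p m (Suc i)" for i
        unfolding p_def by (intro min.mono) simp_all
      moreover have "p m (Suc i) - p m i < \<delta>" for i
      proof -
        have "p m (Suc i) \<le> min (grid m (Suc i)) (s + 1 / 2 ^ m)"
          unfolding p_def by (intro min.mono) simp_all
        also have "\<dots> = p m i + 1 / 2 ^ m" by (simp add: p_def grid_Suc min_add_distrib_left)
        finally have "p m (Suc i) \<le> p m i + 1 / 2 ^ m" .
        then show ?thesis using elim by simp
      qed
      ultimately have "partition_mesh s \<delta> (Suc (?k m)) (p m)"
        using s by (simp add: partition_mesh_def p_end) (simp add: p_def)
      then have "prob {\<omega> \<in> space M. e / 2 < \<bar>R m \<omega> - I \<alpha> s \<omega>\<bar>} < e / 2"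
        unfolding R_def by (rule \<delta>(2))
      then have "expectation (\<lambda>\<omega>. min 1 \<bar>R m \<omega> - I \<alpha> s \<omega>\<bar>) < e"
        using expectation_min_one_le[OF meas(1), of "e / 2" m] \<open>e > 0\<close> by simp
      moreover have "0 \<le> expectation (\<lambda>\<omega>. min 1 \<bar>R m \<omega> - I \<alpha> s \<omega>\<bar>)"
        by (intro integral_nonneg_AE AE_I2) simp
      ultimately show ?case by simp
    qed
  qed
  have lim_b: "(\<lambda>m. expectation (\<lambda>\<omega>. min 1 \<bar>b m \<omega>\<bar>)) \<longlonglongrightarrow> 0"
  proof (rule AE_tendsto_imp_expectation_min_one[OF meas(2)])
    show "AE \<omega> in M. (\<lambda>m. b m \<omega>) \<longlonglongrightarrow> 0"
      using AE_continuous AE_space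
    proof eventually_elim
      case (elim \<omega>)
      have "(\<lambda>m. b m \<omega>) \<longlonglongrightarrow> \<sigma> s \<omega> $ \<alpha> * (W s \<omega> $ \<alpha> - W s \<omega> $ \<alpha>)"
        unfolding b_def using elim vol_continuous[of \<omega>] s
        by (intro tendsto_intros grid_tendsto_of_continuous) auto
      then show ?case by simp
    qed
  qed
  have lim_c: "(\<lambda>m. expectation (\<lambda>\<omega>. min 1 \<bar>c m \<omega>\<bar>)) \<longlonglongrightarrow> 0"
  proof (rule AE_tendsto_imp_expectation_min_one[OF meas(3)])
    show "AE \<omega> in M. (\<lambda>m. c m \<omega>) \<longlonglongrightarrow> 0"
      using AE_continuous
    proof eventually_elim
      case (elim \<omega>)
      have "(\<lambda>m. c m \<omega>) \<longlonglongrightarrow> I \<alpha> s \<omega> - I \<alpha> s \<omega>"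
        unfolding c_def using elim s by (intro tendsto_intros grid_tendsto_of_continuous) auto
      then show ?case by simp
    qed
  qed
  let ?E = "\<lambda>m. expectation (\<lambda>\<omega>. min 1 \<bar>grid_noise m \<alpha> (?k m) \<omega> - I \<alpha> (?g m) \<omega>\<bar>)"
  let ?U = "\<lambda>m. expectation (\<lambda>\<omega>. min 1 \<bar>R m \<omega> - I \<alpha> s \<omega>\<bar>) + expectation (\<lambda>\<omega>. min 1 \<bar>b m \<omega>\<bar>)
      + expectation (\<lambda>\<omega>. min 1 \<bar>c m \<omega>\<bar>)"
  have int: "integrable M (\<lambda>\<omega>. min 1 \<bar>f \<omega>\<bar>)" if "f \<in> borel_measurable M" for f :: "'w \<Rightarrow> real"
    using that by (intro integrable_const_bound[where B = 1]) auto
  have bound: "?E m \<le> ?U m" for m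
  proof -
    have "?E m \<le> expectation (\<lambda>\<omega>. min 1 \<bar>R m \<omega> - I \<alpha> s \<omega>\<bar> + min 1 \<bar>b m \<omega>\<bar> + min 1 \<bar>c m \<omega>\<bar>)"
    proof (rule integral_mono)
      show "integrable M (\<lambda>\<omega>. min 1 \<bar>grid_noise m \<alpha> (?k m) \<omega> - I \<alpha> (?g m) \<omega>\<bar>)"
        by (intro int borel_measurable_diff random_variables(3,4)) simp
      show "integrable M (\<lambda>\<omega>. min 1 \<bar>R m \<omega> - I \<alpha> s \<omega>\<bar> + min 1 \<bar>b m \<omega>\<bar> + min 1 \<bar>c m \<omega>\<bar>)"
        by (intro Bochner_Integration.integrable_add int meas)
      have eq: "grid_noise m \<alpha> (?k m) \<omega> - I \<alpha> (?g m) \<omega> = (R m \<omega> - I \<alpha> s \<omega>) - b m \<omega> + c m \<omega>" for \<omega>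
        by (simp add: R_eq c_def)
      have "min 1 \<bar>x - y + z\<bar> \<le> min 1 \<bar>x\<bar> + min 1 \<bar>y\<bar> + min 1 \<bar>z\<bar>" for x y z :: real
        by linarith
      then show "min 1 \<bar>grid_noise m \<alpha> (?k m) \<omega> - I \<alpha> (?g m) \<omega>\<bar>
          \<le> min 1 \<bar>R m \<omega> - I \<alpha> s \<omega>\<bar> + min 1 \<bar>b m \<omega>\<bar> + min 1 \<bar>c m \<omega>\<bar>" for \<omega>
        unfolding eq .
    qed
    also have "\<dots> = ?U m"
      using int[OF meas(1)] int[OF meas(2)] int[OF meas(3)] by simp
    finally show ?thesis .
  qed
  have "?U \<longlonglongrightarrow> 0 + 0 + 0" by (intro tendsto_add lim_a lim_b lim_c)
  then have "?U \<longlonglongrightarrow> 0" by simp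
  moreover have "0 \<le> ?E m" for m by (intro integral_nonneg_AE AE_I2) simp
  ultimately show ?thesis
    by (intro tendsto_sandwich[where f = "\<lambda>_. 0" and g = ?E and h = ?U] always_eventually allI
        tendsto_const bound)
qed

text \<open>Convergence in probability at each time integrates, by dominated convergence over
  {0..T}, to L1 convergence on the product of \<open>M\<close> and time. One subsequence then
  converges almost everywhere on the product, and Fubini gives almost every time for almost every
  path.\<close>

lemma AE_grid_noise_subseq:
  "\<exists>r. strict_mono r \<and> (AE \<omega> in M. AE s in restrict_space lborel {0..T}.
     \<forall>\<alpha>. (\<lambda>m. grid_noise (r m) \<alpha> (grid_index (r m) s) \<omega>
             - I \<alpha> (grid (r m) (grid_index (r m) s)) \<omega>) \<longlonglongrightarrow> 0)"
proof -
  let ?N = "restrict_space lborel {0..T}"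
  define d where "d m \<alpha> s \<omega> = min 1 \<bar>grid_noise m \<alpha> (grid_index m s) \<omega> - I \<alpha> (grid m (grid_index m s)) \<omega>\<bar>" for m \<alpha> s \<omega>
  define Z where "Z m p = (\<Sum>\<alpha>\<in>UNIV. d m \<alpha> (snd p) (fst p))" for m p
  interpret N: finite_measure ?N
    by (intro finite_measureI) (simp add: emeasure_restrict_space space_restrict_space emeasure_lborel_Icc_eq)
  interpret P: pair_sigma_finite M ?N ..
  interpret PF: finite_measure "M \<Otimes>\<^sub>M ?N"
    by (rule finite_measure_pair_measure) unfold_locales
  \<comment> \<open>Joint measurability of \<open>I\<close> is not assumed; since only grid times
    are sampled, the function is glued from countably many functions of \<omega>.\<close>
  have d_meas: "(\<lambda>p. d m \<alpha> (snd p) (fst p)) \<in> borel_measurable (M \<Otimes>\<^sub>M ?N)" for m \<alpha>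
  proof -
    have "(\<lambda>p. (\<lambda>i p. min 1 \<bar>grid_noise m \<alpha> i (fst p) - I \<alpha> (grid m i) (fst p)\<bar>) (grid_index m (snd p)) p)
        \<in> borel_measurable (M \<Otimes>\<^sub>M ?N)"
    proof (rule measurable_compose_countable)
      show "(\<lambda>p. min 1 \<bar>grid_noise m \<alpha> i (fst p) - I \<alpha> (grid m i) (fst p)\<bar>) \<in> borel_measurable (M \<Otimes>\<^sub>M ?N)" for i
        using random_variables(3)[of "grid m i" \<alpha>] by measurable
      have "grid_index m \<in> measurable ?N (count_space UNIV)"
        by (intro measurable_restrict_space1) simp
      then show "(\<lambda>p. grid_index m (snd p)) \<in> measurable (M \<Otimes>\<^sub>M ?N) (count_space UNIV)"
        by measurable
    qed
    then show ?thesis by (simp add: d_def)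
  qed
  have d_bound: "0 \<le> d m \<alpha> s \<omega>" "d m \<alpha> s \<omega> \<le> 1" for m \<alpha> s \<omega> by (auto simp: d_def)
  have d_int: "integrable M (d m \<alpha> s)" for m \<alpha> s
    unfolding d_def using random_variables(3)[of "grid m (grid_index m s)" \<alpha>]
    by (intro integrable_const_bound[where B = 1]) auto
  have Z_int: "integrable (M \<Otimes>\<^sub>M ?N) (Z m)" for m
    unfolding Z_def
    using d_meas d_bound by (intro Bochner_Integration.integrable_sum PF.integrable_const_bound[where B = 1]) auto
  have Z_norm: "norm (Z m p) = Z m p" for m p using d_bound by (simp add: Z_def sum_nonneg)
  have Z_fubini: "(\<integral>p. norm (Z m p) \<partial>(M \<Otimes>\<^sub>M ?N)) = (\<integral>s. (\<Sum>\<alpha>\<in>UNIV. expectation (d m \<alpha> s)) \<partial>?N)" for m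
  proof -
    have "(\<integral>p. norm (Z m p) \<partial>(M \<Otimes>\<^sub>M ?N)) = (\<integral>s. \<integral>\<omega>. Z m (\<omega>, s) \<partial>M \<partial>?N)"
      unfolding Z_norm using P.integral_snd[of "\<lambda>\<omega> s. Z m (\<omega>, s)"] Z_int[of m] by simp
    also have "\<dots> = (\<integral>s. (\<Sum>\<alpha>\<in>UNIV. expectation (d m \<alpha> s)) \<partial>?N)"
      using d_int by (simp add: Z_def)
    finally show ?thesis .
  qed
  have "(\<lambda>m. \<integral>s. (\<Sum>\<alpha>\<in>UNIV. expectation (d m \<alpha> s)) \<partial>?N) \<longlonglongrightarrow> (\<integral>s. 0 \<partial>?N)"
  proof (rule integral_dominated_convergence[where w = "\<lambda>_. real CARD('n)"])
    show "(\<lambda>s. \<Sum>\<alpha>\<in>UNIV. expectation (d m \<alpha> s)) \<in> borel_measurable ?N" for m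
    proof -
      have "(\<lambda>p. d m \<alpha> (fst p) (snd p)) \<in> borel_measurable (?N \<Otimes>\<^sub>M M)" for \<alpha>
        using measurable_compose[OF measurable_pair_swap' d_meas] by (simp add: split_beta')
      then show ?thesis
        by (intro borel_measurable_sum borel_measurable_lebesgue_integral) (simp add: split_beta')
    qed
    show "AE s in ?N. (\<lambda>m. \<Sum>\<alpha>\<in>UNIV. expectation (d m \<alpha> s)) \<longlonglongrightarrow> 0"
    proof (rule AE_I2)
      fix s assume "s \<in> space ?N"
      then have "s \<ge> 0" by (simp add: space_restrict_space)
      then show "(\<lambda>m. \<Sum>\<alpha>\<in>UNIV. expectation (d m \<alpha> s)) \<longlonglongrightarrow> 0"
        unfolding d_def by (intro tendsto_null_sum grid_noise_tendsto_expectation)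
    qed
    show "AE s in ?N. norm (\<Sum>\<alpha>\<in>UNIV. expectation (d m \<alpha> s)) \<le> real CARD('n)" for m
    proof (rule AE_I2)
      fix s
      have "0 \<le> expectation (d m \<alpha> s)" for \<alpha> using d_bound by simp
      moreover have "expectation (d m \<alpha> s) \<le> expectation (\<lambda>_. 1)" for \<alpha>
        using d_bound d_int by (intro integral_mono) auto
      ultimately show "norm (\<Sum>\<alpha>\<in>UNIV. expectation (d m \<alpha> s)) \<le> real CARD('n)"
        using sum_bounded_above[of UNIV "\<lambda>\<alpha>. expectation (d m \<alpha> s)" 1]
        by (simp add: sum_nonneg prob_space)
    qed
  qed auto
  then have "(\<lambda>m. \<integral>p. norm (Z m p) \<partial>(M \<Otimes>\<^sub>M ?N)) \<longlonglongrightarrow> 0"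
    unfolding Z_fubini by simp
  from tendsto_L1_AE_subseq[OF Z_int this] obtain r where r: "strict_mono r"
    "AE p in M \<Otimes>\<^sub>M ?N. (\<lambda>m. Z (r m) p) \<longlonglongrightarrow> 0" by blast
  have "AE \<omega> in M. AE s in ?N. (\<lambda>m. Z (r m) (\<omega>, s)) \<longlonglongrightarrow> 0"
    using P.AE_pair[OF r(2)] by simp
  then have "AE \<omega> in M. AE s in ?N.
     \<forall>\<alpha>. (\<lambda>m. grid_noise (r m) \<alpha> (grid_index (r m) s) \<omega> - I \<alpha> (grid (r m) (grid_index (r m) s)) \<omega>) \<longlonglongrightarrow> 0"
  proof (rule eventually_mono, elim eventually_mono, intro allI)
    fix \<omega> s \<alpha> assume *: "(\<lambda>m. Z (r m) (\<omega>, s)) \<longlonglongrightarrow> 0"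
    have "d (r m) \<alpha> s \<omega> \<le> Z (r m) (\<omega>, s)" for m
      unfolding Z_def using d_bound member_le_sum[of \<alpha> UNIV "\<lambda>\<alpha>. d (r m) \<alpha> s \<omega>"] by simp
    then have "(\<lambda>m. d (r m) \<alpha> s \<omega>) \<longlonglongrightarrow> 0"
      using d_bound by (intro tendsto_sandwich[OF _ _ tendsto_const *]) auto
    then show "(\<lambda>m. grid_noise (r m) \<alpha> (grid_index (r m) s) \<omega> - I \<alpha> (grid (r m) (grid_index (r m) s)) \<omega>) \<longlonglongrightarrow> 0"
      unfolding d_def by (rule min_one_tendsto_0D)
  qed
  then show ?thesis using r(1) by blast
qed

section \<open>Vanishing of the compensated quadratic variation\<close>

lemma grid_qv_expectation_le:
  assumes "grid m k \<le> T"
  shows "integrable M (\<lambda>\<omega>. (\<Sum>i<k. \<eta> (grid m i) * ((dW m \<alpha> i \<omega>)\<^sup>2 - 1 / 2 ^ m))\<^sup>2)" (is ?int)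
    and "expectation (\<lambda>\<omega>. (\<Sum>i<k. \<eta> (grid m i) * ((dW m \<alpha> i \<omega>)\<^sup>2 - 1 / 2 ^ m))\<^sup>2)
      \<le> 2 * T * (\<eta> 0)\<^sup>2 * (1 / 2 ^ m)" (is "?E \<le> _")
proof -
  interpret G: gaussian_walk M "\<lambda>i. F (grid m i)" "dW m \<alpha>" "1 / 2 ^ m"
    by (rule gaussian_walk_grid)
  show ?int by (rule G.weighted_squares_variance)
  have "?E = 2 * (1 / 2 ^ m)\<^sup>2 * (\<Sum>i<k. (\<eta> (grid m i))\<^sup>2)"
    by (rule G.weighted_squares_variance)
  also have "\<dots> \<le> 2 * (1 / 2 ^ m)\<^sup>2 * (\<Sum>i<k. (\<eta> 0)\<^sup>2)"
  proof (intro mult_left_mono sum_mono power_mono)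
    show "\<eta> (grid m i) \<le> \<eta> 0" "0 \<le> \<eta> (grid m i)" for i
      using monotone_onD[OF rate_antimono, of 0 "grid m i"] rate_pos[of "grid m i"] by auto
  qed auto
  also have "\<dots> = 2 * grid m k * (\<eta> 0)\<^sup>2 * (1 / 2 ^ m)"
    by (simp add: grid_def power2_eq_square)
  also have "\<dots> \<le> 2 * T * (\<eta> 0)\<^sup>2 * (1 / 2 ^ m)"
    using assms by (intro mult_right_mono) auto
  finally show "?E \<le> 2 * T * (\<eta> 0)\<^sup>2 * (1 / 2 ^ m)" .
qed

text \<open>Second moments of order 2^-m give L1 convergence of the sum \<open>u\<close> of all
  squares, over the finitely many target times and all actions; a single further subsequence
  therefore serves all of them.\<close>

lemma AE_grid_qv_subseq:
  fixes r :: "nat \<Rightarrow> nat"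
  assumes "strict_mono r" "finite A" and A: "\<And>j m. j \<in> A \<Longrightarrow> grid m (k m j) \<le> T"
  shows "\<exists>r'. strict_mono r' \<and> (AE \<omega> in M. \<forall>j\<in>A.
    (\<lambda>m. grid_qv (r (r' m)) (k (r (r' m)) j) \<omega>) \<longlonglongrightarrow> 0)"
proof -
  define S where "S m j \<alpha> \<omega> = (\<Sum>i<k m j. \<eta> (grid m i) * ((dW m \<alpha> i \<omega>)\<^sup>2 - 1 / 2 ^ m))" for m j \<alpha> \<omega>
  define u where "u m \<omega> = (\<Sum>j\<in>A. \<Sum>\<alpha>\<in>UNIV. (S m j \<alpha> \<omega>)\<^sup>2)" for m \<omega>
  have S: "integrable M (\<lambda>\<omega>. (S m j \<alpha> \<omega>)\<^sup>2)"
    "expectation (\<lambda>\<omega>. (S m j \<alpha> \<omega>)\<^sup>2) \<le> 2 * T * (\<eta> 0)\<^sup>2 * (1 / 2 ^ m)" if "j \<in> A" for m j \<alpha>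
    unfolding S_def by (rule grid_qv_expectation_le[OF A[OF that]])+
  have u_int: "integrable M (u (r m))" for m
    unfolding u_def using S by (intro Bochner_Integration.integrable_sum) auto
  have u_norm: "norm (u m \<omega>) = u m \<omega>" for m \<omega> by (simp add: u_def sum_nonneg)
  have u_exp: "expectation (\<lambda>\<omega>. norm (u m \<omega>)) \<le> real (card A) * (real CARD('n) * (2 * T * (\<eta> 0)\<^sup>2 * (1 / 2 ^ m)))" for m
  proof -
    have "expectation (\<lambda>\<omega>. norm (u m \<omega>)) = (\<Sum>j\<in>A. \<Sum>\<alpha>\<in>UNIV. expectation (\<lambda>\<omega>. (S m j \<alpha> \<omega>)\<^sup>2))"
      unfolding u_norm unfolding u_def using S(1)
      by (simp add: Bochner_Integration.integral_sum Bochner_Integration.integrable_sum)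
    also have "\<dots> \<le> (\<Sum>j\<in>A. \<Sum>\<alpha>\<in>(UNIV :: 'n set). 2 * T * (\<eta> 0)\<^sup>2 * (1 / 2 ^ m))"
      using S(2) by (intro sum_mono) auto
    finally show ?thesis by simp
  qed
  have "(\<lambda>m. real (card A) * (real CARD('n) * (2 * T * (\<eta> 0)\<^sup>2 * (1 / 2 ^ m)))) \<longlonglongrightarrow>
      real (card A) * (real CARD('n) * (2 * T * (\<eta> 0)\<^sup>2 * 0))"
    by (intro tendsto_intros tendsto_inverse_power2)
  then have "(\<lambda>m. expectation (\<lambda>\<omega>. norm (u m \<omega>))) \<longlonglongrightarrow> 0"
    by (intro tendsto_sandwich[of "\<lambda>_. 0", OF _ always_eventually[OF allI[OF u_exp]] tendsto_const])
      (simp_all add: always_eventually)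
  then have "(\<lambda>m. expectation (\<lambda>\<omega>. norm (u (r m) \<omega>))) \<longlonglongrightarrow> 0"
    by (rule filterlim_compose[OF _ filterlim_subseq[OF assms(1)]])
  from tendsto_L1_AE_subseq[OF u_int this] obtain r' where r': "strict_mono r'"
    "AE \<omega> in M. (\<lambda>m. u (r (r' m)) \<omega>) \<longlonglongrightarrow> 0" by blast
  from r'(2) have "AE \<omega> in M. \<forall>j\<in>A. (\<lambda>m. grid_qv (r (r' m)) (k (r (r' m)) j) \<omega>) \<longlonglongrightarrow> 0"
  proof (eventually_elim, intro ballI)
    fix \<omega> j assume *: "(\<lambda>m. u (r (r' m)) \<omega>) \<longlonglongrightarrow> 0" and j: "j \<in> A"
    have "(\<lambda>m. S (r (r' m)) j \<alpha> \<omega>) \<longlonglongrightarrow> 0" for \<alpha>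
    proof -
      have "(S m j \<alpha> \<omega>)\<^sup>2 \<le> u m \<omega>" for m
      proof -
        have "(S m j \<alpha> \<omega>)\<^sup>2 \<le> (\<Sum>\<alpha>\<in>UNIV. (S m j \<alpha> \<omega>)\<^sup>2)" by (intro member_le_sum) auto
        also have "\<dots> \<le> u m \<omega>" unfolding u_def
          using j \<open>finite A\<close> by (intro member_le_sum) (auto intro: sum_nonneg)
        finally show ?thesis .
      qed
      then have "(\<lambda>m. (S (r (r' m)) j \<alpha> \<omega>)\<^sup>2) \<longlonglongrightarrow> 0"
        by (intro tendsto_sandwich[OF _ _ tendsto_const *] always_eventually allI) simp_all
      then show ?thesis by simp
    qed
    then show "(\<lambda>m. grid_qv (r (r' m)) (k (r (r' m)) j) \<omega>) \<longlonglongrightarrow> 0"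
      unfolding grid_qv_def S_def by (rule tendsto_null_sum)
  qed
  then show ?thesis using r'(1) by blast
qed

section \<open>Passing to the limit along a path\<close>

lemma choice_continuous:
  assumes "\<omega> \<in> space M" "\<And>\<alpha>. continuous_on {0..} (\<lambda>t. I \<alpha> t \<omega>)"
  shows "continuous_on {0..} (\<lambda>t. choice t \<omega>)"
proof -
  have "continuous_on {0..} (\<lambda>t. cum_payoff t \<omega>)"
    unfolding cum_payoff_def using payoff_integrable[OF assms(1)] by (rule continuous_on_indefinite_integral)
  then have "continuous_on {0..} (\<lambda>t. \<eta> t *\<^sub>R (cum_payoff t \<omega> + (\<chi> \<alpha>. I \<alpha> t \<omega>)))"
    using assms(2) by (intro continuous_intros continuous_on_vec_lambda rate_continuous)
  then show ?thesis
    unfolding choice_def by (rule continuous_on_compose2[OF continuous_on_choice_map[OF penalty, of UNIV]]) simp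
qed

lemma choice_set_measurable:
  assumes "\<omega> \<in> space M" "\<And>\<alpha>. continuous_on {0..} (\<lambda>t. I \<alpha> t \<omega>)"
  shows "set_borel_measurable lborel {0..t} (\<lambda>s. choice s \<omega>)"
  unfolding set_borel_measurable_def
  using borel_measurable_continuous_on_indicator[of "{0..t}" "\<lambda>s. choice s \<omega>"]
    continuous_on_subset[OF choice_continuous[OF assms], of "{0..t}"]
  by (auto simp: subset_iff)

text \<open>The noise is compared with \<open>I\<close> at the sampled grid point, continuity of the
  path of \<open>I\<close> moves that point to \<open>s\<close>, and continuity of the choice map
  transfers the limit.\<close>

lemma grid_choice_tendsto:
  assumes \<omega>: "\<omega> \<in> space M" "\<And>\<alpha>. continuous_on {0..} (\<lambda>t. I \<alpha> t \<omega>)" and s: "s \<ge> 0"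
    and r: "strict_mono r"
    and lim: "\<And>\<alpha>. (\<lambda>m. grid_noise (r m) \<alpha> (grid_index (r m) s) \<omega>
             - I \<alpha> (grid (r m) (grid_index (r m) s)) \<omega>) \<longlonglongrightarrow> 0"
  shows "(\<lambda>m. grid_choice (r m) (grid_index (r m) s) \<omega>) \<longlonglongrightarrow> choice s \<omega>"
proof -
  have sub: "(\<lambda>m. f (grid (r m) (grid_index (r m) s))) \<longlonglongrightarrow> f s"
    if "continuous_on {0..} f" for f :: "real \<Rightarrow> 'b::topological_space"
    using filterlim_compose[OF grid_tendsto_of_continuous[OF that s] filterlim_subseq[OF r]] .
  have cont: "continuous_on {0..} (\<lambda>t. cum_payoff t \<omega>)"
    unfolding cum_payoff_def using payoff_integrable[OF \<omega>(1)] by (rule continuous_on_indefinite_integral)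
  have noise: "(\<lambda>m. grid_noise (r m) \<alpha> (grid_index (r m) s) \<omega>) \<longlonglongrightarrow> I \<alpha> s \<omega>" for \<alpha>
    using tendsto_add[OF lim[of \<alpha>] sub[OF \<omega>(2), of \<alpha>]] by simp
  have "isCont (choice_map h) y" for y
    using continuous_on_choice_map[OF penalty, of UNIV] by (simp add: continuous_on_eq_continuous_at)
  then show ?thesis
    unfolding grid_choice_def choice_def
    by (rule isCont_tendsto_compose) (intro tendsto_intros tendsto_vec_lambda noise sub cont rate_continuous)
qed

text \<open>Choices have norm at most 1, so the norm of \<open>v\<close> dominates; dominated
  convergence tolerates the exceptional null set of times.\<close>

lemma payoff_integral_tendsto:
  assumes \<omega>: "\<omega> \<in> space M" "\<And>\<alpha>. continuous_on {0..} (\<lambda>t. I \<alpha> t \<omega>)"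
    and r: "strict_mono r" and t: "0 \<le> t" "t \<le> T"
    and lim: "AE s in restrict_space lborel {0..T}. \<forall>\<alpha>. (\<lambda>m. grid_noise (r m) \<alpha> (grid_index (r m) s) \<omega>
             - I \<alpha> (grid (r m) (grid_index (r m) s)) \<omega>) \<longlonglongrightarrow> 0"
  shows "(\<lambda>m. LINT s:{0..t}|lborel. v s \<omega> \<bullet> grid_choice (r m) (grid_index (r m) s) \<omega>)
    \<longlonglongrightarrow> (LINT s:{0..t}|lborel. v s \<omega> \<bullet> choice s \<omega>)"
  unfolding set_lebesgue_integral_def
proof (rule integral_dominated_convergence[where w = "\<lambda>s. indicator {0..t} s *\<^sub>R norm (v s \<omega>)"])
  note v = payoff_integrable[OF \<omega>(1) t(1)]
  have "set_integrable lborel {0..t} (\<lambda>s. v s \<omega> \<bullet> choice s \<omega>)"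
    using norm_prob_simplex_le[OF choice_simplex]
    by (intro set_integrable_inner_bounded v choice_set_measurable \<omega>) auto
  then show "(\<lambda>s. indicator {0..t} s *\<^sub>R (v s \<omega> \<bullet> choice s \<omega>)) \<in> borel_measurable lborel"
    by (simp add: set_integrable_def)
  have "set_integrable lborel {0..t} (\<lambda>s. v s \<omega> \<bullet> grid_choice (r m) (grid_index (r m) s) \<omega>)" for m
    using norm_prob_simplex_le[OF grid_choice_simplex]
    by (intro set_integrable_inner_bounded v) (auto simp: set_borel_measurable_def)
  then show "(\<lambda>s. indicator {0..t} s *\<^sub>R (v s \<omega> \<bullet> grid_choice (r m) (grid_index (r m) s) \<omega>)) \<in> borel_measurable lborel" for m
    by (simp add: set_integrable_def)
  show "integrable lborel (\<lambda>s. indicator {0..t} s *\<^sub>R norm (v s \<omega>))"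
    using set_integrable_norm[OF v] by (simp add: set_integrable_def)
  show "AE s in lborel. norm (indicator {0..t} s *\<^sub>R (v s \<omega> \<bullet> grid_choice (r m) (grid_index (r m) s) \<omega>))
      \<le> indicator {0..t} s *\<^sub>R norm (v s \<omega>)" for m
  proof (rule AE_I2)
    fix s
    have "\<bar>v s \<omega> \<bullet> x\<bar> \<le> norm (v s \<omega>)" if "norm x \<le> 1" for x
      using Cauchy_Schwarz_ineq2[of "v s \<omega>" x] mult_left_mono[OF that, of "norm (v s \<omega>)"] by simp
    from this[OF norm_prob_simplex_le[OF grid_choice_simplex]]
    show "norm (indicator {0..t} s *\<^sub>R (v s \<omega> \<bullet> grid_choice (r m) (grid_index (r m) s) \<omega>))
      \<le> indicator {0..t} s *\<^sub>R norm (v s \<omega>)" by (simp add: indicator_def)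
  qed
  have "AE s in lborel. s \<in> {0..T} \<longrightarrow> (\<forall>\<alpha>. (\<lambda>m. grid_noise (r m) \<alpha> (grid_index (r m) s) \<omega>
             - I \<alpha> (grid (r m) (grid_index (r m) s)) \<omega>) \<longlonglongrightarrow> 0)"
    using lim by (subst (asm) AE_restrict_space_iff) auto
  then show "AE s in lborel. (\<lambda>m. indicator {0..t} s *\<^sub>R (v s \<omega> \<bullet> grid_choice (r m) (grid_index (r m) s) \<omega>))
      \<longlonglongrightarrow> indicator {0..t} s *\<^sub>R (v s \<omega> \<bullet> choice s \<omega>)"
  proof eventually_elim
    case (elim s)
    show ?case
    proof (cases "s \<in> {0..t}")
      case True
      then have "(\<lambda>m. grid_choice (r m) (grid_index (r m) s) \<omega>) \<longlonglongrightarrow> choice s \<omega>"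
        using elim t by (intro grid_choice_tendsto \<omega> r) auto
      then show ?thesis by (intro tendsto_intros)
    qed simp
  qed
qed

text \<open>The strict inequality leaves room for the errors in \<open>choice_grid_bound\<close>:
  the payoff integrals and \<open>grid_qv\<close> converge along the subsequence, and the remaining
  term is made small through \<delta>.\<close>

lemma choice_grid_bound_limit:
  assumes \<omega>: "\<omega> \<in> space M" "\<And>\<alpha>. continuous_on {0..} (\<lambda>t. I \<alpha> t \<omega>)" "continuous_on {0..} (\<lambda>t. W t \<omega>)"
    and r: "strict_mono r" and t: "t \<le> T" "\<And>m. m \<ge> l \<Longrightarrow> grid m (k m) = t"
    and lim: "AE s in restrict_space lborel {0..T}. \<forall>\<alpha>. (\<lambda>m. grid_noise (r m) \<alpha> (grid_index (r m) s) \<omega>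
             - I \<alpha> (grid (r m) (grid_index (r m) s)) \<omega>) \<longlonglongrightarrow> 0"
    and qv: "(\<lambda>m. grid_qv (r m) (k (r m)) \<omega>) \<longlonglongrightarrow> 0"
    and a: "a < excess t \<omega>"
  shows "\<forall>\<^sub>F m in sequentially. a < grid_fluct (r m) (k (r m)) \<omega>"
proof -
  let ?S = "sigma_max (\<lambda>s. \<sigma> s \<omega>)" and ?n = "real CARD('n)"
  define L where "L = (LINT s:{0..t}|lborel. norm (v s \<omega>))"
  define err where "err \<delta> m = (LINT s:{0..t}|lborel. v s \<omega> \<bullet> grid_choice (r m) (grid_index (r m) s) \<omega>)
       - (LINT s:{0..t}|lborel. v s \<omega> \<bullet> choice s \<omega>)
    + (?S\<^sup>2 * (grid_qv (r m) (k (r m)) \<omega> + ?n * \<eta> 0 / 2 ^ r m) + \<eta> 0 * \<delta> * L) / (2 * K)" for \<delta> m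
  have t0: "0 \<le> t" using t(2)[of l] grid_simps(1)[of l "k l"] by simp
  have L0: "0 \<le> L"
    unfolding L_def set_lebesgue_integral_def by (intro integral_nonneg_AE AE_I2) simp
  have cont: "continuous_on {0..} (\<lambda>t. cum_payoff t \<omega>)"
    unfolding cum_payoff_def using payoff_integrable[OF \<omega>(1)] by (rule continuous_on_indefinite_integral)
  obtain \<delta> where \<delta>: "\<delta> > 0" "\<eta> 0 * \<delta> * L / (2 * K) < excess t \<omega> - a"
  proof
    \<comment> \<open>With this value the error is the factor L / (2 (L + 1)) < 1 times the
      available room; L + 1 replaces L because L may be 0.\<close>
    let ?d = "(excess t \<omega> - a) * K / (\<eta> 0 * (L + 1))"
    have e0: "\<eta> 0 > 0" using rate_pos[of 0] by simp
    show "?d > 0" using a K_pos e0 L0 by simp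
    have "\<eta> 0 * ?d * L / (2 * K) = (excess t \<omega> - a) * (L / (2 * (L + 1)))"
      using e0 K_pos by simp
    also have "\<dots> < (excess t \<omega> - a) * 1"
      using a L0 by (intro mult_strict_left_mono) (auto simp: divide_less_eq)
    finally show "\<eta> 0 * ?d * L / (2 * K) < excess t \<omega> - a" by simp
  qed
  have ev_r: "\<forall>\<^sub>F m in sequentially. P (r m)" if "eventually P sequentially" for P
    using eventually_compose_filterlim[OF that filterlim_subseq[OF r]] .
  have err_lim: "err \<delta> \<longlonglongrightarrow> (LINT s:{0..t}|lborel. v s \<omega> \<bullet> choice s \<omega>) - (LINT s:{0..t}|lborel. v s \<omega> \<bullet> choice s \<omega>)
    + (?S\<^sup>2 * (0 + ?n * \<eta> 0 * 0) + \<eta> 0 * \<delta> * L) / (2 * K)"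
  proof -
    have "(\<lambda>m. 1 / 2 ^ r m :: real) \<longlonglongrightarrow> 0"
      using filterlim_compose[OF tendsto_inverse_power2 filterlim_subseq[OF r]] .
    then have "(\<lambda>m. ?n * \<eta> 0 * (1 / 2 ^ r m)) \<longlonglongrightarrow> ?n * \<eta> 0 * 0"
      by (rule tendsto_mult_left)
    then have "(\<lambda>m. ?n * \<eta> 0 / 2 ^ r m) \<longlonglongrightarrow> ?n * \<eta> 0 * 0" by simp
    then show ?thesis
      unfolding err_def using K_pos
      by (intro tendsto_add tendsto_diff tendsto_divide tendsto_mult_left tendsto_const qv
          payoff_integral_tendsto[OF \<omega>(1,2) r t0 t(1) lim]) auto
  qed
  have "\<forall>\<^sub>F m in sequentially. err \<delta> m < excess t \<omega> - a"
    using \<delta>(2) by (intro order_tendstoD(2)[OF err_lim]) simp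
  moreover have "\<forall>\<^sub>F m in sequentially. excess t \<omega> \<le> grid_fluct (r m) (k (r m)) \<omega> + err \<delta> m"
  proof -
    \<comment> \<open>The budget \<delta> is halved: the Wiener increment carries the factor 2 C,
      hence its threshold \<delta> / (4 C).\<close>
    have "\<forall>\<^sub>F m in sequentially. \<forall>i. grid m (Suc i) \<le> t \<longrightarrow>
        norm (cum_payoff (grid m (Suc i)) \<omega> - cum_payoff (grid m i) \<omega>) < \<delta> / 2"
      using \<delta>(1) by (intro grid_increments_small cont) simp
    moreover have "\<forall>\<^sub>F m in sequentially. \<forall>i. grid m (Suc i) \<le> t \<longrightarrow>
        norm (W (grid m (Suc i)) \<omega> - W (grid m i) \<omega>) < \<delta> / (4 * C)"
      using \<delta>(1) vol_bound_pos by (intro grid_increments_small \<omega>(3)) simp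
    moreover have "\<forall>\<^sub>F m in sequentially. m \<ge> l" by (rule eventually_ge_at_top)
    ultimately have "\<forall>\<^sub>F m in sequentially. m \<ge> l \<and> (\<forall>i<k m.
        norm (cum_payoff (grid m (Suc i)) \<omega> - cum_payoff (grid m i) \<omega>)
          + 2 * C * norm (W (grid m (Suc i)) \<omega> - W (grid m i) \<omega>) \<le> \<delta>)"
    proof (eventually_elim, intro conjI allI impI)
      fix m i assume *: "\<forall>i. grid m (Suc i) \<le> t \<longrightarrow>
          norm (cum_payoff (grid m (Suc i)) \<omega> - cum_payoff (grid m i) \<omega>) < \<delta> / 2"
        "\<forall>i. grid m (Suc i) \<le> t \<longrightarrow> norm (W (grid m (Suc i)) \<omega> - W (grid m i) \<omega>) < \<delta> / (4 * C)"
        and ml: "l \<le> m" and i: "i < k m"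
      have "grid m (Suc i) \<le> t" using t(2)[OF ml] i by (metis grid_simps(3) Suc_leI)
      then have "norm (cum_payoff (grid m (Suc i)) \<omega> - cum_payoff (grid m i) \<omega>) \<le> \<delta> / 2"
        "norm (W (grid m (Suc i)) \<omega> - W (grid m i) \<omega>) \<le> \<delta> / (4 * C)"
        using * by (auto intro: less_imp_le)
      then show "norm (cum_payoff (grid m (Suc i)) \<omega> - cum_payoff (grid m i) \<omega>)
          + 2 * C * norm (W (grid m (Suc i)) \<omega> - W (grid m i) \<omega>) \<le> \<delta>"
        using vol_bound_pos mult_left_mono[of _ "\<delta> / (4 * C)" "2 * C"] by fastforce
    qed
    from ev_r[OF this] show ?thesis
    proof eventually_elim
      case (elim m)
      have "excess (grid (r m) (k (r m))) \<omega> \<le> grid_fluct (r m) (k (r m)) \<omega> + err \<delta> m"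
        using choice_grid_bound[OF \<omega>(1), of \<delta> "k (r m)" "r m"] elim \<delta>(1) t(2)[of "r m"]
        by (simp add: err_def L_def)
      then show ?case using elim t(2) by simp
    qed
  qed
  ultimately show ?thesis by eventually_elim linarith
qed

text \<open>At level \<open>l\<close> only finitely many times lie below \<open>T\<close>, so one
  subsequence and one null set handle all of them; the subsequence may depend on \<open>l\<close>
  and \<open>T\<close>.\<close>

lemma AE_excess_le_grid_fluct:
  "\<exists>r :: nat \<Rightarrow> nat. strict_mono r \<and> (AE \<omega> in M. \<forall>j a. grid l j \<le> T \<longrightarrow> a < excess (grid l j) \<omega> \<longrightarrow>
     (\<forall>\<^sub>F m in sequentially. a < grid_fluct (r m) (j * 2 ^ (r m - l)) \<omega>))"
proof -
  obtain r where r: "strict_mono r" and lim: "AE \<omega> in M. AE s in restrict_space lborel {0..T}.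
     \<forall>\<alpha>. (\<lambda>m. grid_noise (r m) \<alpha> (grid_index (r m) s) \<omega>
             - I \<alpha> (grid (r m) (grid_index (r m) s)) \<omega>) \<longlonglongrightarrow> 0"
    using AE_grid_noise_subseq by blast
  define A where "A = {j. grid l j \<le> T}"
  \<comment> \<open>Levels coarser than \<open>l\<close> may miss the target time; the default index
    0 keeps the sampled time below \<open>T\<close> there, so that the moment bound holds at every
    level.\<close>
  define k where "k m j = (if l \<le> m then j * 2 ^ (m - l) else 0)" for m j :: nat
  have grid_k: "grid m (k m j) = grid l j" if "m \<ge> l" for m j
    using that by (simp add: k_def grid_def field_simps flip: power_add)
  have "A \<subseteq> {..nat \<lceil>T * 2 ^ l\<rceil>}"
    by (auto simp: A_def grid_def field_simps) linarith
  then have "finite A" by (rule finite_subset) simp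
  moreover have "grid m (k m j) \<le> T" if "j \<in> A" for m j
    using that grid_k[of m j] order_trans[OF grid_simps(1)[of l j], of T]
    by (cases "l \<le> m") (auto simp: A_def k_def)
  ultimately obtain r' where r': "strict_mono r'" and qv: "AE \<omega> in M. \<forall>j\<in>A.
    (\<lambda>m. grid_qv (r (r' m)) (k (r (r' m)) j) \<omega>) \<longlonglongrightarrow> 0"
    using AE_grid_qv_subseq[OF r, of A k] by blast
  have rr: "strict_mono (\<lambda>m. r (r' m))" using r r' by (simp add: strict_mono_def)
  have large: "\<forall>\<^sub>F m in sequentially. l \<le> r (r' m)"
    using filterlim_subseq[OF rr] by (simp add: filterlim_at_top)
  have "AE \<omega> in M. \<forall>j a. grid l j \<le> T \<longrightarrow> a < excess (grid l j) \<omega> \<longrightarrow>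
     (\<forall>\<^sub>F m in sequentially. a < grid_fluct (r (r' m)) (j * 2 ^ (r (r' m) - l)) \<omega>)"
    using lim qv AE_continuous AE_space
  proof (eventually_elim, intro allI impI)
    fix \<omega> j a
    assume 1: "AE s in restrict_space lborel {0..T}.
      \<forall>\<alpha>. (\<lambda>m. grid_noise (r m) \<alpha> (grid_index (r m) s) \<omega>
             - I \<alpha> (grid (r m) (grid_index (r m) s)) \<omega>) \<longlonglongrightarrow> 0"
      and 2: "\<forall>j\<in>A. (\<lambda>m. grid_qv (r (r' m)) (k (r (r' m)) j) \<omega>) \<longlonglongrightarrow> 0"
      and 3: "continuous_on {0..} (\<lambda>t. W t \<omega>) \<and> (\<forall>\<alpha>. continuous_on {0..} (\<lambda>t. I \<alpha> t \<omega>))"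
      and 4: "\<omega> \<in> space M" and j: "grid l j \<le> T" and a: "a < excess (grid l j) \<omega>"
    have "\<forall>\<^sub>F m in sequentially. a < grid_fluct (r (r' m)) (k (r (r' m)) j) \<omega>"
    proof (rule choice_grid_bound_limit[OF 4 _ _ rr j grid_k _ _ a])
      show "AE s in restrict_space lborel {0..T}.
        \<forall>\<alpha>. (\<lambda>m. grid_noise (r (r' m)) \<alpha> (grid_index (r (r' m)) s) \<omega>
             - I \<alpha> (grid (r (r' m)) (grid_index (r (r' m)) s)) \<omega>) \<longlonglongrightarrow> 0"
        using 1 by (elim eventually_mono) (use filterlim_compose[OF _ filterlim_subseq[OF r']] in blast)
    qed (use 2 3 j in \<open>auto simp: A_def\<close>)
    with large show "\<forall>\<^sub>F m in sequentially. a < grid_fluct (r (r' m)) (j * 2 ^ (r (r' m) - l)) \<omega>"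
      by eventually_elim (simp add: k_def)
  qed
  then show ?thesis using rr by blast
qed

end

section \<open>Almost sure bounds\<close>

text \<open>Fatou's lemma for events: the tail intersections increase to the event, and each is
  contained in some \<open>A N\<close>.\<close>

lemma (in prob_space) prob_eventually_le:
  fixes A :: "nat \<Rightarrow> 'a set"
  assumes A: "\<And>m. A m \<in> events" and p: "\<And>m. prob (A m) \<le> p"
  shows "{\<omega> \<in> space M. \<forall>\<^sub>F m in sequentially. \<omega> \<in> A m} \<in> events"
    and "prob {\<omega> \<in> space M. \<forall>\<^sub>F m in sequentially. \<omega> \<in> A m} \<le> p"
proof -
  have eq: "{\<omega> \<in> space M. \<forall>\<^sub>F m in sequentially. \<omega> \<in> A m} = (\<Union>N. \<Inter>m\<in>{N..}. A m)"
    using sets.sets_into_space[OF A] by (auto simp: eventually_sequentially)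
  have B: "(\<Inter>m\<in>{N..}. A m) \<in> events" for N
    using A by (intro sets.countable_INT') auto
  then show "{\<omega> \<in> space M. \<forall>\<^sub>F m in sequentially. \<omega> \<in> A m} \<in> events" unfolding eq by auto
  have "(\<lambda>N. prob (\<Inter>m\<in>{N..}. A m)) \<longlonglongrightarrow> prob (\<Union>N. \<Inter>m\<in>{N..}. A m)"
    using B by (intro finite_Lim_measure_incseq) (auto simp: incseq_def intro: order_trans)
  moreover have "prob (\<Inter>m\<in>{N..}. A m) \<le> p" for N
    by (rule order_trans[OF finite_measure_mono[OF _ A[of N]] p]) auto
  ultimately show "prob {\<omega> \<in> space M. \<forall>\<^sub>F m in sequentially. \<omega> \<in> A m} \<le> p"
    unfolding eq by (intro LIMSEQ_le_const2) auto
qed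

section \<open>Asymptotics of means and of dyadic iterated logarithms\<close>

lemma integral_mean_tendsto_0:
  assumes int: "\<And>t. set_integrable lborel {0..t} f" and lim: "(f \<longlongrightarrow> (0 :: real)) at_top"
    and nonneg: "\<And>t. t \<ge> 0 \<Longrightarrow> 0 \<le> f t"
  shows "((\<lambda>t. (LINT s:{0..t}|lborel. f s) / t) \<longlongrightarrow> 0) at_top"
proof (rule tendstoI)
  fix e :: real assume e: "e > 0"
  have "\<forall>\<^sub>F t in at_top. f t < e / 2" using order_tendstoD(2)[OF lim, of "e / 2"] e by simp
  then obtain b where b: "\<And>t. t \<ge> b \<Longrightarrow> f t < e / 2" by (auto simp: eventually_at_top_linorder)
  \<comment> \<open>Beyond \<open>T\<close> the integrand is below e / 2; the mass before
    \<open>T\<close> is a fixed number that disappears after division by t.\<close>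
  define T where "T = max b 0"
  define A where "A = (LINT s:{0..T}|lborel. f s)"
  have "\<forall>\<^sub>F t in at_top. A / t < e / 2"
    using e by real_asymp
  then show "\<forall>\<^sub>F t in at_top. dist ((LINT s:{0..t}|lborel. f s) / t) 0 < e"
    using eventually_ge_at_top[of "T + 1"]
  proof eventually_elim
    case (elim t)
    then have t: "t > 0" "T \<le> t" "0 \<le> T" by (auto simp: T_def)
    have sub: "set_integrable lborel {T<..t} f" using t by (intro set_integrable_subset[OF int[of t]]) auto
    have "(LINT s:{T<..t}|lborel. f s) \<le> (LINT s:{T<..t}|lborel. e / 2)"
    proof (rule set_integral_mono[OF sub])
      have "integrable lborel (indicat_real {T<..t})" by (rule integrable_real_indicator) (use t in auto)
      then show "set_integrable lborel {T<..t} (\<lambda>s. e / 2)"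
        unfolding set_integrable_def real_scaleR_def by (rule integrable_mult_left)
      show "f s \<le> e / 2" if "s \<in> {T<..t}" for s
        using b[of s] that by (simp add: T_def)
    qed
    also have "\<dots> = (t - T) * (e / 2)" using t by (simp add: set_lebesgue_integral_def)
    also have "\<dots> \<le> t * (e / 2)" using t e by (intro mult_right_mono) auto
    finally have "(LINT s:{0..t}|lborel. f s) \<le> A + t * (e / 2)"
      using set_integral_split[OF int[of t], of T] t by (simp add: A_def)
    then have "(LINT s:{0..t}|lborel. f s) / t \<le> A / t + e / 2"
      using t by (simp add: field_simps)
    moreover have "0 \<le> (LINT s:{0..t}|lborel. f s)"
      unfolding set_lebesgue_integral_def using nonneg
      by (intro integral_nonneg_AE AE_I2) (auto simp: indicator_def)
    moreover have "A / t < e / 2" using elim(1) .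
    ultimately have "0 \<le> (LINT s:{0..t}|lborel. f s) / t" "(LINT s:{0..t}|lborel. f s) / t < e"
      using t by (simp, linarith)
    then show ?case by (simp add: dist_real_def)
  qed
qed

text \<open>From 2^j \<le> 2 t one gets j + 2 \<le> ln t / ln 2 + 3 \<le> (ln t)^2 for large t, so
  the logarithm of j + 2 is at most 2 ln (ln t). With the other factor 2 this makes 4 under the
  root.\<close>

lemma loglog_dyadic_bound:
  "\<forall>\<^sub>F t :: real in at_top. \<forall>j. t \<le> 2 ^ j \<longrightarrow> 2 ^ j \<le> 2 * t \<longrightarrow>
     sqrt (2 ^ j * ln (real j + 2)) \<le> 2 * sqrt (t * ln (ln t))"
proof -
  have "\<forall>\<^sub>F t :: real in at_top. 0 < ln t" "\<forall>\<^sub>F t :: real in at_top. ln t / ln 2 + 3 \<le> (ln t)\<^sup>2"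
    by real_asymp+
  then show ?thesis
    using eventually_gt_at_top[of 1]
  proof (eventually_elim, intro allI impI)
    fix t :: real and j :: nat
    assume t: "0 < ln t" "ln t / ln 2 + 3 \<le> (ln t)\<^sup>2" "1 < t" and j: "t \<le> 2 ^ j" "2 ^ j \<le> 2 * t"
    have "real j * ln 2 \<le> ln 2 + ln t"
      using j(2) t(3) ln_mono[of "2 ^ j" "2 * t"] by (simp add: ln_realpow ln_mult)
    then have "real j \<le> ln t / ln 2 + 1" by (simp add: field_simps)
    then have "ln (real j + 2) \<le> ln ((ln t)\<^sup>2)" using t by (intro ln_mono) auto
    also have "\<dots> = 2 * ln (ln t)" using t by (simp add: ln_realpow)
    finally have "2 ^ j * ln (real j + 2) \<le> (2 * t) * (2 * ln (ln t))"
      using j t by (intro mult_mono) auto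
    also have "\<dots> = 2\<^sup>2 * (t * ln (ln t))" by simp
    finally have "sqrt (2 ^ j * ln (real j + 2)) \<le> sqrt (2\<^sup>2 * (t * ln (ln t)))" by simp
    then show "sqrt (2 ^ j * ln (real j + 2)) \<le> 2 * sqrt (t * ln (ln t))"
      by (simp add: real_sqrt_mult)
  qed
qed

section \<open>Bounds for the excess in continuous time\<close>

context perturbed_learning begin

text \<open>Lower semicontinuity is enough: the action that attains the maximum at \<open>t\<close>
  is kept fixed, which gives a continuous minorant of the excess that coincides with it at
  \<open>t\<close>.\<close>

lemma excess_grid_eventually:
  assumes \<omega>: "\<omega> \<in> space M" "\<And>\<alpha>. continuous_on {0..} (\<lambda>t. I \<alpha> t \<omega>)" and t: "t \<ge> 0" and a: "a < excess t \<omega>"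
  shows "\<forall>\<^sub>F l in sequentially. a < excess (grid l (grid_index l t)) \<omega>"
proof -
  define f where "f \<alpha> t = cum_payoff t \<omega> $ \<alpha> - (LINT s:{0..t}|lborel. v s \<omega> \<bullet> choice s \<omega>) - penalty_range h / \<eta> t
    - (sigma_max (\<lambda>s. \<sigma> s \<omega>))\<^sup>2 * (real CARD('n) / (2 * K)) * (LINT s:{0..t}|lborel. \<eta> s)" for \<alpha> t
  have excess_eq: "excess u \<omega> = (MAX \<alpha>. cum_payoff u \<omega> $ \<alpha>) - (LINT s:{0..u}|lborel. v s \<omega> \<bullet> choice s \<omega>) - penalty_range h / \<eta> u
    - (sigma_max (\<lambda>s. \<sigma> s \<omega>))\<^sup>2 * (real CARD('n) / (2 * K)) * (LINT s:{0..u}|lborel. \<eta> s)" if "u \<ge> 0" for u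
    using that by (simp add: excess_def Reg_def cum_payoff_nth[OF \<omega>(1)])
  have f_le: "f \<alpha> u \<le> excess u \<omega>" if "u \<ge> 0" for \<alpha> u
    using Max_ge[of "range (\<lambda>\<alpha>. cum_payoff u \<omega> $ \<alpha>)" "cum_payoff u \<omega> $ \<alpha>"]
    by (simp add: excess_eq[OF that] f_def)
  have "(MAX \<alpha>. cum_payoff t \<omega> $ \<alpha>) \<in> range (\<lambda>\<alpha>. cum_payoff t \<omega> $ \<alpha>)"
    by (intro Max_in) auto
  then obtain \<alpha> where "(MAX \<alpha>. cum_payoff t \<omega> $ \<alpha>) = cum_payoff t \<omega> $ \<alpha>" by blast
  then have \<alpha>: "a < f \<alpha> t" using a by (simp add: excess_eq[OF t] f_def)
  have "continuous_on {0..} (f \<alpha>)"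
  proof -
    have "set_integrable lborel {0..u} (\<lambda>s. v s \<omega> \<bullet> choice s \<omega>)" if "u \<ge> 0" for u
      using norm_prob_simplex_le[OF choice_simplex] that
      by (intro set_integrable_inner_bounded payoff_integrable choice_set_measurable \<omega>) auto
    moreover have "\<eta> u \<noteq> 0" if "u \<in> {0..}" for u using rate_pos[of u] that by simp
    ultimately show ?thesis
      unfolding f_def cum_payoff_def
      by (intro continuous_intros continuous_on_indefinite_integral payoff_integrable[OF \<omega>(1)]
          rate_continuous rate_integrable continuous_on_component) auto
  qed
  from order_tendstoD(1)[OF grid_tendsto_of_continuous[OF this t] \<alpha>]
  show ?thesis
    by eventually_elim (use f_le[of "grid l (grid_index l t)" \<alpha> for l] in \<open>force intro: less_le_trans\<close>)
qed

text \<open>Covering the paths whose excess passes \<open>a\<close> somewhere in {0..T} by an event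
  \<open>B\<close> avoids asking whether this uncountable union is itself measurable.\<close>

lemma excess_tail:
  assumes "a > 0" "T > 0"
  shows "\<exists>B\<in>events. prob B \<le> 4 * real CARD('n) * exp (- a\<^sup>2 / (8 * (real CARD('n))\<^sup>2 * C\<^sup>2 * real T))
    \<and> (AE \<omega> in M. \<forall>t\<in>{0..real T}. a < excess t \<omega> \<longrightarrow> \<omega> \<in> B)"
proof -
  let ?p = "4 * real CARD('n) * exp (- a\<^sup>2 / (8 * (real CARD('n))\<^sup>2 * C\<^sup>2 * real T))"
  have "\<exists>r :: nat \<Rightarrow> nat \<Rightarrow> nat. \<forall>l. strict_mono (r l) \<and> (AE \<omega> in M. \<forall>j a. grid l j \<le> real T \<longrightarrow>
     a < excess (grid l j) \<omega> \<longrightarrow> (\<forall>\<^sub>F m in sequentially. a < grid_fluct (r l m) (j * 2 ^ (r l m - l)) \<omega>))"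
    by (rule choice) (intro allI AE_excess_le_grid_fluct)
  then obtain r :: "nat \<Rightarrow> nat \<Rightarrow> nat" where rr: "\<forall>l. strict_mono (r l) \<and> (AE \<omega> in M. \<forall>j a. grid l j \<le> real T \<longrightarrow>
     a < excess (grid l j) \<omega> \<longrightarrow> (\<forall>\<^sub>F m in sequentially. a < grid_fluct (r l m) (j * 2 ^ (r l m - l)) \<omega>))" ..
  note r = rr[THEN spec, THEN conjunct1] and fluct = rr[THEN spec, THEN conjunct2]
  define A where "A m = {\<omega> \<in> space M. \<exists>k\<le>T * 2 ^ m. a < grid_fluct m k \<omega>}" for m
  have A: "A m \<in> events" for m unfolding A_def by measurable
  have pA: "prob (A m) \<le> ?p" for m unfolding A_def by (rule prob_grid_fluct[OF assms])
  define B' where "B' l = {\<omega> \<in> space M. \<forall>\<^sub>F m in sequentially. \<omega> \<in> A (r l m)}" for l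
  have B': "B' l \<in> events" "prob (B' l) \<le> ?p" for l
    unfolding B'_def by (rule prob_eventually_le[OF A pA])+
  \<comment> \<open>The subsequence \<open>r l\<close> changes with the coarse level, hence two
    nested limits, first in \<open>m\<close> for fixed \<open>l\<close> and then in
    \<open>l\<close>.\<close>
  define B where "B = {\<omega> \<in> space M. \<forall>\<^sub>F l in sequentially. \<omega> \<in> B' l}"
  have B: "B \<in> events" "prob B \<le> ?p"
    unfolding B_def by (rule prob_eventually_le[OF B'])+
  have "AE \<omega> in M. \<forall>l j a. grid l j \<le> real T \<longrightarrow> a < excess (grid l j) \<omega> \<longrightarrow>
     (\<forall>\<^sub>F m in sequentially. a < grid_fluct (r l m) (j * 2 ^ (r l m - l)) \<omega>)"
    using fluct by (simp add: AE_all_countable)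
  then have "AE \<omega> in M. \<forall>t\<in>{0..real T}. a < excess t \<omega> \<longrightarrow> \<omega> \<in> B"
    using AE_continuous AE_space
  proof (eventually_elim, intro ballI impI)
    fix \<omega> t
    assume 1: "\<forall>l j a. grid l j \<le> real T \<longrightarrow> a < excess (grid l j) \<omega> \<longrightarrow>
       (\<forall>\<^sub>F m in sequentially. a < grid_fluct (r l m) (j * 2 ^ (r l m - l)) \<omega>)"
      and 2: "continuous_on {0..} (\<lambda>t. W t \<omega>) \<and> (\<forall>\<alpha>. continuous_on {0..} (\<lambda>t. I \<alpha> t \<omega>))"
      and \<omega>: "\<omega> \<in> space M" and t: "t \<in> {0..real T}" and a: "a < excess t \<omega>"
    have "\<forall>\<^sub>F l in sequentially. a < excess (grid l (grid_index l t)) \<omega>"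
      using 2 t by (intro excess_grid_eventually \<omega> a) auto
    then have "\<forall>\<^sub>F l in sequentially. \<omega> \<in> B' l"
    proof eventually_elim
      case (elim l)
      let ?j = "grid_index l t"
      have le: "grid l ?j \<le> real T" using grid_index_bounds(1)[of t l] t by auto
      then have "\<forall>\<^sub>F m in sequentially. a < grid_fluct (r l m) (?j * 2 ^ (r l m - l)) \<omega>"
        using 1 elim by blast
      moreover have "\<forall>\<^sub>F m in sequentially. l \<le> r l m"
        using filterlim_subseq[OF r[of l]] by (simp add: filterlim_at_top)
      ultimately have "\<forall>\<^sub>F m in sequentially. \<omega> \<in> A (r l m)"
      proof eventually_elim
        case (elim m)
        have "real ?j \<le> real T * 2 ^ l" using le by (simp add: grid_def field_simps)
        then have "?j \<le> T * 2 ^ l" by (metis of_nat_le_iff of_nat_mult of_nat_numeral of_nat_power)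
        then have "?j * 2 ^ (r l m - l) \<le> (T * 2 ^ l) * 2 ^ (r l m - l)" by (rule mult_le_mono1)
        also have "\<dots> = T * 2 ^ r l m" using elim by (simp flip: power_add)
        finally show ?case using elim \<omega> by (auto simp: A_def)
      qed
      then show ?case using \<omega> by (simp add: B'_def)
    qed
    then show "\<omega> \<in> B" using \<omega> by (simp add: B_def)
  qed
  then show ?thesis using B by blast
qed

lemma AE_excess_le_loglog:
  "AE \<omega> in M. \<exists>c. \<forall>\<^sub>F t in at_top. excess t \<omega> \<le> c * sqrt (t * ln (ln t))"
proof -
  let ?n = "real CARD('n)"
  \<comment> \<open>Chosen so that the exponent in \<open>excess_tail\<close> at T = 2^j equals - 2
    ln (j + 2), which gives the summable bound 4 n / (j + 2)^2; the shift by 2 keeps the logarithm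
    positive at j = 0.\<close>
  define a where "a j = 4 * ?n * C * sqrt (2 ^ j * ln (real j + 2))" for j :: nat
  have a_pos: "a j > 0" for j unfolding a_def using vol_bound_pos by (intro mult_pos_pos) auto
  have exponent: "4 * ?n * exp (- (a j)\<^sup>2 / (8 * ?n\<^sup>2 * C\<^sup>2 * real (2 ^ j))) = 4 * ?n * (1 / (real j + 2)\<^sup>2)" for j
  proof -
    have "(a j)\<^sup>2 = 16 * ?n\<^sup>2 * C\<^sup>2 * (2 ^ j * ln (real j + 2))"
      by (simp add: a_def power_mult_distrib)
    then have "- (a j)\<^sup>2 / (8 * ?n\<^sup>2 * C\<^sup>2 * real (2 ^ j)) = - (2 * ln (real j + 2))"
      using vol_bound_pos by (simp add: field_simps)
    also have "\<dots> = - ln ((real j + 2)\<^sup>2)" by (simp add: ln_realpow)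
    finally show ?thesis by (simp add: exp_minus inverse_eq_divide)
  qed
  have "\<forall>j. \<exists>B\<in>events. prob B \<le> 4 * ?n * (1 / (real j + 2)\<^sup>2)
    \<and> (AE \<omega> in M. \<forall>t\<in>{0..real (2 ^ j)}. a j < excess t \<omega> \<longrightarrow> \<omega> \<in> B)"
    unfolding exponent[symmetric] by (intro allI excess_tail[OF a_pos]) simp
  then have "\<exists>B. \<forall>j. B j \<in> events \<and> prob (B j) \<le> 4 * ?n * (1 / (real j + 2)\<^sup>2)
    \<and> (AE \<omega> in M. \<forall>t\<in>{0..real (2 ^ j)}. a j < excess t \<omega> \<longrightarrow> \<omega> \<in> B j)"
    unfolding Bex_def by (rule choice)
  then obtain B where BB: "\<forall>j. B j \<in> events \<and> prob (B j) \<le> 4 * ?n * (1 / (real j + 2)\<^sup>2)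
    \<and> (AE \<omega> in M. \<forall>t\<in>{0..real (2 ^ j)}. a j < excess t \<omega> \<longrightarrow> \<omega> \<in> B j)" ..
  note B = BB[THEN spec, THEN conjunct1] BB[THEN spec, THEN conjunct2, THEN conjunct1]
    and ae = BB[THEN spec, THEN conjunct2, THEN conjunct2]
  have "summable (\<lambda>j. 1 / (real j + 2)\<^sup>2)"
  proof -
    have "summable (\<lambda>j. inverse (real (j + 2) ^ 2))"
      by (rule summable_ignore_initial_segment[OF inverse_power_summable]) simp
    then show ?thesis by (simp add: inverse_eq_divide add.commute)
  qed
  then have "summable (\<lambda>j. 4 * ?n * (1 / (real j + 2)\<^sup>2))" by (rule summable_mult)
  then have "summable (\<lambda>j. prob (B j))"
  proof (rule summable_comparison_test'[where N = 0])
    show "norm (prob (B j)) \<le> 4 * ?n * (1 / (real j + 2)\<^sup>2)" for j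
      using B(2)[of j] by simp
  qed
  then have "AE \<omega> in M. \<forall>\<^sub>F j in sequentially. \<omega> \<in> space M - B j"
    using B(1) by (intro borel_cantelli_AE1) (auto simp: emeasure_eq_measure)
  moreover have "AE \<omega> in M. \<forall>j. \<forall>t\<in>{0..real (2 ^ j)}. a j < excess t \<omega> \<longrightarrow> \<omega> \<in> B j"
    using ae by (simp add: AE_all_countable)
  ultimately show ?thesis
  proof eventually_elim
    case (elim \<omega>)
    then obtain J where J: "\<And>j t. j \<ge> J \<Longrightarrow> 0 \<le> t \<Longrightarrow> t \<le> 2 ^ j \<Longrightarrow> excess t \<omega> \<le> a j"
      by (fastforce simp: eventually_sequentially not_less)
    have "\<forall>\<^sub>F t in at_top. excess t \<omega> \<le> (8 * ?n * C) * sqrt (t * ln (ln t))"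
      using loglog_dyadic_bound eventually_ge_at_top[of "2 ^ J"]
    proof eventually_elim
      case (elim t)
      have t1: "t \<ge> 1" using elim one_le_power[of "2::real" J] by linarith
      \<comment> \<open>The least dyadic power above \<open>t\<close> overshoots by at most a factor
        2; for exponent 0 this uses t \<ge> 1.\<close>
      obtain j where j: "t \<le> 2 ^ j" "2 ^ j \<le> 2 * t" "J \<le> j"
      proof -
        define j where "j = (LEAST j. t \<le> 2 ^ j)"
        have "\<exists>j. t \<le> 2 ^ j" using real_arch_pow[of 2 t] by (auto intro: less_imp_le)
        then have 1: "t \<le> 2 ^ j" unfolding j_def by (rule LeastI_ex)
        have "2 ^ j \<le> 2 * t"
        proof (cases j)
          case (Suc i)
          then have "\<not> t \<le> 2 ^ i" using not_less_Least[of i "\<lambda>j. t \<le> 2 ^ j"] by (simp add: j_def)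
          then show ?thesis using Suc by simp
        qed (use t1 in simp)
        moreover have "J \<le> j"
          using order_trans[OF elim(2) 1] by (simp add: power_increasing_iff)
        ultimately show ?thesis using that 1 by blast
      qed
      have "excess t \<omega> \<le> a j" using J j t1 by simp
      also have "\<dots> \<le> 4 * ?n * C * (2 * sqrt (t * ln (ln t)))"
        unfolding a_def using elim(1) j vol_bound_pos by (intro mult_left_mono) auto
      finally show ?case by simp
    qed
    then show ?case by blast
  qed
qed

text \<open>On paths with \<open>sigma_max\<close> equal to 0 the O-term is identically 0, so its
  error must vanish eventually. There the volatility is 0 at all times, all transforms vanish, and
  no positive level can be passed. As \<sigma> is random, such paths may have positive
  probability.\<close>

lemma AE_excess_nonpos:
  "AE \<omega> in M. sigma_max (\<lambda>s. \<sigma> s \<omega>) = 0 \<longrightarrow> (\<forall>t\<ge>0. excess t \<omega> \<le> 0)"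
proof -
  have "AE \<omega> in M. \<exists>r. \<forall>j a. grid l j \<le> real T \<longrightarrow> a < excess (grid l j) \<omega> \<longrightarrow>
     (\<forall>\<^sub>F m in sequentially. a < grid_fluct (r m) (j * 2 ^ (r m - l)) \<omega>)" for l T
    using AE_excess_le_grid_fluct[of l "real T"] by (auto elim!: eventually_mono)
  then have "AE \<omega> in M. \<forall>l T. \<exists>r. \<forall>j a. grid l j \<le> real T \<longrightarrow> a < excess (grid l j) \<omega> \<longrightarrow>
     (\<forall>\<^sub>F m in sequentially. a < grid_fluct (r m) (j * 2 ^ (r m - l)) \<omega>)"
    by (simp add: AE_all_countable)
  then show ?thesis
    using AE_continuous AE_space
  proof (eventually_elim, intro impI allI)
    fix \<omega> and t :: real
    assume 1: "\<forall>l T. \<exists>r. \<forall>j a. grid l j \<le> real T \<longrightarrow> a < excess (grid l j) \<omega> \<longrightarrow>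
       (\<forall>\<^sub>F m in sequentially. a < grid_fluct (r m) (j * 2 ^ (r m - l)) \<omega>)"
      and 2: "continuous_on {0..} (\<lambda>t. W t \<omega>) \<and> (\<forall>\<alpha>. continuous_on {0..} (\<lambda>t. I \<alpha> t \<omega>))"
      and \<omega>: "\<omega> \<in> space M" and S: "sigma_max (\<lambda>s. \<sigma> s \<omega>) = 0" and t: "0 \<le> t"
    have "\<sigma> s \<omega> $ \<alpha> = 0" if "s \<ge> 0" for s \<alpha>
      using vol_sigma_max[OF \<omega> that, of \<alpha>] vol_nonneg[OF \<omega> that, of \<alpha>] S by simp
    then have fluct0: "grid_fluct m k \<omega> = 0" for m k
      by (simp add: grid_fluct_def grid_noise_def walk_def)
    have grid: "excess (grid l j) \<omega> \<le> 0" for l j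
    proof (rule ccontr)
      assume "\<not> excess (grid l j) \<omega> \<le> 0"
      moreover obtain T where "grid l j \<le> real T" using real_arch_simple by blast
      ultimately show False using 1[rule_format, of l T] by (auto simp: fluct0 not_le)
    qed
    show "excess t \<omega> \<le> 0"
    proof (rule ccontr)
      assume "\<not> excess t \<omega> \<le> 0"
      then have "\<forall>\<^sub>F l in sequentially. 0 < excess (grid l (grid_index l t)) \<omega>"
        using 2 by (intro excess_grid_eventually \<omega> t) auto
      then show False using grid by (simp add: not_less[symmetric])
    qed
  qed
qed

theorem AE_regret_bound:
  "AE \<omega> in M. \<exists>r. r \<in> O[at_top](\<lambda>t. sigma_max (\<lambda>s. \<sigma> s \<omega>) * sqrt (t * ln (ln t))) \<and>
     (\<forall>t\<ge>0. Reg (\<lambda>s. v s \<omega>) (\<lambda>s. choice s \<omega>) t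
        \<le> penalty_range h / \<eta> t
          + (sigma_max (\<lambda>s. \<sigma> s \<omega>))\<^sup>2 * (real CARD('n) / (2 * K)) * (LINT s:{0..t}|lborel. \<eta> s)
          + r t)"
  using AE_excess_le_loglog AE_excess_nonpos AE_space
proof eventually_elim
  case (elim \<omega>)
  let ?S = "sigma_max (\<lambda>s. \<sigma> s \<omega>)" and ?g = "\<lambda>t. sqrt (t * ln (ln t))"
  from elim(1) obtain c where c: "\<forall>\<^sub>F t in at_top. excess t \<omega> \<le> c * ?g t" by blast
  \<comment> \<open>The O-statement is two-sided whereas the excess is only bounded from above, so
    the error is its positive part.\<close>
  define r where "r t = max 0 (excess t \<omega>)" for t
  have "r \<in> O[at_top](\<lambda>t. ?S * ?g t)"
  proof (cases "?S = 0")
    case True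
    have "\<forall>\<^sub>F t in at_top. norm (r t) \<le> 0 * norm (?S * ?g t)"
      using eventually_ge_at_top[of 0] by eventually_elim (use elim(2) True in \<open>simp add: r_def\<close>)
    then show ?thesis by (rule bigoI)
  next
    case False
    then have S: "?S > 0" using sigma_max_nonneg[OF elim(3)] by simp
    have pos: "\<forall>\<^sub>F t :: real in at_top. 0 \<le> ?g t" by real_asymp
    \<comment> \<open>The tails were computed with the deterministic bound \<open>C\<close>;
      dividing by \<open>?S\<close> moves the discrepancy into the path-dependent constant.\<close>
    have "\<forall>\<^sub>F t in at_top. norm (r t) \<le> (\<bar>c\<bar> / ?S) * norm (?S * ?g t)"
      using c pos
    proof eventually_elim
      case (elim t)
      have "c * ?g t \<le> \<bar>c\<bar> * ?g t" using elim(2) by (intro mult_right_mono) auto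
      then have "norm (r t) \<le> \<bar>c\<bar> * ?g t" using elim by (simp add: r_def)
      also have "\<dots> = (\<bar>c\<bar> / ?S) * norm (?S * ?g t)" using S elim(2) by (simp add: abs_mult)
      finally show ?case .
    qed
    then show ?thesis by (rule bigoI)
  qed
  moreover have "excess t \<omega> \<le> r t" for t by (simp add: r_def)
  ultimately show ?case
    by (intro exI[of _ r]) (auto simp: excess_def algebra_simps)
qed

end

text \<open>After division by t each term vanishes: the first because t \<eta>(t) tends to infinity,
  the second as the mean of a function tending to 0, the third because the root of t log log t is
  o(t).\<close>

lemma Limsup_mean_regret_le_0:
  fixes R r \<eta> :: "real \<Rightarrow> real"
  assumes R: "\<And>t. t \<ge> 0 \<Longrightarrow> R t \<le> \<Omega> / \<eta> t + c * (LINT s:{0..t}|lborel. \<eta> s) + r t"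
    and r: "r \<in> O[at_top](\<lambda>t. S * sqrt (t * ln (ln t)))"
    and pos: "\<And>t. t \<ge> 0 \<Longrightarrow> \<eta> t > 0" and int: "\<And>t. set_integrable lborel {0..t} \<eta>"
    and lim: "filterlim (\<lambda>t. t * \<eta> t) at_top at_top" "(\<eta> \<longlongrightarrow> 0) at_top"
  shows "Limsup at_top (\<lambda>t. ereal (1 / t * R t)) \<le> 0"
proof -
  define u where "u t = \<Omega> / (t * \<eta> t) + c * ((LINT s:{0..t}|lborel. \<eta> s) / t) + r t / t" for t
  have "r \<in> o[at_top](\<lambda>t. t)"
  proof (rule landau_o.big_small_trans[OF r])
    show "(\<lambda>t. S * sqrt (t * ln (ln t))) \<in> o[at_top](\<lambda>t. t :: real)"
      by (cases "S = 0") (simp, real_asymp)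
  qed
  then have "((\<lambda>t. r t / t) \<longlongrightarrow> 0) at_top" by (rule smalloD_tendsto)
  moreover have "((\<lambda>t. \<Omega> / (t * \<eta> t)) \<longlongrightarrow> 0) at_top"
    by (rule tendsto_divide_0[OF tendsto_const filterlim_at_top_imp_at_infinity[OF lim(1)]])
  moreover have "((\<lambda>t. (LINT s:{0..t}|lborel. \<eta> s) / t) \<longlongrightarrow> 0) at_top"
    using pos by (intro integral_mean_tendsto_0 int lim(2)) (auto intro: less_imp_le)
  ultimately have "(u \<longlongrightarrow> 0 + c * 0 + 0) at_top"
    unfolding u_def by (intro tendsto_intros)
  then have "Limsup at_top (\<lambda>t. ereal (u t)) = ereal 0"
    by (intro lim_imp_Limsup) auto
  moreover have "\<forall>\<^sub>F t in at_top. ereal (1 / t * R t) \<le> ereal (u t)"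
    using eventually_gt_at_top[of 0]
  proof eventually_elim
    case (elim t)
    then have "1 / t * R t \<le> 1 / t * (\<Omega> / \<eta> t + c * (LINT s:{0..t}|lborel. \<eta> s) + r t)"
      using R[of t] by (intro mult_left_mono) auto
    also have "\<dots> = u t" by (simp add: u_def distrib_left)
    finally show ?case by simp
  qed
  ultimately show ?thesis using Limsup_mono by (metis zero_ereal_def)
qed

theorem theorem3p1:
  fixes M :: "'w measure" and F :: "real \<Rightarrow> 'w measure"
    and h :: "real ^ 'n \<Rightarrow> real" and K :: real
    and W v \<sigma> Y X :: "real \<Rightarrow> 'w \<Rightarrow> real ^ 'n"
    and \<eta> \<eta>' :: "real \<Rightarrow> real"
  assumes "prob_space M" and "filtration (space M) F" and "\<And>t. subalgebra M (F t)"
    and "wiener_process M F W"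
    and "penalty_function K h"
    and "progressively_measurable F v"
    and "\<And>\<omega> t. \<omega> \<in> space M \<Longrightarrow> t \<ge> 0 \<Longrightarrow> set_integrable lborel {0..t} (\<lambda>s. v s \<omega>)"
    and "adapted_process F \<sigma>"
    and "\<And>\<omega>. \<omega> \<in> space M \<Longrightarrow> continuous_on {0..} (\<lambda>t. \<sigma> t \<omega>)"
    and "\<And>\<omega> t \<alpha>. \<omega> \<in> space M \<Longrightarrow> t \<ge> 0 \<Longrightarrow> 0 \<le> \<sigma> t \<omega> $ \<alpha>"
    and "\<exists>C. \<forall>\<omega>\<in>space M. \<forall>t\<ge>0. \<forall>\<alpha>. \<sigma> t \<omega> $ \<alpha> \<le> C"
    and "\<And>t. t \<ge> 0 \<Longrightarrow> \<eta> t > 0"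
    and "\<And>t. t \<ge> 0 \<Longrightarrow> (\<eta> has_real_derivative \<eta>' t) (at t within {0..})"
    and "continuous_on {0..} \<eta>'"
    and "antimono_on {0..} \<eta>"
    and "filterlim (\<lambda>t. t * \<eta> t) at_top at_top"
    and "(\<eta> \<longlongrightarrow> 0) at_top"
    and "score_process M W v \<sigma> Y"
    and "\<And>\<omega> t. \<omega> \<in> space M \<Longrightarrow> t \<ge> 0 \<Longrightarrow> X t \<omega> = choice_map h (\<eta> t *\<^sub>R Y t \<omega>)"
  shows "(AE \<omega> in M. Limsup at_top (\<lambda>t. ereal (1 / t * Reg (\<lambda>s. v s \<omega>) (\<lambda>s. X s \<omega>) t)) \<le> 0)
    \<and> (AE \<omega> in M. \<exists>r. r \<in> O[at_top](\<lambda>t. sigma_max (\<lambda>s. \<sigma> s \<omega>) * sqrt (t * ln (ln t))) \<and>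
         (\<forall>t\<ge>0. Reg (\<lambda>s. v s \<omega>) (\<lambda>s. X s \<omega>) t
            \<le> penalty_range h / \<eta> t
              + (sigma_max (\<lambda>s. \<sigma> s \<omega>))\<^sup>2 * (real CARD('n) / (2 * K)) * (LINT s:{0..t}|lborel. \<eta> s)
              + r t))"
proof -
  obtain C0 where "\<forall>\<omega>\<in>space M. \<forall>t\<ge>0. \<forall>\<alpha>. \<sigma> t \<omega> $ \<alpha> \<le> C0"
    using assms(11) by blast
  \<comment> \<open>Taking the maximum with 1 provides the positive bound required by the
    locale.\<close>
  then have C0: "\<And>\<omega> t \<alpha>. \<omega> \<in> space M \<Longrightarrow> t \<ge> 0 \<Longrightarrow> \<sigma> t \<omega> $ \<alpha> \<le> max C0 1"
    by (simp add: le_max_iff_disj)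
  obtain I where ito: "\<And>\<alpha>. ito_integral M (\<lambda>t \<omega>. W t \<omega> $ \<alpha>) (\<lambda>t \<omega>. \<sigma> t \<omega> $ \<alpha>) (I \<alpha>)"
    and Y: "\<And>\<alpha>. AE \<omega> in M. \<forall>t\<ge>0. Y t \<omega> $ \<alpha> = (LINT s:{0..t}|lborel. v s \<omega> $ \<alpha>) + I \<alpha> t \<omega>"
    using assms(18) unfolding score_process_def by blast
  have cont: "continuous_on {0..} \<eta>" by (rule DERIV_continuous_on) (use assms(13) in auto)
  interpret perturbed_learning M F h K "max C0 1" W v \<sigma> I \<eta>
    by (intro perturbed_learning.intro perturbed_learning_axioms.intro assms(1-10,12,15) C0 ito cont)
      simp_all
  \<comment> \<open>Finitely many actions share one null set; off it \<open>X\<close> and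
    \<open>choice\<close> agree at every time t \<ge> 0, so their regrets coincide.\<close>
  have "AE \<omega> in M. \<forall>\<alpha>. \<forall>t\<ge>0. Y t \<omega> $ \<alpha> = (LINT s:{0..t}|lborel. v s \<omega> $ \<alpha>) + I \<alpha> t \<omega>"
    using Y by (simp add: AE_all_countable)
  then have Reg_eq: "AE \<omega> in M. \<forall>t\<ge>0. Reg (\<lambda>s. v s \<omega>) (\<lambda>s. X s \<omega>) t = Reg (\<lambda>s. v s \<omega>) (\<lambda>s. choice s \<omega>) t"
    using AE_space
  proof eventually_elim
    case (elim \<omega>)
    have "X t \<omega> = choice t \<omega>" if "t \<ge> 0" for t
    proof -
      have "Y t \<omega> = cum_payoff t \<omega> + (\<chi> \<alpha>. I \<alpha> t \<omega>)"
        using elim that by (simp add: vec_eq_iff cum_payoff_nth)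
      then show ?thesis using assms(19)[OF elim(2) that] by (simp add: choice_def)
    qed
    then show ?case
      unfolding Reg_def by (auto intro!: set_lebesgue_integral_cong)
  qed
  let ?bound = "\<lambda>\<omega> r. r \<in> O[at_top](\<lambda>t. sigma_max (\<lambda>s. \<sigma> s \<omega>) * sqrt (t * ln (ln t))) \<and>
         (\<forall>t\<ge>0. Reg (\<lambda>s. v s \<omega>) (\<lambda>s. X s \<omega>) t
            \<le> penalty_range h / \<eta> t
              + (sigma_max (\<lambda>s. \<sigma> s \<omega>))\<^sup>2 * (real CARD('n) / (2 * K)) * (LINT s:{0..t}|lborel. \<eta> s)
              + r t)"
  have bound: "AE \<omega> in M. \<exists>r. ?bound \<omega> r"
    using AE_regret_bound Reg_eq by eventually_elim simp
  moreover from bound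
  have "AE \<omega> in M. Limsup at_top (\<lambda>t. ereal (1 / t * Reg (\<lambda>s. v s \<omega>) (\<lambda>s. X s \<omega>) t)) \<le> 0"
  proof eventually_elim
    case (elim \<omega>)
    then show ?case
      using assms(12,16,17) rate_integrable by (blast intro: Limsup_mean_regret_le_0)
  qed
  ultimately show ?thesis by simp
qed

end
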